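(* Assume hypotheses (H) and (G). Then for all $r\ge3$, $$T_r(x)=\mathbb O(x)\,T_{r-1}(x)-\mathbb S(x)\,T_{r-2}(x)+\mathbb O(x)^{r-2}\,\mathbb S(x).$$
   Context: For integers $N,r\ge1$ let $S_{N,r}=\{(n_1,\dots,n_r)\in\mathbb Z^r:\ n_1+\dots+n_r=N,\ \text{each } n_i\ge3 \text{ odd}\}$; when used as an index set it is ordered lexicographically decreasingly. For $m=(m_1,\dots,m_r)$ and $n=(n_1,\dots,n_r)$ let $\delta\binom{m}{n}=1$ if $m_i=n_i$ for all $i$, and $0$ otherwise. $\mathbf V_{N,r}$ is the $\mathbb Q$-span of the monomials $x_1^{n_1-1}\cdots x_r^{n_r-1}$ with $(n_1,\dots,n_r)\in S_{N,r}$. $\mathsf{Vect}_{N,r}=\mathbb Q^{S_{N,r}}$ (row vectors), and $\pi:\mathbf V_{N,r}\to\mathsf{Vect}_{N,r}$ is the isomorphism sending $\sum a_{n_1,\dots,n_r}x_1^{n_1-1}\cdots x_r^{n_r-1}$ to $(a_{n_1,\dots,n_r})_{(n_1,\dots,n_r)\in S_{N,r}}$. For $r\ge2$, $\mathbf W_{N,r}=\{P\in\mathbf V_{N,r}: P(x_1,\dots,x_r)=P(x_2-x_1,x_2,x_3,\dots,x_r)-P(x_2-x_1,x_1,x_3,\dots,x_r)\}$. Ihara action: for $f\in\mathbb Q[t]$ and a polynomial $g$ in $r-1$ variables, $(f\mathbin{\underline\circ}g)(x_1,\dots,x_r)=f(x_1)g(x_2,\dots,x_r)+\sum_{i=1}^{r-1}\big(f(x_{i+1}-x_i)g(x_1,\dots,\widehat{x_{i+1}},\dots,x_r)-(-1)^{\deg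 f}f(x_i-x_{i+1})g(x_1,\dots,\widehat{x_i},\dots,x_r)\big)$ (hats denote omitted variables). For positive integers $m_i,n_i$, $e\binom{m_1,\dots,m_r}{n_1,\dots,n_r}$ is the coefficient of $x_1^{n_1-1}\cdots x_r^{n_r-1}$ in $t^{m_1-1}\mathbin{\underline\circ}\,(y_1^{m_2-1}\cdots y_{r-1}^{m_r-1})$. $E_{N,r}$ is the $S_{N,r}\times S_{N,r}$ matrix with $(m,n)$-entry $e\binom{m}{n}$. For $2\le j\le r$, $E^{(j)}_{N,r}$ is the $S_{N,r}\times S_{N,r}$ matrix with $(m,n)$-entry $\delta\binom{m_1,\dots,m_{r-j}}{n_1,\dots,n_{r-j}}\,e\binom{m_{r-j+1},\dots,m_r}{n_{r-j+1},\dots,n_r}$ (so $E^{(r)}_{N,r}=E_{N,r}$). $C_{N,r}=E^{(2)}_{N,r}E^{(3)}_{N,r}\cdots E^{(r-1)}_{N,r}E_{N,r}$ (so $C_{N,2}=E_{N,2}$), and $F_{N,r}=E_{N,r}-\mathrm{id}$. For a matrix $A$, $\ker A$ denotes its right kernel. The restricted totally even part of a polynomial is the sum of its monomials in which every variable $x_1,\dots,x_r$ occurs with even exponent $\ge2$. For $1\le j\le r$, $\phi^{(j)}_{N,r}:\mathbf V_{N,r}\to\mathbf V_{N,r}$ is the linear map sending $Q$ to the restricted totally even part of $Q(x_1,\dots,x_r)+\sum_{i=r-j+1}^{r-1}\big(Q(x_1,\dots,x_{r-j},x_{i+1}-x_i,x_{r-j+1},\dots,\widehat{x_{i+1}},\dots,x_r)-Q(x_1,\dots,x_{r-j},x_{i+1}-x_i,x_{r-j+1},\dots,\widehat{x_i},\dots,x_r)\big)$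 (in each term the argument list after $x_{i+1}-x_i$ is $x_{r-j+1},\dots,x_r$ with one variable omitted). $\mathbb O(x)=\frac{x^3}{1-x^2}$, $\mathbb S(x)=\frac{x^{12}}{(1-x^4)(1-x^6)}$. For $r\ge2$, $T_r(x)=\sum_{N>0}\dim_{\mathbb Q}\ker C_{N,r}\,x^N$, and $T_0(x)=T_1(x)=0$. It is known (Tasaka) that for $r\ge2$ and $P\in\mathbf W_{N,r}$, $\pi(P)F_{N,r}$ lies in the left kernel $\{v: vE_{N,r}=0\}$; and it is known (Baumard–Schneps) that $\pi(\mathbf W_{N,2})=\{v: vE_{N,2}=0\}$, with $\sum_N\dim\mathbf W_{N,2}x^N=\mathbb S(x)$. Hypothesis (H): for all $N$ and all $r\ge2$ the linear map $\mathbf W_{N,r}\to\{v\in\mathsf{Vect}_{N,r}: vE_{N,r}=0\}$, $P\mapsto\pi(P)F_{N,r}$, is injective. Hypothesis (G): for all $r\ge3$ and all $N$, $\big(\phi^{(r-1)}_{N,r}\circ\cdots\circ\phi^{(2)}_{N,r}\big)(\mathbf W_{N,r})=\ker\phi^{(r)}_{N,r}\cap\big(\phi^{(r-1)}_{N,r}\circ\cdots\circ\phi^{(2)}_{N,r}\big)(\mathbf V_{N,r})$. *)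

theory Defs
  imports "HOL-Library.Poly_Mapping" "HOL-Library.Function_Algebras"
    "HOL-Computational_Algebra.Polynomial"
    "HOL-Computational_Algebra.Formal_Power_Series"
begin

text \<open>Polynomials in the variables x_1, x_2, ... over Q; variable x_k is encoded as
  index k-1. A monomial is an exponent map nat =>0 nat.\<close>

type_synonym mpoly = "(nat \<Rightarrow>\<^sub>0 nat) \<Rightarrow>\<^sub>0 rat"

definition const :: "rat \<Rightarrow> mpoly" where
  "const c = Poly_Mapping.single 0 c"

definition var :: "nat \<Rightarrow> mpoly" where
  "var i = Poly_Mapping.single (Poly_Mapping.single i 1) 1"

definition expo :: "nat list \<Rightarrow> (nat \<Rightarrow>\<^sub>0 nat)" where
  "expo a = Poly_Mapping.nth a"

definition mono :: "nat list \<Rightarrow> mpoly" where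
  "mono a = Poly_Mapping.single (expo a) 1"

definition psubst :: "(nat \<Rightarrow> mpoly) \<Rightarrow> mpoly \<Rightarrow> mpoly" where
  "psubst \<sigma> p = (\<Sum>m\<in>Poly_Mapping.keys p. const (Poly_Mapping.lookup p m) * (\<Prod>i\<in>Poly_Mapping.keys m. \<sigma> i ^ Poly_Mapping.lookup m i))"

definition upoly_at :: "rat poly \<Rightarrow> mpoly \<Rightarrow> mpoly" where
  "upoly_at f L = (\<Sum>k\<le>Polynomial.degree f. const (coeff f k) * L ^ k)"

text \<open>Shift map realizing an omitted variable: the variables y_0, y_1, ... of g
  are sent to x_0, ..., with x_k omitted (0-indexed).\<close>
definition omit :: "nat \<Rightarrow> nat \<Rightarrow> nat" where
  "omit k j = (if j < k then j else Suc j)"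

definition omitted :: "nat \<Rightarrow> mpoly \<Rightarrow> mpoly" where
  "omitted k g = psubst (\<lambda>j. var (omit k j)) g"

definition S :: "nat \<Rightarrow> nat \<Rightarrow> nat list set" where
  "S N r = {n. length n = r \<and> sum_list n = N \<and> (\<forall>k\<in>set n. odd k \<and> 3 \<le> k)}"

definition dec :: "nat list \<Rightarrow> nat list" where
  "dec n = map (\<lambda>k. k - 1) n"

definition V :: "nat \<Rightarrow> nat \<Rightarrow> mpoly set" where
  "V N r = {P. Poly_Mapping.keys P \<subseteq> (\<lambda>n. expo (dec n)) ` S N r}"

definition W :: "nat \<Rightarrow> nat \<Rightarrow> mpoly set" where
  "W N r = {P \<in> V N r.
     P = psubst (\<lambda>i. if i = 0 then var 1 - var 0 else if i = 1 then var 1 else var i) P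
       - psubst (\<lambda>i. if i = 0 then var 1 - var 0 else if i = 1 then var 0 else var i) P}"

text \<open>Row vectors in Vect_{N,r} = Q^{S_{N,r}} are functions nat list => rat
  vanishing outside S_{N,r}.\<close>
definition piV :: "nat \<Rightarrow> nat \<Rightarrow> mpoly \<Rightarrow> (nat list \<Rightarrow> rat)" where
  "piV N r P = (\<lambda>n. if n \<in> S N r then Poly_Mapping.lookup P (expo (dec n)) else 0)"

definition ihara :: "nat \<Rightarrow> rat poly \<Rightarrow> mpoly \<Rightarrow> mpoly" where
  "ihara r f g = upoly_at f (var 0) * omitted 0 g
     + (\<Sum>i<r - 1. upoly_at f (var (Suc i) - var i) * omitted (Suc i) g
          - (-1) ^ Polynomial.degree f * upoly_at f (var i - var (Suc i)) * omitted i g)"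

definition ecoef :: "nat list \<Rightarrow> nat list \<Rightarrow> rat" where
  "ecoef m n = Poly_Mapping.lookup (ihara (length m) (monom 1 (hd m - 1)) (mono (dec (tl m)))) (expo (dec n))"

type_synonym mat = "nat list \<Rightarrow> nat list \<Rightarrow> rat"

definition matmul :: "nat list set \<Rightarrow> mat \<Rightarrow> mat \<Rightarrow> mat" where
  "matmul I A B = (\<lambda>m n. \<Sum>k\<in>I. A m k * B k n)"

definition Emat :: "nat \<Rightarrow> nat \<Rightarrow> mat" where
  "Emat N r = (\<lambda>m n. ecoef m n)"

definition Ej :: "nat \<Rightarrow> nat \<Rightarrow> nat \<Rightarrow> mat" where
  "Ej N r j = (\<lambda>m n. (if take (r - j) m = take (r - j) n then 1 else 0)
                     * ecoef (drop (r - j) m) (drop (r - j) n))"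

definition Cmat :: "nat \<Rightarrow> nat \<Rightarrow> mat" where
  "Cmat N r = foldr (\<lambda>j A. matmul (S N r) (Ej N r j) A) [2..<r] (Emat N r)"

definition Fmat :: "nat \<Rightarrow> nat \<Rightarrow> mat" where
  "Fmat N r = (\<lambda>m n. Emat N r m n - (if m = n then 1 else 0))"

definition rowmul :: "nat list set \<Rightarrow> (nat list \<Rightarrow> rat) \<Rightarrow> mat \<Rightarrow> (nat list \<Rightarrow> rat)" where
  "rowmul I v A = (\<lambda>n. if n \<in> I then (\<Sum>m\<in>I. v m * A m n) else 0)"

definition rkernel :: "nat list set \<Rightarrow> mat \<Rightarrow> (nat list \<Rightarrow> rat) set" where
  "rkernel I A = {v. (\<forall>n. n \<notin> I \<longrightarrow> v n = 0) \<and> (\<forall>m\<in>I. (\<Sum>n\<in>I. A m n * v n) = 0)}"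

definition lkernel :: "nat list set \<Rightarrow> mat \<Rightarrow> (nat list \<Rightarrow> rat) set" where
  "lkernel I A = {v. (\<forall>n. n \<notin> I \<longrightarrow> v n = 0) \<and> rowmul I v A = 0}"

definition qdim :: "(nat list \<Rightarrow> rat) set \<Rightarrow> nat" where
  "qdim K = vector_space.dim (\<lambda>(c::rat) (v::nat list \<Rightarrow> rat). (\<lambda>x. c * v x)) K"

definition rtep :: "nat \<Rightarrow> mpoly \<Rightarrow> mpoly" where
  "rtep r P = (\<Sum>m\<in>{m\<in>Poly_Mapping.keys P. \<forall>i<r. even (Poly_Mapping.lookup m i) \<and> 2 \<le> Poly_Mapping.lookup m i}.
                 Poly_Mapping.single m (Poly_Mapping.lookup P m))"

text \<open>Substitution Q(x_1,..,x_{r-j}, x_{i+1}-x_i, x_{r-j+1},..,(omitted),..,x_r),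
  with i0 = i - 1 the 0-indexed position of x_i and o the position (relative to
  x_{r-j+1}) of the omitted variable.\<close>
definition phisubst :: "nat \<Rightarrow> nat \<Rightarrow> nat \<Rightarrow> nat \<Rightarrow> nat \<Rightarrow> mpoly" where
  "phisubst r j i0 om p =
     (if p < r - j then var p
      else if p = r - j then var (Suc i0) - var i0
      else var (r - j + omit om (p - (r - j + 1))))"

definition phi :: "nat \<Rightarrow> nat \<Rightarrow> nat \<Rightarrow> mpoly \<Rightarrow> mpoly" where
  "phi N r j Q = rtep r (Q + (\<Sum>i0\<in>{r - j..<r - 1}.
       psubst (phisubst r j i0 (Suc i0 - (r - j))) Q
     - psubst (phisubst r j i0 (i0 - (r - j))) Q))"

definition phicomp :: "nat \<Rightarrow> nat \<Rightarrow> mpoly \<Rightarrow> mpoly" where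
  "phicomp N r = fold (\<lambda>j f. phi N r j \<circ> f) [2..<r] id"

definition hypH :: bool where
  "hypH \<longleftrightarrow> (\<forall>N r. 2 \<le> r \<longrightarrow>
      inj_on (\<lambda>P. rowmul (S N r) (piV N r P) (Fmat N r)) (W N r))"

definition hypG :: bool where
  "hypG \<longleftrightarrow> (\<forall>N r. 3 \<le> r \<longrightarrow>
      phicomp N r ` W N r = {Q \<in> V N r. phi N r r Q = 0} \<inter> phicomp N r ` V N r)"

definition Oser :: "rat fps" where
  "Oser = fps_X ^ 3 / (1 - fps_X ^ 2)"

definition Sser :: "rat fps" where
  "Sser = fps_X ^ 12 / ((1 - fps_X ^ 4) * (1 - fps_X ^ 6))"

definition Tser :: "nat \<Rightarrow> rat fps" where
  "Tser r = (if r < 2 then 0 else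
     Abs_fps (\<lambda>N. if N = 0 then 0 else of_nat (qdim (rkernel (S N r) (Cmat N r)))))"

end

theory Submission
  imports Defs
begin

text \<open>
  Write \<open>d(N,r)\<close> for the dimension of the left kernel of \<open>C\<^bsub>N,r\<^esub>\<close>, which is also that of its right kernel.
  Up to \<open>\<pi>\<close>, multiplication of row vectors by \<open>E\<^sup>(\<^sup>j\<^sup>)\<close> is \<open>\<phi>\<^sup>(\<^sup>j\<^sup>)\<close>. Put \<open>A = E\<^sup>(\<^sup>2\<^sup>) \<dots> E\<^sup>(\<^sup>r\<^sup>-\<^sup>1\<^sup>)\<close>,
  so that \<open>C = A E\<close>. Then \<open>d(N,r)\<close> is the dimension of the left kernel of \<open>A\<close> plus that of the
  part of the image of \<open>A\<close> killed by \<open>E\<close>. As \<open>A\<close> is block diagonal in the first coordinate, with blocks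
  \<open>C\<^bsub>N-n,r-1\<^esub>\<close>, the first summand contributes \<open>O T\<^bsub>r-1\<^esub>\<close>. By (G) the second is the dimension of the
  image of \<open>\<pi>(W)\<close> under \<open>A\<close>. Here \<open>W\<^bsub>N,r\<^esub>\<close> is the sum of the \<open>W\<^bsub>a,2\<^esub> \<otimes> V\<^bsub>N-a,r-2\<^esub>\<close>, the factors
  \<open>E\<^sup>(\<^sup>2\<^sup>), \<dots>, E\<^sup>(\<^sup>r\<^sup>-\<^sup>2\<^sup>)\<close> act on the second tensor factor as \<open>C\<^bsub>N-a,r-2\<^esub>\<close>, and on \<open>W\<close> the last factor
  \<open>\<phi>\<^sup>(\<^sup>r\<^sup>-\<^sup>1\<^sup>)\<close> equals \<open>- (\<phi>\<^sup>(\<^sup>r\<^sup>) - id)\<close>, which is injective by (H).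

  The dimension of \<open>W\<^bsub>N,2\<^esub>\<close> is that of the even period polynomials of degree \<open>w = N - 2\<close> without
  extremal terms. They form the kernel of a map from the even antisymmetric polynomials onto the
  sign-isotypic part of the binary forms of degree \<open>w\<close> under the group \<open>S\<^sub>3\<close> permuting
  \<open>x\<close>, \<open>y\<close>, \<open>x - y\<close> up to sign; surjectivity holds because no nonzero functional on binary forms of
  positive degree is invariant under \<open>SL\<^sub>2(\<int>)\<close>.
\<close>

section \<open>Linear algebra in spaces of functions\<close>

text \<open>Two rank-nullity counts for \<open>A\<close> share one image: by (G), \<open>A\<close>
  maps the left kernel of \<open>C\<close> and pi(W) onto the same space. Hence d(N,r) minus the
  dimension of ker A equals dim W minus the dimension of the part of pi(W) killed by
  \<open>A\<close>. That part has generating series S T_{r-2}, and dim W has O^{r-2} S. The identity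
  stays additive over the naturals until it is read off as power series.

  The obstacle is that (H) speaks about vectors of pi(W), whereas the factor E^(r-1) meets a vector
  already multiplied by E^(2) ... E^(r-2). So pi(W) has to be stable under these factors. It is,
  because the relation defining W involves only x_1 and x_2, and these factors mix only the last r-2
  coordinates.

  For N = 2h+2 the dimension of W_{N,2} comes out as (h-1) div 2 - h div 3. The minuend counts the
  polynomials t^{2b} - t^{2h-2b}; the subtrahend grows by one whenever w grows by 6, the degree of
  (x y (x-y))^2.\<close>

lemma (in vector_space) span_Int_span_independent:
  assumes "independent B" "C \<subseteq> B" "x \<in> span C" "x \<in> span (B - C)"
  shows "x = 0"
proof -
  have a: "representation B x = representation C x"
    using assms by (intro representation_extend) auto
  have b: "representation B x = representation (B - C) x"
    using assms by (intro representation_extend) auto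
  have "representation B x b = 0" for b
    using representation_ne_zero[of C x b] representation_ne_zero[of "B - C" x b] a b by auto
  moreover have "x \<in> span B" using assms(2,3) span_mono by blast
  ultimately show ?thesis
    using sum_nonzero_representation_eq[OF assms(1)] by force
qed

text \<open>A basis of the kernel extends to a basis of \<open>X\<close>, and the added vectors map
  to a basis of the image. Finiteness enters through a finite set spanning \<open>X\<close>, because
  the ambient spaces of functions and of polynomials are infinite-dimensional.\<close>

lemma (in vector_space_pair) dim_kernel_image:
  assumes lf: "Vector_Spaces.linear s1 s2 f" and X: "vs1.subspace X" and B: "finite B" "X \<subseteq> vs1.span B"
  shows "vs1.dim X = vs1.dim {x \<in> X. f x = 0} + vs2.dim (f ` X)"
proof -
  let ?K = "{x \<in> X. f x = 0}"
  obtain D where D: "D \<subseteq> ?K" "vs1.independent D" "?K \<subseteq> vs1.span D" "card D = vs1.dim ?K"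
    using vs1.basis_exists[of ?K] by blast
  obtain C where C: "D \<subseteq> C" "C \<subseteq> X" "vs1.independent C" "X \<subseteq> vs1.span C"
    using vs1.maximal_independent_subset_extend[of D X] D by blast
  have finC: "finite C"
    using vs1.independent_span_bound[OF B(1) C(3)] C(2) B(2) by blast
  have spX: "vs1.span C \<subseteq> X" using C(2) X by (simp add: vs1.span_minimal)
  have inj: "inj_on f (vs1.span (C - D))"
  proof (subst linear_inj_on_iff_eq_0[OF lf], simp, safe)
    fix x assume x: "x \<in> vs1.span (C - D)" "f x = 0"
    then have "x \<in> X" using spX vs1.span_mono[of "C - D" C] by blast
    then have "x \<in> vs1.span D" using x D(3) by blast
    then show "x = 0" using vs1.span_Int_span_independent[OF C(3) C(1)] x(1) by blast
  qed
  have indep: "vs2.independent (f ` (C - D))"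
    using linear_independent_injective_image[OF lf _ inj] vs1.independent_mono[OF C(3)] by blast
  have img: "f ` X \<subseteq> vs2.span (f ` (C - D))"
  proof -
    have "f ` X \<subseteq> vs2.span (f ` C)" using linear_spans_image[OF lf C(4)] .
    also have "\<dots> \<subseteq> vs2.span (f ` (C - D))"
    proof (rule vs2.span_minimal)
      show "f ` C \<subseteq> vs2.span (f ` (C - D))"
      proof
        fix y assume "y \<in> f ` C"
        then obtain c where c: "c \<in> C" "y = f c" by blast
        show "y \<in> vs2.span (f ` (C - D))"
        proof (cases "c \<in> D")
          case True then show ?thesis using D(1) c vs2.span_zero by auto
        next
          case False then show ?thesis using c by (auto intro: vs2.span_base)
        qed
      qed
    qed simp
    finally show ?thesis .
  qed
  have "vs2.dim (f ` X) = card (f ` (C - D))"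
    using vs2.basis_card_eq_dim[OF _ img indep] C(2) by (metis Diff_subset image_mono order_trans)
  also have "\<dots> = card (C - D)"
    using inj vs1.span_superset by (intro card_image) (blast intro: inj_on_subset)
  also have "\<dots> = card C - card D" using C(1) finC by (simp add: card_Diff_subset finite_subset)
  finally have "vs2.dim (f ` X) = card C - card D" .
  moreover have "card C = vs1.dim X" using vs1.basis_card_eq_dim[OF C(2,4,3)] .
  moreover have "card D \<le> card C" using C(1) finC by (simp add: card_mono)
  ultimately show ?thesis using D(4) by simp
qed

lemma (in vector_space) dim_zero_space: "dim {0} = 0"
  using dim_span_eq_card_independent[OF independent_empty] by simp

lemma (in vector_space_pair) dim_image_inj_on:
  assumes "Vector_Spaces.linear s1 s2 f" "vs1.subspace X" "finite B" "X \<subseteq> vs1.span B"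
    and "\<And>x. x \<in> X \<Longrightarrow> f x = 0 \<Longrightarrow> x = 0"
  shows "vs2.dim (f ` X) = vs1.dim X"
proof -
  have "{x \<in> X. f x = 0} = {0}"
    using assms(5) linear_0[OF assms(1)] vs1.subspace_0[OF assms(2)] by auto
  then show ?thesis using dim_kernel_image[OF assms(1-4)]
    by (simp add: vs1.dim_zero_space)
qed

section \<open>Coordinate spaces and reduced echelon bases\<close>

abbreviation (input) fscale :: "rat \<Rightarrow> ('a \<Rightarrow> rat) \<Rightarrow> 'a \<Rightarrow> rat" where
  "fscale \<equiv> \<lambda>c v x. c * v x"

interpretation fv: vector_space "fscale :: rat \<Rightarrow> ('a \<Rightarrow> rat) \<Rightarrow> 'a \<Rightarrow> rat"
  by unfold_locales (auto simp: algebra_simps)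

interpretation fv_pair: vector_space_pair
  "fscale :: rat \<Rightarrow> ('a \<Rightarrow> rat) \<Rightarrow> 'a \<Rightarrow> rat" "fscale :: rat \<Rightarrow> ('b \<Rightarrow> rat) \<Rightarrow> 'b \<Rightarrow> rat"
  by unfold_locales

lemma qdim_eq_dim: "qdim = fv.dim"
  by (simp add: qdim_def fun_eq_iff)

definition supp_on :: "'a set \<Rightarrow> ('a \<Rightarrow> rat) set" where
  "supp_on A = {v. \<forall>x. x \<notin> A \<longrightarrow> v x = 0}"

lemma subspace_supp_on: "fv.subspace (supp_on A)"
  by (auto simp: fv.subspace_def supp_on_def)

lemma fun_eq_0_iff: "(f = 0) \<longleftrightarrow> (\<forall>x. f x = 0)" for f :: "'a \<Rightarrow> rat"
  by (auto simp: fun_eq_iff)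

lemma sum_fun_apply: "(sum f A) x = (\<Sum>a\<in>A. f a x)" for f :: "'b \<Rightarrow> 'a \<Rightarrow> rat"
  by (induction A rule: infinite_finite_induct) auto

lemma fv_linearI:
  fixes f :: "('a \<Rightarrow> rat) \<Rightarrow> 'b \<Rightarrow> rat"
  assumes "\<And>u v x. f (u + v) x = f u x + f v x" "\<And>c v x. f (fscale c v) x = c * f v x"
  shows "Vector_Spaces.linear fscale fscale f"
  by (intro Vector_Spaces.linear_iff[THEN iffD2] conjI allI) (use assms in \<open>auto simp: fun_eq_iff fv.vector_space_axioms\<close>)

text \<open>An element of \<open>U\<close> is determined by its values on \<open>X\<close>, so these
  values are its coefficients in the basis \<open>M\<close>. \<open>dim_tensor\<close> uses this to
  extend data prescribed at the pivots.\<close>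

definition dual_basis :: "('a \<Rightarrow> rat) set \<Rightarrow> 'a set \<Rightarrow> ('a \<Rightarrow> 'a \<Rightarrow> rat) \<Rightarrow> bool" where
  "dual_basis U X M \<longleftrightarrow> (\<forall>p\<in>X. M p \<in> U) \<and> (\<forall>p\<in>X. \<forall>q\<in>X. M p q = (if p = q then 1 else 0)) \<and>
     (\<forall>u\<in>U. (\<forall>p\<in>X. u p = 0) \<longrightarrow> u = 0)"

lemma dual_basisD:
  assumes "dual_basis U X M"
  shows "p \<in> X \<Longrightarrow> M p \<in> U" "u \<in> U \<Longrightarrow> (\<And>p. p \<in> X \<Longrightarrow> u p = 0) \<Longrightarrow> u = 0"
    and "p \<in> X \<Longrightarrow> q \<in> X \<Longrightarrow> M p q = (if p = q then 1 else 0)"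
  using assms unfolding dual_basis_def by blast+

lemma dual_basis_sum:
  assumes "dual_basis U X M" "finite X" "q \<in> X"
  shows "(\<Sum>p\<in>X. c p * M p q) = c q"
proof -
  have "(\<Sum>p\<in>X. c p * M p q) = (\<Sum>p\<in>X. if p = q then c p else 0)"
    using dual_basisD(3)[OF assms(1)] assms(3) by (intro sum.cong) auto
  then show ?thesis using assms(2,3) by simp
qed

text \<open>Reduced echelon form: the pivots are the points of \<open>X\<close>.\<close>

lemma dual_basis_exists:
  assumes "finite A" "fv.subspace U" "U \<subseteq> supp_on A"
  shows "\<exists>X\<subseteq>A. \<exists>M. dual_basis U X M"
  using assms
proof (induction A arbitrary: U rule: finite_induct)
  case empty
  then have "U \<subseteq> {0}" by (auto simp: supp_on_def fun_eq_0_iff)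
  then show ?case by (auto simp: dual_basis_def)
next
  case (insert x A)
  let ?U = "{u \<in> U. u x = 0}"
  have sub: "fv.subspace ?U" using insert.prems(1) by (auto simp: fv.subspace_def)
  have sup: "?U \<subseteq> supp_on A" using insert.prems(2) by (auto simp: supp_on_def)
  obtain X M where XM: "X \<subseteq> A" "dual_basis ?U X M"
    using insert.IH[OF sub sup] by blast
  show ?case
  proof (cases "\<forall>u\<in>U. u x = 0")
    case True
    then have "?U = U" by auto
    then show ?thesis using XM by auto
  next
    case False
    then obtain u0 where u0: "u0 \<in> U" "u0 x \<noteq> 0" by blast
    define u1 where "u1 = fscale (1 / u0 x) u0"
    have u1: "u1 \<in> U" "u1 x = 1"
      using u0 insert.prems(1) fv.subspace_scale[of U u0 "1 / u0 x"] by (auto simp: u1_def)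
    \<comment> \<open>Elimination: the entries of \<open>u1\<close> at the older pivots are cleared.
      The vectors \<open>M p\<close> vanish at \<open>x\<close>, so the new pivot entry stays
      1.\<close>
    define u2 where "u2 = u1 - (\<Sum>p\<in>X. fscale (u1 p) (M p))"
    have finX: "finite X" using XM(1) insert.hyps(1) finite_subset by blast
    have MU: "M p \<in> U" "M p x = 0" if "p \<in> X" for p using XM(2) that by (auto simp: dual_basis_def)
    have u2U: "u2 \<in> U" unfolding u2_def
      using MU u1 insert.prems(1) by (intro fv.subspace_diff fv.subspace_sum fv.subspace_scale) auto
    have u2x: "u2 x = 1" using MU u1 by (simp add: u2_def sum_fun_apply)
    have u2q: "u2 q = 0" if "q \<in> X" for q
      using dual_basis_sum[OF XM(2) finX that] by (simp add: u2_def sum_fun_apply)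
    have xX: "x \<notin> X" using XM(1) insert.hyps(2) by auto
    have "dual_basis U (insert x X) (M(x := u2))"
      unfolding dual_basis_def
    proof (intro conjI ballI impI)
      fix p assume "p \<in> insert x X" then show "(M(x := u2)) p \<in> U" using MU u2U by auto
    next
      fix p q assume "p \<in> insert x X" "q \<in> insert x X"
      then show "(M(x := u2)) p q = (if p = q then 1 else 0)"
        using xX u2x u2q MU XM(2) by (auto simp: dual_basis_def)
    next
      fix u assume "u \<in> U" "\<forall>p\<in>insert x X. u p = 0"
      then show "u = 0" using XM(2) by (auto simp: dual_basis_def)
    qed
    then show ?thesis using XM(1) by (intro exI[of _ "insert x X"]) auto
  qed
qed

lemma dual_basis_expand:
  assumes "dual_basis U X M" "finite X" "fv.subspace U" "u \<in> U"
  shows "u = (\<Sum>p\<in>X. fscale (u p) (M p))"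
proof -
  let ?s = "\<Sum>p\<in>X. fscale (u p) (M p)"
  note MU = dual_basisD(1)[OF assms(1)]
  have "u - ?s \<in> U"
    using assms MU by (intro fv.subspace_diff fv.subspace_sum fv.subspace_scale) auto
  moreover have "(u - ?s) q = 0" if "q \<in> X" for q
    using dual_basis_sum[OF assms(1,2) that] by (simp add: sum_fun_apply)
  ultimately have "u - ?s = 0" using dual_basisD(2)[OF assms(1)] by blast
  then show ?thesis by simp
qed

lemma dim_dual_basis:
  assumes M: "dual_basis U X M" and "finite X" "fv.subspace U"
  shows "fv.dim U = card X"
proof -
  have inj: "inj_on M X"
  proof (rule inj_onI)
    fix p q assume "p \<in> X" "q \<in> X" "M p = M q"
    then show "p = q" using M unfolding dual_basis_def by (metis zero_neq_one)
  qed
  have "fv.independent (M ` X)"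
  proof (rule fv.independent_if_scalars_zero)
    fix f x assume f: "(\<Sum>x\<in>M ` X. fscale (f x) x) = 0" and "x \<in> M ` X"
    then obtain q where q: "q \<in> X" "x = M q" by blast
    have "0 = (\<Sum>x\<in>M ` X. fscale (f x) x) q" using f by simp
    also have "\<dots> = (\<Sum>p\<in>X. f (M p) * M p q)"
      using inj by (simp add: sum.reindex sum_fun_apply)
    also have "\<dots> = f x" using dual_basis_sum[OF M assms(2) q(1)] q(2) by simp
    finally show "f x = 0" by simp
  qed (use assms in simp)
  moreover have "M ` X \<subseteq> U" using M by (auto simp: dual_basis_def)
  moreover have "U \<subseteq> fv.span (M ` X)"
  proof
    fix u assume "u \<in> U"
    then have "u = (\<Sum>p\<in>X. fscale (u p) (M p))" using dual_basis_expand assms by blast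
    moreover have "\<dots> \<in> fv.span (M ` X)" by (intro fv.span_sum fv.span_scale fv.span_base) auto
    ultimately show "u \<in> fv.span (M ` X)" by simp
  qed
  ultimately show ?thesis using fv.basis_card_eq_dim card_image[OF inj] by metis
qed

lemma dual_basis_supp_on: "dual_basis (supp_on A) A (\<lambda>p q. if p = q then 1 else 0)"
  by (auto simp: dual_basis_def supp_on_def fun_eq_0_iff)

lemma dim_supp_on: "finite A \<Longrightarrow> fv.dim (supp_on A) = card A"
  using dim_dual_basis[OF dual_basis_supp_on _ subspace_supp_on] .

lemma supp_on_finite_span:
  assumes "finite A" shows "\<exists>B. finite B \<and> supp_on A \<subseteq> fv.span B"
proof (intro exI conjI subsetI)
  let ?M = "\<lambda>p q. if p = q then 1 else (0 :: rat)"
  show "finite (?M ` A)" using assms by simp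
  fix u :: "'a \<Rightarrow> rat" assume "u \<in> supp_on A"
  then have "u = (\<Sum>p\<in>A. fscale (u p) (?M p))"
    using dual_basis_expand[OF dual_basis_supp_on assms subspace_supp_on] by blast
  moreover have "\<dots> \<in> fv.span (?M ` A)" by (intro fv.span_sum fv.span_scale fv.span_base) auto
  ultimately show "u \<in> fv.span (?M ` A)" by simp
qed

lemma fv_rank_nullity:
  fixes f :: "('a \<Rightarrow> rat) \<Rightarrow> 'b \<Rightarrow> rat"
  assumes "Vector_Spaces.linear fscale fscale f" "fv.subspace U" "finite A" "U \<subseteq> supp_on A"
  shows "fv.dim U = fv.dim {u \<in> U. f u = 0} + fv.dim (f ` U)"
proof -
  obtain B where "finite B" "supp_on A \<subseteq> fv.span B" using supp_on_finite_span assms(3) by blast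
  then show ?thesis using fv_pair.dim_kernel_image[OF assms(1,2)] assms(4) by blast
qed

lemma fv_dim_image_inj:
  fixes f :: "('a \<Rightarrow> rat) \<Rightarrow> 'b \<Rightarrow> rat"
  assumes "Vector_Spaces.linear fscale fscale f" "fv.subspace U" "finite A" "U \<subseteq> supp_on A"
    and "\<And>u. u \<in> U \<Longrightarrow> f u = 0 \<Longrightarrow> u = 0"
  shows "fv.dim (f ` U) = fv.dim U"
proof -
  obtain B where "finite B" "supp_on A \<subseteq> fv.span B" using supp_on_finite_span assms(3) by blast
  then show ?thesis using fv_pair.dim_image_inj_on[OF assms(1,2) _ _ assms(5)] assms(4) by blast
qed

section \<open>Direct sums over a partition of the index set\<close>

definition pull :: "('b \<Rightarrow> 'a) \<Rightarrow> 'b set \<Rightarrow> ('a \<Rightarrow> rat) \<Rightarrow> 'b \<Rightarrow> rat" where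
  "pull h B v = (\<lambda>y. if y \<in> B then v (h y) else 0)"

lemma linear_pull: "Vector_Spaces.linear fscale fscale (pull h B)"
  by (rule fv_linearI) (auto simp: pull_def)

lemma pull_0 [simp]: "pull h B 0 = 0"
  by (auto simp: pull_def fun_eq_iff)

lemma pull_add: "pull h B (u + v) = pull h B u + pull h B v"
  by (auto simp: pull_def fun_eq_iff)

lemma pull_scale: "pull h B (fscale c v) = fscale c (pull h B v)"
  by (auto simp: pull_def fun_eq_iff)

lemma subspace_blocks:
  assumes "\<And>j. j \<in> J \<Longrightarrow> fv.subspace (K j)"
  shows "fv.subspace {v \<in> supp_on A. \<forall>j\<in>J. pull (\<iota> j) (B j) v \<in> K j}"
proof -
  show ?thesis
    unfolding fv.subspace_def
  proof (intro conjI ballI allI; clarsimp simp only: mem_Collect_eq)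
    show "0 \<in> supp_on A \<and> (\<forall>j\<in>J. pull (\<iota> j) (B j) 0 \<in> K j)"
      using assms by (auto simp: supp_on_def fv.subspace_0)
  next
    fix x y assume "x \<in> supp_on A" "y \<in> supp_on A"
      "\<forall>j\<in>J. pull (\<iota> j) (B j) x \<in> K j" "\<forall>j\<in>J. pull (\<iota> j) (B j) y \<in> K j"
    then show "x + y \<in> supp_on A \<and> (\<forall>j\<in>J. pull (\<iota> j) (B j) (x + y) \<in> K j)"
      using assms by (auto simp: pull_add fv.subspace_add subspace_supp_on)
  next
    fix c x assume "x \<in> supp_on A" "\<forall>j\<in>J. pull (\<iota> j) (B j) x \<in> K j"
    then show "fscale c x \<in> supp_on A \<and> (\<forall>j\<in>J. pull (\<iota> j) (B j) (fscale c x) \<in> K j)"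
      using assms subspace_supp_on[of A] by (auto simp: pull_scale fv.subspace_scale)
  qed
qed

text \<open>The images of the \<open>B j\<close> are disjoint, so the conditions decouple and the
  space is the direct sum of the \<open>K j\<close>. Each induction step restricts to one block: the
  image is \<open>K k\<close>, the kernel is the space for the remaining blocks.\<close>

lemma dim_blocks:
  fixes K :: "'j \<Rightarrow> ('b \<Rightarrow> rat) set" and \<iota> :: "'j \<Rightarrow> 'b \<Rightarrow> 'a"
  assumes "finite J" "\<And>j. j \<in> J \<Longrightarrow> finite (B j)"
    and "\<And>j. j \<in> J \<Longrightarrow> fv.subspace (K j)" "\<And>j. j \<in> J \<Longrightarrow> K j \<subseteq> supp_on (B j)"
    and "\<And>j. j \<in> J \<Longrightarrow> inj_on (\<iota> j) (B j)"
    and "\<And>i j x y. i \<in> J \<Longrightarrow> j \<in> J \<Longrightarrow> x \<in> B i \<Longrightarrow> y \<in> B j \<Longrightarrow> \<iota> i x = \<iota> j y \<Longrightarrow> i = j"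
  shows "fv.dim {v \<in> supp_on (\<Union>j\<in>J. \<iota> j ` B j). \<forall>j\<in>J. pull (\<iota> j) (B j) v \<in> K j} = (\<Sum>j\<in>J. fv.dim (K j))"
  using assms
proof (induction J rule: finite_induct)
  case empty
  have "supp_on {} = {0 :: 'a \<Rightarrow> rat}" by (auto simp: supp_on_def fun_eq_iff)
  then show ?case by (simp add: fv.dim_zero_space)
next
  case (insert k J)
  let ?L = "\<lambda>J. {v \<in> supp_on (\<Union>j\<in>J. \<iota> j ` B j). \<forall>j\<in>J. pull (\<iota> j) (B j) v \<in> K j}"
  let ?f = "pull (\<iota> k) (B k)"
  have IH: "fv.dim (?L J) = (\<Sum>j\<in>J. fv.dim (K j))"
  proof (rule insert.IH)
    fix i j x y assume "i \<in> J" "j \<in> J" "x \<in> B i" "y \<in> B j" "\<iota> i x = \<iota> j y"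
    then show "i = j" using insert.prems(5)[of i j x y] by simp
  qed (simp_all add: insert.prems)
  have sub: "fv.subspace (?L (insert k J))"
    using insert.prems(2) by (rule subspace_blocks)
  have fin: "finite (\<Union>j\<in>insert k J. \<iota> j ` B j)" using insert.hyps(1) insert.prems(1) by auto
  have ker: "{v \<in> ?L (insert k J). ?f v = 0} = ?L J"
  proof (intro equalityI subsetI)
    fix v assume "v \<in> {v \<in> ?L (insert k J). ?f v = 0}"
    then have v: "v \<in> ?L (insert k J)" and z: "?f v = 0" by blast+
    have "v x = 0" if "x \<in> \<iota> k ` B k" for x
      using z that unfolding pull_def fun_eq_0_iff by (metis imageE)
    then have "v \<in> supp_on (\<Union>j\<in>J. \<iota> j ` B j)" using v unfolding supp_on_def by blast
    then show "v \<in> ?L J" using v by blast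
  next
    fix v assume v: "v \<in> ?L J"
    have "v (\<iota> k y) = 0" if "y \<in> B k" for y
    proof -
      have "\<iota> k y \<notin> (\<Union>j\<in>J. \<iota> j ` B j)" using insert.prems(5) insert.hyps(2) that by fastforce
      then show ?thesis using v by (auto simp: supp_on_def)
    qed
    then have "?f v = 0" by (auto simp: pull_def fun_eq_iff)
    then show "v \<in> {v \<in> ?L (insert k J). ?f v = 0}"
      using v insert.prems(2)[of k] by (auto simp: supp_on_def fv.subspace_0)
  qed
  have im: "?f ` ?L (insert k J) = K k"
  proof (intro equalityI subsetI)
    fix u assume "u \<in> ?f ` ?L (insert k J)" then show "u \<in> K k" by auto
  next
    fix u assume u: "u \<in> K k"
    define v where "v x = (if x \<in> \<iota> k ` B k then u (the_inv_into (B k) (\<iota> k) x) else 0)" for x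
    have "?f v = u"
      using u insert.prems(3)[of k] insert.prems(4)[of k]
      by (auto simp: v_def pull_def fun_eq_iff supp_on_def the_inv_into_f_f)
    moreover have "pull (\<iota> j) (B j) v = 0" if "j \<in> J" for j
    proof -
      have "\<iota> j y \<notin> \<iota> k ` B k" if "y \<in> B j" for y
        using insert.prems(5) insert.hyps(2) that \<open>j \<in> J\<close> by fastforce
      then show ?thesis by (auto simp: v_def pull_def fun_eq_iff)
    qed
    moreover have "v \<in> supp_on (\<Union>j\<in>insert k J. \<iota> j ` B j)" by (auto simp: v_def supp_on_def)
    ultimately have "v \<in> ?L (insert k J)" using u insert.prems(2) by (auto simp: fv.subspace_0)
    then show "u \<in> ?f ` ?L (insert k J)" using \<open>?f v = u\<close> by blast
  qed
  have "fv.dim (?L (insert k J)) = fv.dim (?L J) + fv.dim (K k)"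
    using fv_rank_nullity[OF linear_pull[of "\<iota> k" "B k"] sub fin] unfolding ker im by blast
  then show ?case using IH insert.hyps by simp
qed

lemma dim_add_le_card:
  assumes "finite A" "fv.subspace U" "fv.subspace X" "U \<subseteq> supp_on A" "X \<subseteq> supp_on A" "U \<inter> X \<subseteq> {0}"
  shows "fv.dim U + fv.dim X \<le> card A"
proof -
  obtain P M where P: "P \<subseteq> A" "dual_basis U P M"
    using dual_basis_exists[OF assms(1,2,4)] by blast
  have finP: "finite P" using P(1) assms(1) finite_subset by blast
  text \<open>Subtracting the \<open>U\<close>-component along the pivots maps \<open>X\<close> injectively into functions on the non-pivots.\<close>
  define f where "f v = v - (\<Sum>p\<in>P. fscale (v p) (M p))" for v :: "'a \<Rightarrow> rat"
  note MU = dual_basisD(1)[OF P(2)]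
  have lin: "Vector_Spaces.linear fscale fscale f"
  proof (rule fv_linearI)
    fix u v x show "f (u + v) x = f u x + f v x"
      unfolding f_def by (simp add: sum_fun_apply) (simp only: distrib_right sum.distrib)
  next
    fix c v x show "f (fscale c v) x = c * f v x"
      unfolding f_def by (simp add: sum_fun_apply) (simp only: right_diff_distrib sum_distrib_left mult.assoc)
  qed
  have "f ` X \<subseteq> supp_on (A - P)"
  proof safe
    fix v assume v: "v \<in> X"
    have "f v q = 0" if "q \<in> P" for q
      using dual_basis_sum[OF P(2) finP that] by (simp add: f_def sum_fun_apply)
    moreover have "f v q = 0" if "q \<notin> A" for q
    proof -
      have "M p q = 0" if "p \<in> P" for p using MU[OF that] assms(4) \<open>q \<notin> A\<close> by (auto simp: supp_on_def)
      moreover have "v q = 0" using v assms(5) that by (auto simp: supp_on_def)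
      ultimately show ?thesis by (simp add: f_def sum_fun_apply)
    qed
    ultimately show "f v \<in> supp_on (A - P)" by (auto simp: supp_on_def)
  qed
  moreover obtain D where D: "finite D" "supp_on (A - P) \<subseteq> fv.span D" "card D = card (A - P)"
  proof -
    obtain D where "D \<subseteq> supp_on (A - P)" "fv.independent D" "supp_on (A - P) \<subseteq> fv.span D"
      "card D = fv.dim (supp_on (A - P))"
      using fv.basis_exists[of "supp_on (A - P)"] by blast
    moreover obtain D' where "finite D'" "supp_on (A - P) \<subseteq> fv.span D'"
      using supp_on_finite_span[of "A - P"] assms(1) by auto
    ultimately show ?thesis
      using that[of D] fv.independent_span_bound[of D' D] assms(1) by (auto simp: dim_supp_on)
  qed
  ultimately have "fv.dim (f ` X) \<le> card (A - P)"
    using fv.dim_le_card[of "f ` X" D] by auto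
  moreover have "fv.dim (f ` X) = fv.dim X"
  proof (rule fv_dim_image_inj[OF lin assms(3,1,5)])
    fix v assume v: "v \<in> X" "f v = 0"
    then have "v = (\<Sum>p\<in>P. fscale (v p) (M p))" by (simp add: f_def)
    moreover have "\<dots> \<in> U" using assms(2) MU by (intro fv.subspace_sum fv.subspace_scale) auto
    ultimately show "v = 0" using v assms(6) by auto
  qed
  moreover have "fv.dim U = card P" using dim_dual_basis[OF P(2) finP assms(2)] .
  moreover have "card (A - P) + card P = card A"
    using P(1) assms(1) finP by (metis card_Diff_subset card_mono le_add_diff_inverse2)
  ultimately show ?thesis by simp
qed

section \<open>Row rank, column rank and the two kernels of a square matrix\<close>

definition colmul :: "nat list set \<Rightarrow> mat \<Rightarrow> (nat list \<Rightarrow> rat) \<Rightarrow> (nat list \<Rightarrow> rat)" where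
  "colmul I A v = (\<lambda>m. if m \<in> I then (\<Sum>n\<in>I. A m n * v n) else 0)"

lemma linear_rowmul: "Vector_Spaces.linear fscale fscale (\<lambda>v. rowmul I v A)"
  by (rule fv_linearI) (auto simp: rowmul_def algebra_simps sum.distrib sum_distrib_left)

lemma linear_colmul: "Vector_Spaces.linear fscale fscale (colmul I A)"
  by (rule fv_linearI) (auto simp: colmul_def algebra_simps sum.distrib sum_distrib_left)

lemma lkernel_eq: "lkernel I A = {v \<in> supp_on I. rowmul I v A = 0}"
  by (auto simp: lkernel_def supp_on_def)

lemma rkernel_eq: "rkernel I A = {v \<in> supp_on I. colmul I A v = 0}"
  by (auto simp: rkernel_def supp_on_def colmul_def fun_eq_0_iff)

lemma subspace_kernel_on:
  fixes f :: "('a \<Rightarrow> rat) \<Rightarrow> 'b \<Rightarrow> rat"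
  assumes "Vector_Spaces.linear fscale fscale f" "fv.subspace U"
  shows "fv.subspace {v \<in> U. f v = 0}"
proof -
  have "{v \<in> U. f v = 0} = U \<inter> {v. f v = 0}" by auto
  then show ?thesis using fv_pair.linear_subspace_kernel[OF assms(1)] assms(2) fv.subspace_inter by metis
qed

text \<open>Over an ordered field the row space meets the right kernel trivially, which bounds the row rank
  by the column rank; transposing gives equality.\<close>

lemma row_rank_le_column_rank:
  assumes "finite I"
  shows "fv.dim ((\<lambda>v. rowmul I v A) ` supp_on I) \<le> fv.dim (colmul I A ` supp_on I)"
proof -
  let ?R = "(\<lambda>v. rowmul I v A) ` supp_on I"
  let ?K = "{v \<in> supp_on I. colmul I A v = 0}"
  have "fv.dim ?R + fv.dim ?K \<le> card I"
  proof (rule dim_add_le_card[OF assms])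
    show "fv.subspace ?R" using fv_pair.linear_subspace_image[OF linear_rowmul subspace_supp_on] .
    show "fv.subspace ?K" using subspace_kernel_on[OF linear_colmul subspace_supp_on] .
    show "?R \<subseteq> supp_on I" by (auto simp: supp_on_def rowmul_def)
    show "?R \<inter> ?K \<subseteq> {0}"
    proof
      fix u assume u: "u \<in> ?R \<inter> ?K"
      then obtain v where v: "u = rowmul I v A" by auto
      have "(\<Sum>n\<in>I. u n * u n) = (\<Sum>n\<in>I. \<Sum>m\<in>I. v m * (A m n * u n))"
        by (intro sum.cong refl) (auto simp: v rowmul_def sum_distrib_right algebra_simps)
      also have "\<dots> = (\<Sum>m\<in>I. v m * colmul I A u m)"
        by (subst sum.swap) (auto simp: colmul_def sum_distrib_left)
      also have "\<dots> = 0" using u by simp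
      finally have "\<forall>n\<in>I. u n * u n = 0"
        using sum_nonneg_eq_0_iff[OF assms, of "\<lambda>n. u n * u n"] by simp
      then show "u \<in> {0}" using u by (auto simp: supp_on_def fun_eq_0_iff)
    qed
  qed auto
  moreover have "card I = fv.dim ?K + fv.dim (colmul I A ` supp_on I)"
    using fv_rank_nullity[OF linear_colmul subspace_supp_on assms order_refl] dim_supp_on[OF assms] by metis
  ultimately show ?thesis by simp
qed

lemma dim_rkernel_eq_lkernel:
  assumes "finite I"
  shows "fv.dim (rkernel I A) = fv.dim (lkernel I A)"
proof -
  have t: "colmul I A = (\<lambda>v. rowmul I v (\<lambda>m n. A n m))" for A
    by (auto simp: colmul_def rowmul_def fun_eq_iff mult.commute)
  have eq: "fv.dim ((\<lambda>v. rowmul I v A) ` supp_on I) = fv.dim (colmul I A ` supp_on I)"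
    using row_rank_le_column_rank[OF assms, of A] row_rank_le_column_rank[OF assms, of "\<lambda>m n. A n m"] unfolding t by simp
  have "card I = fv.dim (rkernel I A) + fv.dim (colmul I A ` supp_on I)"
    using fv_rank_nullity[OF linear_colmul subspace_supp_on assms order_refl] dim_supp_on[OF assms]
    unfolding rkernel_eq by metis
  moreover have "card I = fv.dim (lkernel I A) + fv.dim ((\<lambda>v. rowmul I v A) ` supp_on I)"
    using fv_rank_nullity[OF linear_rowmul subspace_supp_on assms order_refl] dim_supp_on[OF assms]
    unfolding lkernel_eq by metis
  ultimately show ?thesis using eq by linarith
qed

section \<open>Substitution in multivariate polynomials\<close>

abbreviation (input) "lookup \<equiv> Poly_Mapping.lookup"
abbreviation (input) "keys \<equiv> Poly_Mapping.keys"
abbreviation (input) "single \<equiv> Poly_Mapping.single"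

lemma poly_mapping_sum_single:
  assumes "finite A" "keys p \<subseteq> A"
  shows "p = (\<Sum>m\<in>A. single m (lookup p m))"
proof (rule poly_mapping_eqI)
  fix k
  have "lookup (\<Sum>m\<in>A. single m (lookup p m)) k = (\<Sum>m\<in>A. if m = k then lookup p m else 0)"
    by (simp add: lookup_sum lookup_single when_def)
  also have "\<dots> = lookup p k" using assms by (auto simp: in_keys_iff)
  finally show "lookup p k = lookup (\<Sum>m\<in>A. single m (lookup p m)) k" by simp
qed

lemma const_add: "const (c + d) = const c + const d"
  and const_mult: "const (c * d) = const c * const d"
  and const_0 [simp]: "const 0 = 0"
  and const_1 [simp]: "const 1 = 1"
  and const_uminus: "const (- c) = - const c"
  by (simp_all add: const_def single_add mult_single single_uminus)

lemma const_mult_single: "const c * single m d = single m (c * d)"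
  by (simp add: const_def mult_single)

lemma lookup_const_mult: "lookup (const c * p) m = c * lookup p m"
proof -
  have "const c * p = const c * (\<Sum>k\<in>keys p. single k (lookup p k))"
    using poly_mapping_sum_single[of "keys p" p] by simp
  also have "\<dots> = (\<Sum>k\<in>keys p. single k (c * lookup p k))"
    by (simp add: sum_distrib_left const_mult_single)
  finally have "lookup (const c * p) m = (\<Sum>k\<in>keys p. if k = m then c * lookup p k else 0)"
    by (simp add: lookup_sum lookup_single when_def)
  then show ?thesis by (auto simp: in_keys_iff)
qed

definition subst_mon :: "(nat \<Rightarrow> mpoly) \<Rightarrow> (nat \<Rightarrow>\<^sub>0 nat) \<Rightarrow> mpoly" where
  "subst_mon \<sigma> m = (\<Prod>i\<in>keys m. \<sigma> i ^ lookup m i)"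

lemma subst_mon_superset:
  assumes "finite A" "keys m \<subseteq> A"
  shows "subst_mon \<sigma> m = (\<Prod>i\<in>A. \<sigma> i ^ lookup m i)"
  unfolding subst_mon_def using assms by (intro prod.mono_neutral_left) (auto simp: in_keys_iff)

lemma subst_mon_add: "subst_mon \<sigma> (m + n) = subst_mon \<sigma> m * subst_mon \<sigma> n"
proof -
  let ?A = "keys m \<union> keys n"
  have "subst_mon \<sigma> (m + n) = (\<Prod>i\<in>?A. \<sigma> i ^ lookup (m + n) i)"
    using keys_add[of m n] by (intro subst_mon_superset) auto
  also have "\<dots> = (\<Prod>i\<in>?A. \<sigma> i ^ lookup m i) * (\<Prod>i\<in>?A. \<sigma> i ^ lookup n i)"
    by (simp add: lookup_add power_add prod.distrib)
  finally show ?thesis by (simp add: subst_mon_superset[of ?A])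
qed

lemma psubst_superset:
  assumes "finite A" "keys p \<subseteq> A"
  shows "psubst \<sigma> p = (\<Sum>m\<in>A. const (lookup p m) * subst_mon \<sigma> m)"
  unfolding psubst_def subst_mon_def using assms
  by (intro sum.mono_neutral_left) (auto simp: in_keys_iff)

lemma psubst_0 [simp]: "psubst \<sigma> 0 = 0"
  by (simp add: psubst_def)

lemma psubst_add: "psubst \<sigma> (p + q) = psubst \<sigma> p + psubst \<sigma> q"
proof -
  let ?A = "keys p \<union> keys q"
  have "psubst \<sigma> (p + q) = (\<Sum>m\<in>?A. const (lookup (p + q) m) * subst_mon \<sigma> m)"
    using keys_add[of p q] by (intro psubst_superset) auto
  then show ?thesis
    by (simp add: psubst_superset[of ?A] lookup_add const_add distrib_right sum.distrib)
qed

lemma psubst_sum: "psubst \<sigma> (sum f A) = (\<Sum>a\<in>A. psubst \<sigma> (f a))"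
  by (induction A rule: infinite_finite_induct) (auto simp: psubst_add)

lemma psubst_uminus: "psubst \<sigma> (- p) = - psubst \<sigma> p"
  using psubst_add[of \<sigma> "- p" p] by (simp add: eq_neg_iff_add_eq_0)

lemma psubst_diff: "psubst \<sigma> (p - q) = psubst \<sigma> p - psubst \<sigma> q"
  using psubst_add[of \<sigma> p "- q"] by (simp add: psubst_uminus)

lemma psubst_single: "psubst \<sigma> (single m c) = const c * subst_mon \<sigma> m"
  by (subst psubst_superset[of "{m}"]) auto

lemma psubst_mult: "psubst \<sigma> (p * q) = psubst \<sigma> p * psubst \<sigma> q"
proof -
  have s: "psubst \<sigma> (single m c * single n d) = psubst \<sigma> (single m c) * psubst \<sigma> (single n d)" for m n c d
    by (simp add: mult_single psubst_single subst_mon_add const_mult)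
  let ?p = "\<Sum>m\<in>keys p. single m (lookup p m)" and ?q = "\<Sum>m\<in>keys q. single m (lookup q m)"
  have "psubst \<sigma> (?p * ?q) = psubst \<sigma> ?p * psubst \<sigma> ?q"
    by (simp add: sum_product psubst_sum s)
  then show ?thesis using poly_mapping_sum_single[of "keys p" p] poly_mapping_sum_single[of "keys q" q] by simp
qed

lemma psubst_1 [simp]: "psubst \<sigma> 1 = 1"
  using psubst_single[of \<sigma> 0 1] by (simp add: subst_mon_def)

lemma psubst_power: "psubst \<sigma> (p ^ n) = psubst \<sigma> p ^ n"
  by (induction n) (auto simp: psubst_mult)

lemma psubst_prod: "psubst \<sigma> (prod f A) = (\<Prod>a\<in>A. psubst \<sigma> (f a))"
  by (induction A rule: infinite_finite_induct) (auto simp: psubst_mult)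

lemma psubst_var [simp]: "psubst \<sigma> (var i) = \<sigma> i"
  by (simp add: var_def psubst_single subst_mon_def)

lemma lookup_expo: "lookup (expo a) i = (if i < length a then a ! i else 0)"
  by (simp add: expo_def nth_default_def)

lemma keys_expo_subset: "keys (expo a) \<subseteq> {..<length a}"
  by (auto simp: in_keys_iff lookup_expo split: if_splits)

text \<open>\<open>expo\<close> forgets trailing zeros, hence the assumption on the lengths.\<close>

lemma expo_inj: "length a = length b \<Longrightarrow> expo a = expo b \<longleftrightarrow> a = b"
  by (metis lookup_expo nth_equalityI)

lemma psubst_mono: "psubst \<sigma> (mono a) = (\<Prod>i<length a. \<sigma> i ^ (a ! i))"
proof -
  have "psubst \<sigma> (mono a) = (\<Prod>i\<in>{..<length a}. \<sigma> i ^ lookup (expo a) i)"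
    using keys_expo_subset[of a] subst_mon_superset[of "{..<length a}" "expo a" \<sigma>]
    by (simp add: mono_def psubst_single)
  then show ?thesis by (simp add: lookup_expo)
qed

lemma var_power: "var i ^ k = single (single i k) 1"
  by (induction k) (auto simp: var_def mult_single single_add[symmetric])

lemma prod_single: "(\<Prod>i\<in>A. single (f i) 1) = single (\<Sum>i\<in>A. f i) (1 :: rat)"
  by (induction A rule: infinite_finite_induct) (auto simp: mult_single)

lemma psubst_var_id [simp]: "psubst var p = p"
proof -
  have "subst_mon var m = single m 1" for m
    using poly_mapping_sum_single[of "keys m" m] by (simp add: subst_mon_def var_power prod_single)
  then show ?thesis
    using poly_mapping_sum_single[of "keys p" p]
    by (simp add: psubst_superset[of "keys p" p] const_mult_single)
qed

lemma mono_eq_prod: "mono a = (\<Prod>i<length a. var i ^ (a ! i))"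
  using psubst_mono[of var a] by simp

definition shift :: "nat \<Rightarrow> mpoly \<Rightarrow> mpoly" where
  "shift s = psubst (\<lambda>i. var (i + s))"

definition shift_mon :: "nat \<Rightarrow> (nat \<Rightarrow>\<^sub>0 nat) \<Rightarrow> (nat \<Rightarrow>\<^sub>0 nat)" where
  "shift_mon s m = (\<Sum>i\<in>keys m. single (i + s) (lookup m i))"

lemma lookup_shift_mon: "lookup (shift_mon s m) k = (if k < s then 0 else lookup m (k - s))"
proof -
  have "lookup (shift_mon s m) k = (\<Sum>i\<in>keys m. if i + s = k then lookup m i else 0)"
    by (simp add: shift_mon_def lookup_sum lookup_single when_def)
  also have "\<dots> = (\<Sum>i\<in>keys m. if i = k - s then (if k < s then 0 else lookup m i) else 0)"
    by (intro sum.cong) auto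
  also have "\<dots> = (if k < s then 0 else lookup m (k - s))" by (auto simp: in_keys_iff)
  finally show ?thesis .
qed

lemma shift_single: "shift s (single m c) = single (shift_mon s m) c"
  by (simp add: shift_def psubst_single subst_mon_def var_power prod_single shift_mon_def const_mult_single)

lemma expo_append: "expo (a @ b) = expo a + shift_mon (length a) (expo b)"
  by (rule poly_mapping_eqI) (auto simp: lookup_add lookup_expo lookup_shift_mon nth_append)

lemma expo_plus_shift_mon_eq_iff:
  assumes "length a = length b"
  shows "expo a + shift_mon (length a) m = expo b + shift_mon (length b) n \<longleftrightarrow> a = b \<and> m = n"
proof
  assume e: "expo a + shift_mon (length a) m = expo b + shift_mon (length b) n"
  have l: "lookup (expo a + shift_mon (length a) m) k = lookup (expo b + shift_mon (length b) n) k" for k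
    using e by simp
  have "a ! i = b ! i" if "i < length a" for i
    using l[of i] that assms by (simp add: lookup_add lookup_expo lookup_shift_mon)
  then have "a = b" using assms by (intro nth_equalityI) auto
  moreover have "m = n"
  proof (rule poly_mapping_eqI)
    fix k show "lookup m k = lookup n k"
      using l[of "k + length a"] assms by (simp add: lookup_add lookup_expo lookup_shift_mon)
  qed
  ultimately show "a = b \<and> m = n" by simp
qed (use assms in auto)

text \<open>The two factors involve disjoint sets of variables, so the coefficient factorises. The
  case distinction becomes the Kronecker delta in E^(j).\<close>

lemma lookup_mono_mult_shift:
  assumes "length a = length b"
  shows "lookup (mono a * shift (length a) p) (expo (b @ c)) = (if a = b then lookup p (expo c) else 0)"
proof -
  have "mono a * shift (length a) p = (\<Sum>m\<in>keys p. single (expo a + shift_mon (length a) m) (lookup p m))"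
    by (subst poly_mapping_sum_single[of "keys p" p])
      (auto simp: shift_def psubst_sum sum_distrib_left mono_def mult_single
        shift_single[unfolded shift_def])
  then have "lookup (mono a * shift (length a) p) (expo (b @ c)) =
      (\<Sum>m\<in>keys p. if a = b \<and> m = expo c then lookup p m else 0)"
    by (simp add: lookup_sum lookup_single when_def expo_append expo_plus_shift_mon_eq_iff[OF assms])
  then show ?thesis by (auto simp: in_keys_iff)
qed

text \<open>Homogeneity of degree N - r together with the parity condition imposed by
  \<open>rtep\<close> is what brings the result of \<open>phi\<close> back into
  \<open>V N r\<close>.\<close>

definition homog :: "nat \<Rightarrow> nat \<Rightarrow> mpoly set" where
  "homog r d = {p. \<forall>m\<in>keys p. keys m \<subseteq> {..<r} \<and> (\<Sum>i<r. lookup m i) = d}"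

lemma homog_add: "p \<in> homog r d \<Longrightarrow> q \<in> homog r d \<Longrightarrow> p + q \<in> homog r d"
  using keys_add[of p q] by (auto simp: homog_def)

lemma homog_uminus: "p \<in> homog r d \<Longrightarrow> - p \<in> homog r d"
  by (auto simp: homog_def in_keys_iff)

lemma homog_diff: "p \<in> homog r d \<Longrightarrow> q \<in> homog r d \<Longrightarrow> p - q \<in> homog r d"
  using homog_add[of p r d "- q"] homog_uminus by simp

lemma homog_0: "0 \<in> homog r d"
  by (simp add: homog_def)

lemma homog_sum: "(\<And>a. a \<in> A \<Longrightarrow> f a \<in> homog r d) \<Longrightarrow> sum f A \<in> homog r d"
  by (induction A rule: infinite_finite_induct) (auto simp: homog_0 homog_add)

lemma homog_mult: "p \<in> homog r d \<Longrightarrow> q \<in> homog r e \<Longrightarrow> p * q \<in> homog r (d + e)"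
proof -
  assume p: "p \<in> homog r d" and q: "q \<in> homog r e"
  show ?thesis unfolding homog_def
  proof (intro CollectI ballI)
    fix m assume "m \<in> keys (p * q)"
    then obtain a b where ab: "m = a + b" "a \<in> keys p" "b \<in> keys q" using keys_mult[of p q] by auto
    then show "keys m \<subseteq> {..<r} \<and> (\<Sum>i<r. lookup m i) = d + e"
      using p q keys_add[of a b] by (fastforce simp: homog_def lookup_add sum.distrib)
  qed
qed

lemma homog_1: "1 \<in> homog r 0"
  by (simp add: homog_def)

lemma homog_const_mult: "p \<in> homog r d \<Longrightarrow> const c * p \<in> homog r d"
  by (auto simp: homog_def in_keys_iff lookup_const_mult)

lemma homog_var: "i < r \<Longrightarrow> var i \<in> homog r 1"
  by (auto simp: homog_def var_def lookup_single when_def)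

lemma homog_power: "p \<in> homog r d \<Longrightarrow> p ^ n \<in> homog r (d * n)"
  by (induction n) (auto simp: homog_1 intro: homog_mult)

lemma homog_prod:
  "(\<And>a. a \<in> A \<Longrightarrow> f a \<in> homog r (d a)) \<Longrightarrow> finite A \<Longrightarrow> prod f A \<in> homog r (sum d A)"
  by (induction A rule: infinite_finite_induct) (auto simp: homog_1 homog_mult)

lemma lookup_rtep:
  "lookup (rtep r P) m = (if \<forall>i<r. even (lookup m i) \<and> 2 \<le> lookup m i then lookup P m else 0)"
proof -
  let ?A = "{m \<in> keys P. \<forall>i<r. even (lookup m i) \<and> 2 \<le> lookup m i}"
  have "lookup (rtep r P) m = (\<Sum>k\<in>?A. if k = m then lookup P k else 0)"
    by (simp add: rtep_def lookup_sum lookup_single when_def)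
  also have "\<dots> = (if m \<in> ?A then lookup P m else 0)" by simp
  finally show ?thesis by (auto simp: in_keys_iff)
qed

lemma rtep_diff: "rtep r (P - Q) = rtep r P - rtep r Q"
  by (auto intro!: poly_mapping_eqI simp: lookup_rtep lookup_minus)

lemma finite_S: "finite (S N r)"
proof (rule finite_subset)
  show "S N r \<subseteq> {xs. set xs \<subseteq> {..N} \<and> length xs = r}"
    using member_le_sum_list by (fastforce simp: S_def)
qed (simp add: finite_lists_length_eq)

lemma length_dec [simp]: "length (dec n) = length n"
  by (simp add: dec_def)

lemma nth_dec [simp]: "i < length n \<Longrightarrow> dec n ! i = n ! i - 1"
  by (simp add: dec_def)

lemma S_D: "n \<in> S N r \<Longrightarrow> length n = r" "n \<in> S N r \<Longrightarrow> sum_list n = N"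
  "n \<in> S N r \<Longrightarrow> i < r \<Longrightarrow> odd (n ! i) \<and> 3 \<le> n ! i"
  by (auto simp: S_def)

lemma expo_dec_inj: "n \<in> S N r \<Longrightarrow> m \<in> S M r \<Longrightarrow> expo (dec n) = expo (dec m) \<longleftrightarrow> n = m"
proof
  assume n: "n \<in> S N r" and m: "m \<in> S M r" and "expo (dec n) = expo (dec m)"
  then have d: "dec n = dec m" using expo_inj[of "dec n" "dec m"] S_D(1)[OF n] S_D(1)[OF m] by simp
  have "n ! i = m ! i" if "i < r" for i
  proof -
    have "dec n ! i = dec m ! i" using d by simp
    \<comment> \<open>The truncated subtraction in \<open>dec\<close> can be undone because all
      entries are at least 3.\<close>
    then show ?thesis using that S_D(1,3)[OF n] S_D(1,3)[OF m] by fastforce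
  qed
  then show "n = m" using S_D(1)[OF n] S_D(1)[OF m] by (intro nth_equalityI) auto
qed simp

lemma lookup_expo_dec_even:
  "n \<in> S N r \<Longrightarrow> i < r \<Longrightarrow> even (lookup (expo (dec n)) i) \<and> 2 \<le> lookup (expo (dec n)) i"
  using S_D(1)[of n N r] S_D(3)[of n N r i] by (auto simp: lookup_expo)

lemma piV_supp: "piV N r P \<in> supp_on (S N r)"
  by (auto simp: supp_on_def piV_def)

lemma sum_expo_dec: "n \<in> S N r \<Longrightarrow> (\<Sum>i<r. lookup (expo (dec n)) i) + r = N"
proof -
  assume n: "n \<in> S N r"
  have "(\<Sum>i<r. lookup (expo (dec n)) i) + r = (\<Sum>i<r. (n ! i - 1) + 1)"
    unfolding sum.distrib using S_D(1)[OF n] by (simp add: lookup_expo)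
  also have "\<dots> = (\<Sum>i<r. n ! i)" using S_D(3)[OF n] by (intro sum.cong) fastforce+
  also have "\<dots> = N" using S_D(1,2)[OF n] by (simp add: sum_list_sum_nth atLeast0LessThan)
  finally show ?thesis .
qed

lemma V_expand: "P \<in> V N r \<Longrightarrow> P = (\<Sum>n\<in>S N r. const (piV N r P n) * mono (dec n))"
proof -
  assume P: "P \<in> V N r"
  have inj: "inj_on (\<lambda>n. expo (dec n)) (S N r)" by (rule inj_onI) (simp add: expo_dec_inj)
  have "P = (\<Sum>m\<in>(\<lambda>n. expo (dec n)) ` S N r. single m (lookup P m))"
    using P finite_S by (intro poly_mapping_sum_single) (auto simp: V_def)
  also have "\<dots> = (\<Sum>n\<in>S N r. single (expo (dec n)) (lookup P (expo (dec n))))"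
    using inj by (simp add: sum.reindex)
  finally show ?thesis by (simp add: mono_def const_mult_single piV_def)
qed

definition vec_poly :: "nat \<Rightarrow> nat \<Rightarrow> (nat list \<Rightarrow> rat) \<Rightarrow> mpoly" where
  "vec_poly N r v = (\<Sum>n\<in>S N r. const (v n) * mono (dec n))"

lemma piV_vec_poly: "v \<in> supp_on (S N r) \<Longrightarrow> piV N r (vec_poly N r v) = v"
proof
  fix n assume v: "v \<in> supp_on (S N r)"
  show "piV N r (vec_poly N r v) n = v n"
  proof (cases "n \<in> S N r")
    case True
    have "lookup (vec_poly N r v) (expo (dec n)) = (\<Sum>k\<in>S N r. if k = n then v k else 0)"
      unfolding vec_poly_def lookup_sum using True
      by (intro sum.cong) (auto simp: lookup_const_mult mono_def lookup_single when_def expo_dec_inj)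
    then show ?thesis using True finite_S by (simp add: piV_def)
  next
    case False then show ?thesis using v by (simp add: piV_def supp_on_def)
  qed
qed

lemma vec_poly_V: "vec_poly N r v \<in> V N r"
proof -
  have "keys (vec_poly N r v) \<subseteq> (\<Union>n\<in>S N r. keys (const (v n) * mono (dec n)))"
    unfolding vec_poly_def by (rule keys_sum)
  also have "\<dots> \<subseteq> (\<lambda>n. expo (dec n)) ` S N r"
    by (auto simp: in_keys_iff lookup_const_mult mono_def lookup_single when_def split: if_splits)
  finally show ?thesis by (simp add: V_def)
qed

lemma piV_image_V: "piV N r ` V N r = supp_on (S N r)"
proof (intro equalityI subsetI)
  fix v assume "v \<in> supp_on (S N r)"
  then show "v \<in> piV N r ` V N r" using piV_vec_poly vec_poly_V by (metis image_eqI)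
qed (auto simp: piV_supp)

lemma piV_inj: "P \<in> V N r \<Longrightarrow> Q \<in> V N r \<Longrightarrow> piV N r P = piV N r Q \<Longrightarrow> P = Q"
  using V_expand by metis

lemma psubst_V: "P \<in> V N r \<Longrightarrow> psubst \<sigma> P = (\<Sum>n\<in>S N r. const (piV N r P n) * (\<Prod>i<r. \<sigma> i ^ (dec n ! i)))"
proof -
  assume P: "P \<in> V N r"
  have "psubst \<sigma> (const c) = const c" for c
    by (simp add: const_def psubst_single subst_mon_def)
  then have "psubst \<sigma> P = (\<Sum>n\<in>S N r. const (piV N r P n) * psubst \<sigma> (mono (dec n)))"
    by (subst V_expand[OF P]) (simp add: psubst_sum psubst_mult)
  also have "\<dots> = (\<Sum>n\<in>S N r. const (piV N r P n) * (\<Prod>i<r. \<sigma> i ^ (dec n ! i)))"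
    by (intro sum.cong refl) (simp add: psubst_mono S_D(1))
  finally show ?thesis .
qed

section \<open>The dimension of the space of even period polynomials\<close>

interpretation pv: vector_space "smult :: rat \<Rightarrow> rat poly \<Rightarrow> rat poly"
  by unfold_locales (auto simp: smult_add_right smult_add_left)

interpretation pv_pair: vector_space_pair "smult :: rat \<Rightarrow> rat poly \<Rightarrow> rat poly" "smult :: rat \<Rightarrow> rat poly \<Rightarrow> rat poly"
  by unfold_locales

interpretation rat_vs: vector_space "(*) :: rat \<Rightarrow> rat \<Rightarrow> rat"
  by unfold_locales (auto simp: algebra_simps)

interpretation pv_rat: vector_space_pair "smult :: rat \<Rightarrow> rat poly \<Rightarrow> rat poly" "(*) :: rat \<Rightarrow> rat \<Rightarrow> rat"
  by unfold_locales

interpretation pv_fv: vector_space_pair "smult :: rat \<Rightarrow> rat poly \<Rightarrow> rat poly"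
    "fscale :: rat \<Rightarrow> ('a \<Rightarrow> rat) \<Rightarrow> 'a \<Rightarrow> rat"
  by unfold_locales

interpretation fv_pv: vector_space_pair "fscale :: rat \<Rightarrow> ('a \<Rightarrow> rat) \<Rightarrow> 'a \<Rightarrow> rat"
    "smult :: rat \<Rightarrow> rat poly \<Rightarrow> rat poly"
  by unfold_locales

text \<open>The points 0 and 1 are excluded because the evaluations of \<open>flip\<close> and of
  its composites with \<open>tau\<close> involve 1/t and 1/(1-t).\<close>

lemma poly_eqI_except:
  fixes p q :: "rat poly"
  assumes "\<And>t. t \<noteq> 0 \<Longrightarrow> t \<noteq> 1 \<Longrightarrow> poly p t = poly q t"
  shows "p = q"
proof (rule ccontr)
  assume "p \<noteq> q"
  then have "finite {t. poly (p - q) t = 0}" by (intro poly_roots_finite) simp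
  moreover have "UNIV - {0, 1} \<subseteq> {t. poly (p - q) t = 0}" using assms by auto
  ultimately have "finite (UNIV - {0, 1 :: rat})" using finite_subset by blast
  then show False by (simp add: infinite_UNIV_char_0)
qed

text \<open>A polynomial \<open>p\<close> of degree at most \<open>w\<close> stands for the binary form \<open>P\<close> of degree \<open>w\<close> with
  \<open>p(t) = P(t,1)\<close>. For even \<open>w\<close>, \<open>flip\<close> and \<open>tau\<close> are the involutions \<open>P(y,x)\<close> and \<open>P(y-x,y)\<close>, which
  generate a copy of \<open>S\<^sub>3\<close>.\<close>

definition flip :: "nat \<Rightarrow> rat poly \<Rightarrow> rat poly" where
  "flip w p = (\<Sum>a\<le>w. monom (coeff p (w - a)) a)"

definition tau :: "rat poly \<Rightarrow> rat poly" where
  "tau p = pcompose p [:1, -1:]"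

lemma coeff_flip: "coeff (flip w p) a = (if a \<le> w then coeff p (w - a) else 0)"
  by (auto simp: flip_def coeff_sum)

lemma degree_flip: "degree (flip w p) \<le> w"
  by (rule degree_le) (simp add: coeff_flip)

lemma flip_flip: "degree p \<le> w \<Longrightarrow> flip w (flip w p) = p"
  by (rule poly_eqI) (auto simp: coeff_flip coeff_eq_0)

lemma flip_add: "flip w (p + q) = flip w p + flip w q"
  and flip_diff: "flip w (p - q) = flip w p - flip w q"
  and flip_0: "flip w 0 = 0"
  and flip_minus: "flip w (- p) = - flip w p"
  and flip_smult: "flip w (smult c p) = smult c (flip w p)"
  by (auto intro!: poly_eqI simp: coeff_flip)

lemma poly_flip:
  assumes "degree p \<le> w" "t \<noteq> 0"
  shows "poly (flip w p) t = t ^ w * poly p (1 / t)"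
proof -
  have "poly (flip w p) t = (\<Sum>a\<le>w. coeff p (w - a) * t ^ a)"
    by (simp add: flip_def poly_sum poly_monom)
  also have "\<dots> = (\<Sum>a\<le>w. coeff p a * t ^ (w - a))"
    by (rule sum.reindex_bij_witness[where i = "\<lambda>a. w - a" and j = "\<lambda>a. w - a"]) auto
  also have "\<dots> = (\<Sum>a\<le>w. t ^ w * (coeff p a * (1 / t) ^ a))"
    using assms(2) by (intro sum.cong refl) (auto simp: power_diff power_one_over field_simps)
  also have "\<dots> = t ^ w * poly (\<Sum>a\<le>w. monom (coeff p a) a) (1 / t)"
    by (simp add: poly_sum poly_monom sum_distrib_left)
  also have "(\<Sum>a\<le>w. monom (coeff p a) a) = p" using assms(1) by (rule poly_as_sum_of_monoms')
  finally show ?thesis .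
qed

lemma tau_add: "tau (p + q) = tau p + tau q"
  and tau_diff: "tau (p - q) = tau p - tau q"
  and tau_0: "tau 0 = 0"
  and tau_minus: "tau (- p) = - tau p"
  and tau_smult: "tau (smult c p) = smult c (tau p)"
  and tau_mult: "tau (p * q) = tau p * tau q"
  by (simp_all add: tau_def pcompose_add pcompose_diff pcompose_uminus pcompose_smult pcompose_mult)

lemma poly_tau [simp]: "poly (tau p) t = poly p (1 - t)"
  by (simp add: tau_def poly_pcompose)

lemma degree_tau [simp]: "degree (tau p) = degree p"
  by (simp add: tau_def degree_pcompose)

lemma tau_tau [simp]: "tau (tau p) = p"
  by (rule poly_eqI_except) simp

text \<open>The braid relation of S_3. It holds on polynomials because \<open>w\<close> is even, so
  that (t-1)^w = (1-t)^w.\<close>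

lemma tau_flip_tau:
  assumes "degree p \<le> w" "even w"
  shows "tau (flip w (tau p)) = flip w (tau (flip w p))"
proof (rule poly_eqI_except)
  fix t :: rat assume t: "t \<noteq> 0" "t \<noteq> 1"
  have "poly (tau (flip w (tau p))) t = (1 - t) ^ w * poly p (1 - 1 / (1 - t))"
    using t assms by (simp add: poly_flip)
  also have "1 - 1 / (1 - t) = 1 / (1 - 1 / t)" using t by (simp add: field_simps)
  also have "(1 - t) ^ w = t ^ w * (1 - 1 / t) ^ w"
  proof -
    have "t ^ w * (1 - 1 / t) ^ w = (t - 1) ^ w"
      using t by (simp add: power_mult_distrib[symmetric] algebra_simps)
    also have "\<dots> = (1 - t) ^ w" using assms(2) by (metis minus_diff_eq power_minus_even)
    finally show ?thesis by simp
  qed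
  also have "t ^ w * (1 - 1 / t) ^ w * poly p (1 / (1 - 1 / t)) = poly (flip w (tau (flip w p))) t"
    using t assms by (simp add: poly_flip degree_flip)
  finally show "poly (tau (flip w (tau p))) t = poly (flip w (tau (flip w p))) t" .
qed

text \<open>On polynomials with \<open>flip w p = - p\<close> this is half of the alternating sum
  over S_3: the six terms coincide in pairs. Its values on \<open>even_anti w\<close> therefore lie
  in the sign-isotypic part.\<close>

definition norm_sum :: "nat \<Rightarrow> rat poly \<Rightarrow> rat poly" where
  "norm_sum w p = p - tau p + flip w (tau p)"

definition even_poly :: "rat poly \<Rightarrow> bool" where
  "even_poly p \<longleftrightarrow> (\<forall>a. odd a \<longrightarrow> coeff p a = 0)"

text \<open>The depth-two space W_{w+2,2}, dehomogenised. Here \<open>flip w (tau p)\<close> stands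
  for P(x-y,x), which is the P(y-x,x) of the defining relation because P is even in its first
  variable.\<close>

definition period_polys :: "nat \<Rightarrow> rat poly set" where
  "period_polys w = {p. degree p \<le> w \<and> even_poly p \<and> coeff p 0 = 0 \<and> coeff p w = 0 \<and> p = tau p - flip w (tau p)}"

definition even_anti :: "nat \<Rightarrow> rat poly set" where
  "even_anti w = {p. degree p \<le> w \<and> even_poly p \<and> coeff p 0 = 0 \<and> flip w p = - p}"

definition sign_part :: "nat \<Rightarrow> rat poly set" where
  "sign_part w = {p. degree p \<le> w \<and> tau p = - p \<and> flip w p = - p}"

text \<open>A difference q - flip q changes sign under \<open>flip\<close>, and the relation writes
  \<open>p\<close> in this form.\<close>

lemma period_polys_anti: "p \<in> period_polys w \<Longrightarrow> flip w p = - p"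
proof -
  assume p: "p \<in> period_polys w"
  then have e: "p = tau p - flip w (tau p)" and "degree p \<le> w" by (auto simp: period_polys_def)
  have "flip w p = flip w (tau p) - flip w (flip w (tau p))" by (subst e) (simp add: flip_diff)
  also have "\<dots> = - p" using flip_flip[of "tau p" w] \<open>degree p \<le> w\<close> e by simp
  finally show ?thesis .
qed

lemma period_polys_eq_kernel: "period_polys w = {p \<in> even_anti w. norm_sum w p = 0}"
proof (intro equalityI subsetI)
  fix p assume p: "p \<in> period_polys w"
  then show "p \<in> {p \<in> even_anti w. norm_sum w p = 0}"
    using period_polys_anti[OF p] by (auto simp: period_polys_def even_anti_def norm_sum_def)
next
  fix p assume p: "p \<in> {p \<in> even_anti w. norm_sum w p = 0}"
  then have "coeff (flip w p) 0 = 0" by (auto simp: even_anti_def)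
  then have "coeff p w = 0" by (simp add: coeff_flip)
  moreover have "p = tau p - flip w (tau p)" using p by (simp add: norm_sum_def algebra_simps eq_neg_iff_add_eq_0)
  ultimately show "p \<in> period_polys w" using p by (auto simp: period_polys_def even_anti_def)
qed

lemma linear_norm_sum: "Vector_Spaces.linear smult smult (norm_sum w)"
  by (intro Vector_Spaces.linear_iff[THEN iffD2] conjI allI pv.vector_space_axioms)
    (auto simp: norm_sum_def flip_add flip_smult tau_add tau_smult smult_diff_right smult_add_right)

lemma subspace_even_anti: "pv.subspace (even_anti w)"
  by (auto simp: pv.subspace_def even_anti_def even_poly_def degree_add_le flip_add flip_smult flip_0
      intro: order_trans[OF degree_smult_le])

lemma subspace_sign_part: "pv.subspace (sign_part w)"
  by (auto simp: pv.subspace_def sign_part_def tau_add tau_smult degree_add_le flip_add flip_smult flip_0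
      tau_0 intro: order_trans[OF degree_smult_le])

lemma degree_le_finite_span: "\<exists>B. finite B \<and> {p. degree p \<le> w} \<subseteq> pv.span B"
proof (intro exI conjI subsetI)
  let ?B = "(\<lambda>a. monom 1 a) ` {..w} :: rat poly set"
  show "finite ?B" by simp
  fix p :: "rat poly" assume "p \<in> {p. degree p \<le> w}"
  then have "p = (\<Sum>a\<le>w. smult (coeff p a) (monom 1 a))"
    by (simp add: smult_monom poly_as_sum_of_monoms')
  moreover have "\<dots> \<in> pv.span ?B" by (intro pv.span_sum pv.span_scale pv.span_base) auto
  ultimately show "p \<in> pv.span ?B" by simp
qed

lemma norm_sum_in_sign_part:
  assumes "p \<in> even_anti w" "even w"
  shows "norm_sum w p \<in> sign_part w"
proof -
  have d: "degree p \<le> w" and f: "flip w p = - p" using assms(1) by (auto simp: even_anti_def)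
  have 1: "tau (flip w (tau p)) = - flip w (tau p)"
    using tau_flip_tau[OF d assms(2)] f by (simp add: tau_minus flip_minus)
  have "tau (norm_sum w p) = - norm_sum w p" by (simp add: norm_sum_def tau_add tau_diff 1)
  moreover have "flip w (norm_sum w p) = - norm_sum w p"
    using d by (simp add: norm_sum_def flip_add flip_diff f flip_flip)
  moreover have "degree (norm_sum w p) \<le> w"
    using d degree_flip by (auto simp: norm_sum_def intro!: degree_add_le degree_diff_le)
  ultimately show ?thesis by (simp add: sign_part_def)
qed

text \<open>The form x^w - y^w is the extremal solution of the period relation. Subtracting
  multiples of it removes extremal coefficients without changing \<open>norm_sum\<close>.\<close>

lemma norm_sum_monom_diff:
  assumes "even w" shows "norm_sum w (monom 1 w - 1) = 0"
proof (rule poly_eqI_except)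
  fix t :: rat assume t: "t \<noteq> 0" "t \<noteq> 1"
  have "degree (tau (monom 1 w - 1)) \<le> w" by (simp add: degree_monom_le degree_diff_le)
  then have "poly (norm_sum w (monom 1 w - 1)) t = t ^ w - (1 - t) ^ w + t ^ w * ((1 - 1 / t) ^ w - 1)"
    using t by (simp add: norm_sum_def poly_flip poly_monom)
  also have "\<dots> = t ^ w * (1 - 1 / t) ^ w - (1 - t) ^ w" by (simp add: algebra_simps)
  also have "t ^ w * (1 - 1 / t) ^ w = (t - 1) ^ w"
    using t by (simp add: power_mult_distrib[symmetric] algebra_simps)
  also have "(t - 1) ^ w = (1 - t) ^ w" using assms by (metis minus_diff_eq power_minus_even)
  finally show "poly (norm_sum w (monom 1 w - 1)) t = poly 0 t" by simp
qed

text \<open>A functional \<open>f\<close> that kills the image of \<open>norm_sum w\<close> extends to one on all polynomials of degree at most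
  \<open>w\<close> that changes sign under both \<open>t \<mapsto> 1 - t\<close> and \<open>t \<mapsto> - t\<close>, hence is invariant under translation,
  hence vanishes.\<close>

lemma norm_sum_surj:
  assumes "even w"
  shows "norm_sum w ` even_anti w = sign_part w"
proof (intro equalityI subsetI)
  fix q assume "q \<in> norm_sum w ` even_anti w"
  then show "q \<in> sign_part w" using norm_sum_in_sign_part assms by blast
next
  fix q assume q: "q \<in> sign_part w"
  show "q \<in> norm_sum w ` even_anti w"
  proof (rule ccontr)
    assume nq: "q \<notin> norm_sum w ` even_anti w"
    let ?X = "norm_sum w ` even_anti w"
    have subX: "pv.subspace ?X" using pv_pair.linear_subspace_image[OF linear_norm_sum subspace_even_anti] .
    obtain B where B: "B \<subseteq> ?X" "pv.independent B" "?X \<subseteq> pv.span B"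
      by (rule pv.basis_exists[of ?X])
    have "pv.span B \<subseteq> ?X" using B(1) subX by (rule pv.span_minimal)
    then have "q \<notin> pv.span B" using nq by blast
    then have "pv.independent (insert q B)" using B(2) by (rule pv.independent_insertI)
    then obtain f where f: "Vector_Spaces.linear smult (*) f"
      and fB: "\<forall>x\<in>insert q B. f x = (if x = q then 1 else 0 :: rat)"
      using pv_rat.linear_independent_extend[of "insert q B" "\<lambda>x. if x = q then 1 else 0"] by auto
    have fq: "f q = 1" using fB by simp
    have "f x = 0" if "x \<in> B" for x using fB that nq B(1) by auto
    then have fX: "f x = 0" if "x \<in> ?X" for x
      using pv_rat.linear_eq_0_on_span[OF f, of B x] that B(3) by blast
    note f_lin = pv_rat.linear_add[OF f] pv_rat.linear_diff[OF f] pv_rat.linear_neg[OF f]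
      pv_rat.linear_scale[OF f] pv_rat.linear_sum[OF f]
    note N_lin = pv_pair.linear_add[OF linear_norm_sum] pv_pair.linear_diff[OF linear_norm_sum]
      pv_pair.linear_neg[OF linear_norm_sum] pv_pair.linear_scale[OF linear_norm_sum]
    \<comment> \<open>Antisymmetrising first makes the functional meaningful on all polynomials of
      degree at most \<open>w\<close>, not only on antisymmetric ones.\<close>
    define g where "g p = f (norm_sum w (p - flip w p))" for p
    have g_add: "g (p + r) = g p + g r" for p r
    proof -
      have "p + r - flip w (p + r) = (p - flip w p) + (r - flip w r)" by (simp add: flip_add)
      then show ?thesis by (simp only: g_def N_lin f_lin)
    qed
    have g_smult: "g (smult c p) = c * g p" for p c
    proof -
      have "smult c p - flip w (smult c p) = smult c (p - flip w p)" by (simp add: flip_smult smult_diff_right)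
      then show ?thesis by (simp only: g_def N_lin f_lin)
    qed
    have g_even: "g p = 0" if "even_poly p" "degree p \<le> w" for p
    proof -
      let ?r = "p - flip w p"
      let ?c = "coeff ?r w"
      \<comment> \<open>The antisymmetrisation of an even polynomial may have extremal terms c (t^w
        - 1). Removing them lands in \<open>even_anti w\<close>, where \<open>f\<close> after
        \<open>norm_sum\<close> vanishes.\<close>
      let ?s = "?r - smult ?c (monom 1 w - 1)"
      have fr: "flip w ?r = - ?r" using that(2) by (simp add: flip_diff flip_flip)
      have cc: "coeff ?r 0 = - ?c"
        using arg_cong[OF fr, of "\<lambda>p. coeff p w"] by (simp add: coeff_flip)
      have "?s \<in> even_anti w"
        unfolding even_anti_def
      proof (intro CollectI conjI)
        show "degree ?s \<le> w" using that(2) degree_flip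
          by (auto intro!: degree_diff_le order_trans[OF degree_smult_le] simp: degree_monom_le)
        show "even_poly ?s"
          using that assms by (auto simp: even_poly_def coeff_flip coeff_1 coeff_monom)
        show "coeff ?s 0 = 0"
        proof (cases "w = 0")
          case True then show ?thesis using cc by (simp add: coeff_monom)
        next
          case False then show ?thesis using cc by (simp add: coeff_monom)
        qed
        have "flip w (monom 1 w - 1) = - (monom 1 w - 1)"
          by (rule poly_eqI) (auto simp: coeff_flip coeff_monom coeff_1)
        then have "flip w ?s = - ?r - smult ?c (- (monom 1 w - 1))" by (simp only: flip_diff[of w ?r] fr flip_smult)
        also have "\<dots> = - ?s" by (simp only: smult_minus_right)
        finally show "flip w ?s = - ?s" .
      qed
      then have "f (norm_sum w ?s) = 0" using fX by blast
      moreover have "norm_sum w ?s = norm_sum w ?r" 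
      proof -
        have "norm_sum w ?s = norm_sum w ?r - smult ?c (norm_sum w (monom 1 w - 1))"
          by (subst N_lin(2), subst N_lin(4), rule refl)
        then show ?thesis by (simp only: norm_sum_monom_diff[OF assms] smult_0_right diff_0_right)
      qed
      ultimately show ?thesis by (simp add: g_def)
    qed
    have g_tau: "g (tau p) = - g p" if d: "degree p \<le> w" for p
    proof -
      have d': "degree (tau (flip w p)) \<le> w" "degree (tau p) \<le> w" "degree (flip w (tau p)) \<le> w"
        using d degree_flip by simp_all
      have 1: "flip w (tau (flip w (tau p))) = tau (flip w p)"
        using tau_flip_tau[OF d assms] d' flip_flip by metis
      have "norm_sum w (tau p - flip w (tau p)) = - norm_sum w (p - flip w p)"
        by (simp add: norm_sum_def tau_diff flip_diff 1 tau_flip_tau[OF d assms] flip_flip[OF d'(1)] algebra_simps)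
      then show ?thesis by (simp add: g_def f_lin)
    qed
    let ?eps = "\<lambda>p :: rat poly. pcompose p [:0, -1:]"
    have coeff_eps: "coeff (?eps p) a = (-1) ^ a * coeff p a" for p a
      by (simp add: coeff_pcompose_linear)
    have g_eps: "g (?eps p) = - g p" if "degree p \<le> w" for p
    proof -
      have "even_poly (p + ?eps p)" by (auto simp: even_poly_def coeff_eps)
      moreover have "degree (p + ?eps p) \<le> w" using that by (intro degree_add_le) (auto simp: degree_pcompose)
      ultimately have "g (p + ?eps p) = 0" by (rule g_even)
      then show ?thesis by (simp add: g_add)
    qed
    have g_shift: "g (pcompose p [:1, 1:]) = g p" if "degree p \<le> w" for p
    proof -
      \<comment> \<open>Translation by 1 is a product of two reflections, so the two signs
        cancel.\<close>
      have "pcompose p [:1, 1:] = ?eps (tau p)"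
        by (simp add: tau_def pcompose_assoc[symmetric] pcompose_pCons)
      then show ?thesis using g_eps[of "tau p"] g_tau[OF that] that by simp
    qed
    have g_sum: "g (\<Sum>i\<in>A. smult (c i) (h i)) = (\<Sum>i\<in>A. c i * g (h i))" if "finite A" for A :: "nat set" and c h
      using that by (induction A rule: finite_induct) (use g_smult[of 0 0] in \<open>auto simp: g_add g_smult\<close>)
    have g_monom: "g (monom 1 j) = 0" if "j < w" for j
      using that
    proof (induction j rule: less_induct)
      case (less j)
      have "pcompose (monom 1 (Suc j)) [:1, 1:] = (\<Sum>i\<le>Suc j. smult (of_nat (Suc j choose i)) (monom 1 i) :: rat poly)"
      proof (rule poly_eqI_except)
        fix t :: rat
        have "poly (pcompose (monom 1 (Suc j)) [:1, 1:]) t = (t + 1) ^ Suc j"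
          by (simp add: poly_pcompose poly_monom add.commute)
        also have "\<dots> = (\<Sum>i\<le>Suc j. of_nat (Suc j choose i) * t ^ i)"
          by (subst binomial_ring) simp
        finally show "poly (pcompose (monom 1 (Suc j)) [:1, 1:]) t =
            poly (\<Sum>i\<le>Suc j. smult (of_nat (Suc j choose i)) (monom 1 i)) t"
          by (simp add: poly_sum poly_monom)
      qed
      \<comment> \<open>Translation invariance at t^(j+1): the top terms cancel and the terms below
        t^j vanish by induction, leaving (j+1) g(t^j) = 0. This needs j+1 <= w, so t^w remains; it
        is killed because it is even.\<close>
      then have "g (monom 1 (Suc j)) = (\<Sum>i\<le>Suc j. of_nat (Suc j choose i) * g (monom 1 i))"
        using g_shift[of "monom 1 (Suc j)"] less.prems
        by (simp add: degree_monom_eq g_sum del: sum.atMost_Suc)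
      also have "\<dots> = (\<Sum>i<j. of_nat (Suc j choose i) * g (monom 1 i)) + of_nat (Suc j) * g (monom 1 j)
          + g (monom 1 (Suc j))"
        by (simp add: lessThan_Suc_atMost[symmetric])
      also have "(\<Sum>i<j. of_nat (Suc j choose i) * g (monom 1 i)) = 0"
        using less by (intro sum.neutral) auto
      finally have "of_nat (Suc j) * g (monom 1 j) = 0" by simp
      then show ?case by (simp del: of_nat_Suc)
    qed
    have "even_poly (monom 1 w)" using assms by (auto simp: even_poly_def coeff_monom)
    then have gw: "g (monom 1 w) = 0" using g_even[of "monom 1 w"] by (simp add: degree_monom_le)
    have d: "degree q \<le> w" and tq: "tau q = - q" and rq: "flip w q = - q" using q by (auto simp: sign_part_def)
    have "q = (\<Sum>a\<le>w. smult (coeff q a) (monom 1 a))"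
      using d by (simp add: smult_monom poly_as_sum_of_monoms')
    then have "g q = (\<Sum>a\<le>w. coeff q a * g (monom 1 a))" using g_sum[of "{..w}" "coeff q" "monom 1"] by simp
    also have "\<dots> = 0"
      using g_monom gw by (intro sum.neutral) (auto simp: le_less)
    finally have "g q = 0" .
    \<comment> \<open>On the sign part, q - flip q is 2q and \<open>norm_sum\<close> is
      multiplication by 3. So the value 1 of \<open>f\<close> at \<open>q\<close> contradicts
      \<open>g q = 0\<close>.\<close>
    moreover have "norm_sum w (q - flip w q) = smult 6 q"
      unfolding norm_sum_def tau_diff flip_diff rq tau_minus tq flip_minus minus_minus
      by (rule poly_eqI) (simp only: coeff_add coeff_diff coeff_minus coeff_smult)
    ultimately show False using fq by (simp add: g_def f_lin)
  qed
qed

lemma pv_dim_rank_nullity: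
  assumes "Vector_Spaces.linear smult smult f" "pv.subspace X" "X \<subseteq> {p. degree p \<le> w}"
  shows "pv.dim X = pv.dim {p \<in> X. f p = 0} + pv.dim (f ` X)"
proof -
  obtain B where "finite B" "{p. degree p \<le> w} \<subseteq> pv.span B" using degree_le_finite_span by blast
  then show ?thesis using pv_pair.dim_kernel_image[OF assms(1,2), of B] assms(3) by blast
qed

lemma dim_period_polys_add:
  assumes "even w"
  shows "pv.dim (period_polys w) + pv.dim (sign_part w) = pv.dim (even_anti w)"
proof -
  have "even_anti w \<subseteq> {p. degree p \<le> w}" by (auto simp: even_anti_def)
  then show ?thesis
    using pv_dim_rank_nullity[OF linear_norm_sum subspace_even_anti, of w w w]
    unfolding period_polys_eq_kernel norm_sum_surj[OF assms] by simp
qed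

text \<open>A basis is formed by t^{2b} - t^{2h-2b} with 1 <= b < h/2. The coefficients below the
  middle are free, the middle one is its own negative, and those above are determined by
  antisymmetry.\<close>

lemma dim_even_anti: "pv.dim (even_anti (2 * h)) = (h - 1) div 2"
proof -
  let ?I = "{b. 1 \<le> b \<and> 2 * b < h}"
  define f where "f p = (\<lambda>b. if b \<in> ?I then coeff p (2 * b) else 0)" for p :: "rat poly"
  have lin: "Vector_Spaces.linear smult fscale f"
    by (intro Vector_Spaces.linear_iff[THEN iffD2] conjI allI pv.vector_space_axioms fv.vector_space_axioms)
      (auto simp: f_def fun_eq_iff)
  have finI: "finite ?I" by (rule finite_subset[of _ "{..h}"]) auto
  obtain B where B: "finite B" "{p. degree p \<le> 2 * h} \<subseteq> pv.span B" using degree_le_finite_span by blast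
  have "even_anti (2 * h) \<subseteq> {p. degree p \<le> 2 * h}" by (auto simp: even_anti_def)
  then have sp: "even_anti (2 * h) \<subseteq> pv.span B" using B(2) by blast
  have "fv.dim (f ` even_anti (2 * h)) = pv.dim (even_anti (2 * h))"
  proof (rule pv_fv.dim_image_inj_on[OF lin subspace_even_anti B(1) sp])
    fix p assume p: "p \<in> even_anti (2 * h)" and fp: "f p = 0"
    have low: "coeff p (2 * b) = 0" if "1 \<le> b" "2 * b < h" for b
      using fun_cong[OF fp, of b] that by (simp add: f_def)
    have anti: "coeff p a = - coeff p (2 * h - a)" if "a \<le> 2 * h" for a
    proof -
      have "flip (2 * h) p = - p" using p by (simp add: even_anti_def)
      then have "coeff (flip (2 * h) p) a = - coeff p a" by simp
      then show ?thesis using that by (simp add: coeff_flip)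
    qed
    have z: "coeff p (2 * b) = 0" if "2 * b < h" for b
      using low[of b] that p by (cases "b = 0") (auto simp: even_anti_def)
    have "coeff p a = 0" for a
    proof (cases "odd a \<or> a > 2 * h")
      case True then show ?thesis using p by (auto simp: even_anti_def even_poly_def coeff_eq_0)
    next
      case False
      then obtain b where b: "a = 2 * b" "b \<le> h" by (auto elim!: evenE)
      consider "2 * b < h" | "2 * b = h" | "2 * (h - b) < h" using b(2) by linarith
      then show ?thesis
      proof cases
        case 1 then show ?thesis using z b by simp
      next
        case 2 then show ?thesis using anti[of h] b by simp
      next
        case 3
        then have "coeff p (2 * (h - b)) = 0" by (rule z)
        then show ?thesis using anti[of a] b by (simp add: diff_mult_distrib2)
      qed
    qed
    then show "p = 0" by (simp add: poly_eq_iff)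
  qed
  moreover have "f ` even_anti (2 * h) = supp_on ?I"
  proof (intro equalityI subsetI)
    fix v assume "v \<in> f ` even_anti (2 * h)" then show "v \<in> supp_on ?I" by (auto simp: supp_on_def f_def)
  next
    fix v assume v: "v \<in> supp_on ?I"
    define p where "p = (\<Sum>b\<in>?I. monom (v b) (2 * b) - monom (v b) (2 * h - 2 * b))"
    have cp: "coeff p a = (\<Sum>b\<in>?I. (if 2 * b = a then v b else 0) - (if 2 * h - 2 * b = a then v b else 0))" for a
      by (simp add: p_def coeff_sum)
    have "p \<in> even_anti (2 * h)" unfolding even_anti_def
    proof (intro CollectI conjI)
      show "degree p \<le> 2 * h" unfolding p_def
        by (intro degree_sum_le finI degree_diff_le order_trans[OF degree_monom_le]) auto
      show "even_poly p" unfolding even_poly_def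
      proof (intro allI impI)
        fix a :: nat assume "odd a"
        then have "2 * b \<noteq> a \<and> 2 * h - 2 * b \<noteq> a" for b
          by (metis diff_mult_distrib2 dvd_triv_left)
        then show "coeff p a = 0" by (simp add: cp)
      qed
      show "coeff p 0 = 0" unfolding cp by (intro sum.neutral) auto
      show "flip (2 * h) p = - p"
      proof (rule poly_eqI)
        fix a
        show "coeff (flip (2 * h) p) a = coeff (- p) a"
        proof (cases "a \<le> 2 * h")
          case True
          have "(\<Sum>b\<in>?I. (if 2 * b = 2 * h - a then v b else 0) - (if 2 * h - 2 * b = 2 * h - a then v b else 0))
             = - (\<Sum>b\<in>?I. (if 2 * b = a then v b else 0) - (if 2 * h - 2 * b = a then v b else 0))"
            unfolding sum_negf[symmetric] using True by (intro sum.cong refl) auto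
          then show ?thesis using True by (simp add: coeff_flip cp)
        next
          case False
          then have "degree p < a" using \<open>degree p \<le> 2 * h\<close> by simp
          then show ?thesis using False by (simp add: coeff_flip coeff_eq_0)
        qed
      qed
    qed
    moreover have "f p = v"
    proof
      fix b
      show "f p b = v b"
      proof (cases "b \<in> ?I")
        case True
        have "coeff p (2 * b) = (\<Sum>c\<in>?I. if c = b then v c else 0)"
          unfolding cp using True by (intro sum.cong refl) auto
        then show ?thesis using True finI by (simp add: f_def)
      next
        case False then show ?thesis using v unfolding f_def supp_on_def by auto
      qed
    qed
    ultimately show "v \<in> f ` even_anti (2 * h)" by blast
  qed
  moreover have "card ?I = (h - 1) div 2"
  proof -
    have "?I = {1..(h - 1) div 2}" by auto
    then show ?thesis by simp
  qed
  ultimately show ?thesis using dim_supp_on[OF finI] by simp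
qed

section \<open>Dimension of the sign-isotypic part\<close>

lemma odd_degree_tau_anti:
  assumes "tau p = - p" "p \<noteq> 0" shows "odd (degree p)"
proof
  assume "even (degree p)"
  \<comment> \<open>The substitution t -> 1-t multiplies the leading coefficient by
    (-1)^degree.\<close>
  then have "lead_coeff (tau p) = lead_coeff p"
    unfolding tau_def by (subst lead_coeff_comp) auto
  then have "lead_coeff p = - lead_coeff p" using assms(1) by simp
  then show False using assms(2) by simp
qed

lemma sign_part_low_coeffs:
  assumes "p \<in> sign_part w" "even w"
  shows "coeff p 0 = 0" "coeff p w = 0"
proof -
  have d: "degree p \<le> w" and f: "flip w p = - p" and t: "tau p = - p"
    using assms(1) by (auto simp: sign_part_def)
  show w: "coeff p w = 0"
    using odd_degree_tau_anti[OF t] d assms(2) by (metis coeff_0 coeff_eq_0 le_neq_implies_less)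
  have "coeff (flip w p) 0 = - coeff p 0" using f by simp
  then show "coeff p 0 = 0" using w by (simp add: coeff_flip)
qed

text \<open>The base cases w = 0, 2, 4 of the recursion in steps of 6; the first nonzero element has
  w = 6.\<close>

lemma sign_part_small:
  assumes "w < 6" "even w" shows "sign_part w = {0}"
proof -
  have "p = 0" if p: "p \<in> sign_part w" for p
  proof -
    have d: "degree p \<le> w" and f: "flip w p = - p" and t: "tau p = - p"
      using p by (auto simp: sign_part_def)
    have anti: "coeff p a = - coeff p (w - a)" if "a \<le> w" for a
      using arg_cong[OF f, of "\<lambda>p. coeff p a"] that by (simp add: coeff_flip)
    have c0: "coeff p 0 = 0" "coeff p w = 0" using sign_part_low_coeffs[OF p assms(2)] by auto
    have hi: "coeff p a = 0" if "a > w" for a using that d by (simp add: coeff_eq_0)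
    have "w = 0 \<or> w = 2 \<or> w = 4" using assms by presburger
    then consider "w = 0" | "w = 2" | "w = 4" by blast
    then show ?thesis
    proof cases
      case 1
      then show ?thesis using c0 hi by (metis leading_coeff_0_iff d le_zero_eq)
    next
      case 2
      have "coeff p 1 = 0" using anti[of 1] 2 by simp
      then have "coeff p a = 0" for a using c0 hi[of a] 2 by (cases "a = 0 \<or> a = 1 \<or> a = 2") auto
      then show ?thesis by (simp add: poly_eq_iff)
    next
      case 3
      have c2: "coeff p 2 = 0" using anti[of 2] 3 by simp
      have c13: "coeff p 1 = - coeff p 3" using anti[of 1] 3 by simp
      have pe: "poly p x = coeff p 3 * (x ^ 3 - x)" for x
      proof -
        have "poly p x = poly (\<Sum>i\<le>4. monom (coeff p i) i) x"
          using d 3 poly_as_sum_of_monoms'[of p 4] by simp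
        also have "\<dots> = (\<Sum>i\<le>4. coeff p i * x ^ i)" by (simp only: poly_sum poly_monom)
        also have "\<dots> = coeff p 0 + coeff p 1 * x + coeff p 2 * x ^ 2 + coeff p 3 * x ^ 3 + coeff p 4 * x ^ 4"
          by (simp add: eval_nat_numeral)
        finally show ?thesis using c0 c2 c13 3 by (simp add: right_diff_distrib)
      qed
      \<comment> \<open>The point 2 goes to -1, a root of t^3 - t, while 2 itself is not a
        root.\<close>
      have "poly (tau p) 2 = - poly p 2" using t by simp
      then have "coeff p 3 = 0" by (simp add: pe)
      then have "coeff p a = 0" for a
        using c0 c2 c13 hi[of a] 3 by (cases "a = 0 \<or> a = 1 \<or> a = 2 \<or> a = 3 \<or> a = 4") auto
      then show ?thesis by (simp add: poly_eq_iff)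
    qed
  qed
  moreover have "0 \<in> sign_part w" using subspace_sign_part pv.subspace_0 by blast
  ultimately show ?thesis by blast
qed

text \<open>The dehomogenisation of \<open>(x y (x - y))\<^sup>2\<close>: a form in the sign part vanishes to odd order along
  each of the lines \<open>x = 0\<close>, \<open>y = 0\<close>, \<open>x = y\<close>, so it is divisible by this as soon as the order is
  not one.\<close>

definition disc :: "rat poly" where "disc = ([:0, 1:] * [:1, -1:]) ^ 2"

lemma tau_disc: "tau disc = disc"
  by (rule poly_eqI_except) (simp add: disc_def mult.commute)

lemma degree_disc: "degree disc = 4" and disc_nz: "disc \<noteq> 0"
  by (simp_all add: disc_def degree_power_eq degree_mult_eq power_eq_0_iff)

lemma flip_disc:
  assumes "degree q \<le> w"
  shows "flip (w + 6) (disc * q) = disc * flip w q"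
proof (rule poly_eqI_except)
  fix t :: rat assume t: "t \<noteq> 0" "t \<noteq> 1"
  have "degree (disc * q) \<le> w + 6"
    using assms degree_mult_le[of disc q] degree_disc by linarith
  then have "poly (flip (w + 6) (disc * q)) t = t ^ (w + 6) * (((1 / t) * (1 - 1 / t)) ^ 2 * poly q (1 / t))"
    using t by (simp add: poly_flip disc_def)
  also have "\<dots> = (t ^ 6 * ((1 / t) * (1 - 1 / t)) ^ 2) * (t ^ w * poly q (1 / t))"
    by (simp add: power_add)
  also have "t ^ 6 * ((1 / t) * (1 - 1 / t)) ^ 2 = (t ^ 3 * ((1 / t) * (1 - 1 / t))) ^ 2"
    by (simp only: power_mult_distrib) simp
  also have "t ^ 3 * ((1 / t) * (1 - 1 / t)) = t * (t - 1)"
    using t by (simp add: eval_nat_numeral right_diff_distrib)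
  also have "(t * (t - 1)) ^ 2 = (t * (1 - t)) ^ 2" by (simp add: power_mult_distrib power2_commute)
  also have "\<dots> = poly disc t" by (simp add: disc_def)
  also have "t ^ w * poly q (1 / t) = poly (flip w q) t" using t assms by (simp add: poly_flip)
  finally show "poly (flip (w + 6) (disc * q)) t = poly (disc * flip w q) t" by simp
qed

text \<open>Coprimality of the squares of \<open>x\<close> and \<open>y\<close>, made explicit by
  (x+y)^3 = x^2 (x+3y) + y^2 (y+3x).\<close>

lemma dvd_of_dvd_square_mult:
  fixes x y r :: "'a :: comm_ring_1"
  assumes "x + y = 1" "y ^ 2 dvd x ^ 2 * r"
  shows "y ^ 2 dvd r"
proof -
  have "r = (x + y) ^ 3 * r" using assms(1) by simp
  also have "\<dots> = (x ^ 2 * r) * (x + 3 * y) + y ^ 2 * ((y + 3 * x) * r)"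
    by (simp add: eval_nat_numeral algebra_simps)
  finally show ?thesis using assms(2) by (metis dvd_add dvd_mult2 dvd_triv_left)
qed

lemma disc_mult_sign_part:
  assumes "even w"
  shows "{p \<in> sign_part (w + 6). coeff p (w + 5) = 0} = (\<lambda>q. disc * q) ` sign_part w"
proof (intro equalityI subsetI)
  fix p assume "p \<in> {p \<in> sign_part (w + 6). coeff p (w + 5) = 0}"
  then have p: "p \<in> sign_part (w + 6)" and c5: "coeff p (w + 5) = 0" by auto
  have d: "degree p \<le> w + 6" and f: "flip (w + 6) p = - p" and t: "tau p = - p"
    using p by (auto simp: sign_part_def)
  show "p \<in> (\<lambda>q. disc * q) ` sign_part w"
  proof (cases "p = 0")
    case True
    then show ?thesis using pv.subspace_0[OF subspace_sign_part, of w] by (auto intro!: image_eqI[of _ _ 0])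
  next
    case False
    then have odd: "odd (degree p)" using odd_degree_tau_anti t by blast
    have "lead_coeff p \<noteq> 0" using False by simp
    then have "degree p \<noteq> w + 5" using c5 by metis
    moreover have "degree p \<noteq> w + 6" "degree p \<noteq> w + 4" using odd assms by auto
    \<comment> \<open>The degrees w+6 and w+4 fail by parity and w+5 by assumption, so the form
      vanishes to order at least three along y = 0. Next, \<open>flip\<close> carries multiplicity
      two to t = 0, and \<open>tau\<close> carries it on to t = 1.\<close>
    ultimately have deg: "degree p \<le> w + 3" using d by linarith
    have low: "coeff p k = 0" if "k < 2" for k
    proof -
      have "coeff (flip (w + 6) p) k = - coeff p k" using f by simp
      moreover have "coeff p (w + 6 - k) = 0" using deg that by (intro coeff_eq_0) linarith
      ultimately show ?thesis using that by (simp add: coeff_flip)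
    qed
    have "monom 1 2 dvd p" using low by (simp add: monom_1_dvd_iff')
    then have x: "[:0, 1:] ^ 2 dvd p" by (simp add: monom_altdef)
    then obtain r where r: "p = [:0, 1:] ^ 2 * r" by (elim dvdE)
    then have "tau p = tau ([:0, 1:] * [:0, 1:]) * tau r" by (simp only: tau_mult power2_eq_square)
    then have "tau p = [:1, -1:] ^ 2 * tau r"
      by (simp only: tau_mult power2_eq_square) (simp add: tau_def pcompose_pCons)
    then have y: "[:1, -1:] ^ 2 dvd p" using t by (metis dvd_minus_iff dvd_triv_left)
    have "[:1, -1:] ^ 2 dvd r"
    proof (rule dvd_of_dvd_square_mult)
      show "[:0, 1:] + [:1, -1:] = (1 :: rat poly)" by (simp add: one_pCons)
    qed (use y r in simp)
    then have "disc dvd p" unfolding disc_def power_mult_distrib r by (rule mult_dvd_mono[OF dvd_refl])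
    then obtain q where q: "p = disc * q" by (elim dvdE)
    have q0: "q \<noteq> 0" using False q by auto
    have dq: "degree q \<le> w"
      using deg degree_mult_eq[OF disc_nz q0] q degree_disc by simp
    have "disc * tau q = disc * (- q)" using t unfolding q tau_mult tau_disc by simp
    then have "tau q = - q" using disc_nz mult_cancel_left by blast
    moreover have "disc * flip w q = disc * (- q)" using f unfolding q flip_disc[OF dq] by simp
    then have "flip w q = - q" using disc_nz mult_cancel_left by blast
    ultimately show ?thesis using dq q by (auto simp: sign_part_def)
  qed
next
  fix p assume "p \<in> (\<lambda>q. disc * q) ` sign_part w"
  then obtain q where q: "q \<in> sign_part w" "p = disc * q" by blast
  have dq: "degree q \<le> w" using q by (simp add: sign_part_def)
  have d: "degree p \<le> w + 4"
    using dq degree_mult_le[of disc q] degree_disc unfolding q(2) by linarith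
  show "p \<in> {p \<in> sign_part (w + 6). coeff p (w + 5) = 0}"
    using q(1) d unfolding q(2)
    by (auto simp: sign_part_def tau_mult tau_disc flip_disc[OF dq] coeff_eq_0)
qed

text \<open>With \<open>p = x\<close>, \<open>q = - y\<close>, \<open>r = y - x\<close> the witness is \<open>(p-q)(q-r)(r-p) \<cdot> pqr \<cdot> (pq+qr+rp)\<^sup>h\<close> up to a
  scalar.\<close>

lemma sign_part_witness: "\<exists>p \<in> sign_part (2 * h + 6). coeff p (2 * h + 5) \<noteq> 0"
proof -
  define p :: "rat poly" where
    "p = [:0, 1:] * [:-1, 1:] * [:1, 1:] * [:-2, 1:] * [:-1, 2:] * [:1, -1, 1:] ^ h"
  have d: "degree p = 2 * h + 5"
    unfolding p_def by (subst degree_mult_eq; simp add: degree_power_eq)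
  have pe: "poly p t = t * (t - 1) * (1 + t) * (t - 2) * (2 * t - 1) * (1 - t + t ^ 2) ^ h" for t
  proof -
    have "poly [:1, -1, 1:] t = 1 - t + t ^ 2" by (simp add: power2_eq_square algebra_simps)
    moreover have "poly [:0, 1:] t = t" "poly [:-1, 1:] t = t - 1" "poly [:1, 1:] t = 1 + t"
      "poly [:-2, 1:] t = t - 2" "poly [:-1, 2:] t = 2 * t - 1" by simp_all
    ultimately show ?thesis by (simp only: p_def poly_mult poly_power)
  qed
  have "tau p = - p"
  proof (rule poly_eqI_except)
    fix t :: rat
    have "1 - (1 - t) + (1 - t) ^ 2 = 1 - t + t ^ 2" by (simp add: power2_eq_square algebra_simps)
    moreover have "(1 - t) * ((1 - t) - 1) * (1 + (1 - t)) * ((1 - t) - 2) * (2 * (1 - t) - 1)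
      = - (t * (t - 1) * (1 + t) * (t - 2) * (2 * t - 1))"
      by algebra
    ultimately show "poly (tau p) t = poly (- p) t" by (simp only: poly_tau pe poly_minus mult_minus_left)
  qed
  moreover have "flip (2 * h + 6) p = - p"
  proof (rule poly_eqI_except)
    fix t :: rat assume t: "t \<noteq> 0"
    define u where "u = 1 / t"
    have tu: "t * u = 1" using t by (simp add: u_def)
    have "poly (flip (2 * h + 6) p) t = t ^ (2 * h + 6) *
       (u * (u - 1) * (1 + u) * (u - 2) * (2 * u - 1) * (1 - u + u ^ 2) ^ h)"
      unfolding u_def pe[symmetric] using t d by (intro poly_flip) simp_all
    also have "\<dots> = t * (t * u) * (t * u - t) * (t + t * u) * (t * u - 2 * t) * (2 * (t * u) - t)
        * (t ^ 2 - t * (t * u) + (t * u) ^ 2) ^ h"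
    proof -
      have "t ^ 2 - t * (t * u) + (t * u) ^ 2 = t ^ 2 * (1 - u + u ^ 2)"
        by algebra
      moreover have "t ^ (2 * h + 6) = t * t * t * t * t * t * (t ^ 2) ^ h"
        unfolding power_add power_mult by (simp add: eval_nat_numeral)
      moreover have "t * (t * u) * (t * u - t) * (t + t * u) * (t * u - 2 * t) * (2 * (t * u) - t)
        = t * t * t * t * t * t * (u * (u - 1) * (1 + u) * (u - 2) * (2 * u - 1))"
        by algebra
      ultimately show ?thesis by (simp only: power_mult_distrib mult_ac)
    qed
    also have "\<dots> = - poly p t"
    proof -
      have "t * 1 * (1 - t) * (t + 1) * (1 - 2 * t) * (2 * 1 - t) = - (t * (t - 1) * (1 + t) * (t - 2) * (2 * t - 1))"
        by algebra
      moreover have "t ^ 2 - t * 1 + 1 ^ 2 = 1 - t + t ^ 2" by simp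
      ultimately show ?thesis unfolding tu pe by (simp only: mult_minus_left)
    qed
    finally show "poly (flip (2 * h + 6) p) t = poly (- p) t" by simp
  qed
  moreover have "coeff p (2 * h + 5) \<noteq> 0" using d by (metis degree_0 leading_coeff_0_iff add_is_0 zero_neq_numeral)
  ultimately show ?thesis using d by (intro bexI[of _ p]) (simp_all add: sign_part_def)
qed

lemma dim_sign_part_step: "pv.dim (sign_part (2 * h + 6)) = pv.dim (sign_part (2 * h)) + 1"
proof -
  let ?w = "2 * h"
  \<comment> \<open>The coefficient functional takes values in functions on \<open>unit\<close>, so
    that the rank-nullity statement into function spaces applies. Its kernel is \<open>disc\<close>
    times \<open>sign_part (2 * h)\<close>; the witness makes it onto.\<close>
  define f where "f p = (\<lambda>_ :: unit. coeff p (?w + 5))" for p :: "rat poly"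
  have lin: "Vector_Spaces.linear smult fscale f"
    by (intro Vector_Spaces.linear_iff[THEN iffD2] conjI allI pv.vector_space_axioms fv.vector_space_axioms)
      (auto simp: f_def fun_eq_iff)
  obtain B where B: "finite B" "{p. degree p \<le> ?w + 6} \<subseteq> pv.span B" using degree_le_finite_span by blast
  have sp: "sign_part (?w + 6) \<subseteq> pv.span B" "sign_part ?w \<subseteq> pv.span B"
    using B(2) by (auto simp: sign_part_def)
  have "pv.dim (sign_part (?w + 6)) = pv.dim {p \<in> sign_part (?w + 6). f p = 0} + fv.dim (f ` sign_part (?w + 6))"
    by (rule pv_fv.dim_kernel_image[OF lin subspace_sign_part B(1) sp(1)])
  moreover have "{p \<in> sign_part (?w + 6). f p = 0} = (\<lambda>q. disc * q) ` sign_part ?w"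
    using disc_mult_sign_part[of ?w] by (simp add: f_def fun_eq_iff)
  moreover have "pv.dim ((\<lambda>q. disc * q) ` sign_part ?w) = pv.dim (sign_part ?w)"
  proof (rule pv_pair.dim_image_inj_on[OF _ subspace_sign_part B(1) sp(2)])
    show "Vector_Spaces.linear smult smult (\<lambda>q. disc * q)"
      by (intro Vector_Spaces.linear_iff[THEN iffD2] conjI allI pv.vector_space_axioms) (auto simp: distrib_left)
  qed (use disc_nz in auto)
  moreover have "f ` sign_part (?w + 6) = supp_on UNIV"
  proof (intro equalityI subsetI)
    fix v :: "unit \<Rightarrow> rat"
    obtain p where p: "p \<in> sign_part (?w + 6)" "coeff p (?w + 5) \<noteq> 0" using sign_part_witness by blast
    have "smult (v () / coeff p (?w + 5)) p \<in> sign_part (?w + 6)"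
      using pv.subspace_scale[OF subspace_sign_part p(1)] .
    moreover have "f (smult (v () / coeff p (?w + 5)) p) = v" using p(2) by (simp add: f_def fun_eq_iff)
    ultimately show "v \<in> f ` sign_part (?w + 6)" by (metis image_eqI)
  qed (simp add: supp_on_def)
  ultimately show ?thesis using dim_supp_on[of "UNIV :: unit set"] by simp
qed

lemma dim_sign_part: "pv.dim (sign_part (2 * h)) = h div 3"
proof (induction h rule: less_induct)
  case (less h)
  show ?case
  proof (cases "h < 3")
    case True
    then show ?thesis using sign_part_small[of "2 * h"] pv.dim_zero_space by simp
  next
    case False
    define k where "k = h - 3"
    have k: "h = k + 3" using False by (simp add: k_def)
    have "2 * h = 2 * k + 6" using k by simp
    then show ?thesis using dim_sign_part_step[of k] less[of k] k by simp
  qed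
qed

text \<open>The subtraction does not truncate: \<open>dim_period_polys_add\<close> shows that h div
  3 is at most (h-1) div 2.\<close>

lemma dim_period_polys: "pv.dim (period_polys (2 * h)) = (h - 1) div 2 - h div 3"
proof -
  have "even (2 * h)" by simp
  from dim_period_polys_add[OF this] show ?thesis unfolding dim_even_anti dim_sign_part by linarith
qed

section \<open>The maps \<open>\<phi>\<^sup>(\<^sup>j\<^sup>)\<close> and the matrices \<open>E\<^sup>(\<^sup>j\<^sup>)\<close>\<close>

text \<open>The value on the monomial x^e of the polynomial whose restricted totally even part is
  taken in \<open>phi\<close>. Its coefficients are the entries of one row of E^(j).\<close>

definition phi_terms :: "nat \<Rightarrow> nat \<Rightarrow> nat list \<Rightarrow> mpoly" where
  "phi_terms r j e = mono e + (\<Sum>i0\<in>{r - j..<r - 1}.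
      (\<Prod>p<r. phisubst r j i0 (Suc i0 - (r - j)) p ^ (e ! p)) - (\<Prod>p<r. phisubst r j i0 (i0 - (r - j)) p ^ (e ! p)))"

lemma upoly_at_monom: "upoly_at (monom 1 k) L = L ^ k"
proof -
  have "upoly_at (monom 1 k) L = (\<Sum>i\<le>k. if i = k then L ^ i else 0)"
    unfolding upoly_at_def by (intro sum.cong) (auto simp: degree_monom_eq)
  then show ?thesis by simp
qed

text \<open>For an even exponent the sign in the Ihara action is 1 and f(x_i - x_{i+1}) = f(x_{i+1}
  - x_i), so its terms are exactly those of \<open>phi\<close> in full depth.\<close>

lemma ihara_monom:
  assumes "even k"
  shows "ihara (Suc (length a)) (monom 1 k) (mono a) = phi_terms (Suc (length a)) (Suc (length a)) (k # a)"
proof -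
  let ?n = "length a"
  have om: "omitted l (mono a) = (\<Prod>i<?n. var (omit l i) ^ (a ! i))" for l
    by (simp add: omitted_def psubst_mono)
  have pr: "(\<Prod>p<Suc ?n. phisubst (Suc ?n) (Suc ?n) i l p ^ ((k # a) ! p)) = (var (Suc i) - var i) ^ k * omitted l (mono a)" for i l
    by (subst prod.lessThan_Suc_shift) (simp add: phisubst_def om)
  have first: "var 0 ^ k * omitted 0 (mono a) = mono (k # a)"
    by (subst mono_eq_prod[of "k # a"]) (simp add: om omit_def prod.lessThan_Suc_shift del: prod.lessThan_Suc)
  have ev: "(var i - var (Suc i)) ^ k = (var (Suc i) - var i) ^ k" for i
    using assms by (metis minus_diff_eq power_minus_even)
  show ?thesis
    unfolding ihara_def phi_terms_def upoly_at_monom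
    using assms by (simp add: first pr ev degree_monom_eq atLeast0LessThan del: prod.lessThan_Suc)
qed

lemma shift_simps: "shift s (p + q) = shift s p + shift s q" "shift s (p - q) = shift s p - shift s q"
  "shift s (sum f A) = (\<Sum>x\<in>A. shift s (f x))" "shift s (prod f A) = (\<Prod>x\<in>A. shift s (f x))"
  "shift s (p ^ n) = shift s p ^ n" "shift s (var i) = var (i + s)"
  by (simp_all add: shift_def psubst_add psubst_diff psubst_sum psubst_prod psubst_power)

lemma mono_append: "mono (a @ b) = mono a * shift (length a) (mono b)"
  by (simp add: mono_def mult_single expo_append shift_single)

text \<open>The substitutions leave the first r-j variables alone and act on the others as in depth
  \<open>j\<close>, after a shift of the variables.\<close>

lemma phi_terms_block:
  assumes "1 \<le> j" "j \<le> r" "length e = r"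
  shows "phi_terms r j e = mono (take (r - j) e) * shift (r - j) (phi_terms j j (drop (r - j) e))"
proof -
  define s where "s = r - j"
  have r: "r = s + j" using assms s_def by simp
  have ph: "phisubst r j (i + s) l (p + s) = shift s (phisubst j j i l p)" for i l p
    by (auto simp: phisubst_def r shift_simps add.commute)
  have pr: "(\<Prod>p<r. phisubst r j (i + s) l p ^ (e ! p)) =
      mono (take s e) * shift s (\<Prod>p<j. phisubst j j i l p ^ (drop s e ! p))" for i l
  proof -
    have "(\<Prod>p<r. phisubst r j (i + s) l p ^ (e ! p)) =
       (\<Prod>p<s. phisubst r j (i + s) l p ^ (e ! p)) * (\<Prod>p<j. phisubst r j (i + s) l (p + s) ^ (e ! (p + s)))"
    proof -
      have "{..<r} = {..<s} \<union> (\<lambda>p. p + s) ` {..<j}"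
      proof (intro equalityI subsetI)
        fix x assume "x \<in> {..<r}"
        then show "x \<in> {..<s} \<union> (\<lambda>p. p + s) ` {..<j}"
          using r by (cases "x < s") (auto intro!: image_eqI[of _ _ "x - s"])
      qed (auto simp: r)
      moreover have "{..<s} \<inter> (\<lambda>p. p + s) ` {..<j} = {}" by auto
      ultimately show ?thesis by (simp add: prod.union_disjoint prod.reindex inj_on_def)
    qed
    also have "(\<Prod>p<s. phisubst r j (i + s) l p ^ (e ! p)) = mono (take s e)"
      using assms by (simp add: mono_eq_prod phisubst_def r min_def)
    also have "(\<Prod>p<j. phisubst r j (i + s) l (p + s) ^ (e ! (p + s))) = shift s (\<Prod>p<j. phisubst j j i l p ^ (drop s e ! p))"
      unfolding shift_simps ph using assms(3) r by (intro prod.cong refl) (simp add: add.commute)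
    finally show ?thesis .
  qed
  have "(\<Sum>i0\<in>{s..<r - 1}. (\<Prod>p<r. phisubst r j i0 (Suc i0 - s) p ^ (e ! p)) - (\<Prod>p<r. phisubst r j i0 (i0 - s) p ^ (e ! p)))
      = (\<Sum>i\<in>{0..<j - 1}. (\<Prod>p<r. phisubst r j (i + s) (Suc i) p ^ (e ! p)) - (\<Prod>p<r. phisubst r j (i + s) i p ^ (e ! p)))"
    using r assms(1)
    by (intro sum.reindex_bij_witness[where i = "\<lambda>i. i + s" and j = "\<lambda>i. i - s"]) (auto simp: Suc_diff_le)
  also have "\<dots> = mono (take s e) * shift s (\<Sum>i\<in>{0..<j - 1}.
      (\<Prod>p<j. phisubst j j i (Suc i) p ^ (drop s e ! p)) - (\<Prod>p<j. phisubst j j i i p ^ (drop s e ! p)))"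
    unfolding pr shift_simps(3) sum_distrib_left by (intro sum.cong refl) (simp only: shift_simps(2) right_diff_distrib)
  finally have "phi_terms r j e = mono e + \<dots>" by (simp add: phi_terms_def s_def[symmetric])
  moreover have "mono e = mono (take s e) * shift s (mono (drop s e))"
    using mono_append[of "take s e" "drop s e"] assms(3) r by simp
  ultimately show ?thesis
    unfolding s_def[symmetric] phi_terms_def[of j j] by (simp add: shift_simps distrib_left)
qed

text \<open>The block factorisation produces the delta, and \<open>ihara_monom\<close> applies to
  the last \<open>j\<close> entries because they are odd, which makes the exponent of the acting
  monomial even.\<close>

lemma Ej_eq_lookup:
  assumes "1 \<le> j" "j \<le> r" "m \<in> S N r" "n \<in> S N r"
  shows "Ej N r j m n = lookup (phi_terms r j (dec m)) (expo (dec n))"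
proof -
  define s where "s = r - j"
  have len: "length m = r" "length n = r" using assms S_D(1) by auto
  have "drop s m \<noteq> []" using len assms s_def by simp
  then obtain a b where ab: "drop s m = a # b" by (cases "drop s m") auto
  have lb: "Suc (length b) = j" using ab len assms s_def by (metis diff_diff_cancel length_Cons length_drop)
  have "a = m ! s" using ab len assms s_def by (metis hd_drop_conv_nth list.sel(1) diff_less less_le_trans zero_less_one le_neq_implies_less nat_less_le length_drop length_Cons zero_less_Suc zero_less_diff)
  then have "odd a" using S_D(3)[OF assms(3), of s] assms s_def by simp
  have ds: "dec (drop s m) = drop s (dec m)" "dec (take s m) = take s (dec m)"
    "dec (drop s n) = drop s (dec n)" "dec (take s n) = take s (dec n)"
    by (auto simp: dec_def drop_map take_map)
  have "ecoef (drop s m) (drop s n) = lookup (phi_terms j j (dec (drop s m))) (expo (dec (drop s n)))"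
    using ihara_monom[of "a - 1" "dec b"] \<open>odd a\<close> lb by (simp add: ecoef_def ab dec_def)
  moreover have "lookup (phi_terms r j (dec m)) (expo (dec n)) =
      (if take s (dec m) = take s (dec n) then lookup (phi_terms j j (drop s (dec m))) (expo (drop s (dec n))) else 0)"
    using phi_terms_block[of j r "dec m"] assms len s_def
      lookup_mono_mult_shift[of "take s (dec m)" "take s (dec n)" _ "drop s (dec n)"] by simp
  moreover have "take s (dec m) = take s (dec n) \<longleftrightarrow> take s m = take s n"
  proof
    assume t: "take s (dec m) = take s (dec n)"
    have "m ! i = n ! i" if "i < s" for i
    proof -
      have "dec m ! i = dec n ! i" using t that by (metis nth_take)
      moreover have "i < r" using that s_def by simp
      ultimately show ?thesis using S_D(3)[OF assms(3), of i] S_D(3)[OF assms(4), of i] len by simp linarith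
    qed
    then show "take s m = take s n" using len s_def by (intro nth_equalityI) auto
  next
    assume "take s m = take s n"
    then show "take s (dec m) = take s (dec n)" using ds by metis
  qed
  ultimately show ?thesis unfolding Ej_def s_def[symmetric] ds by simp
qed

lemma phi_eq_rtep:
  assumes "P \<in> V N r"
  shows "phi N r j P = rtep r (\<Sum>m\<in>S N r. const (piV N r P m) * phi_terms r j (dec m))"
proof -
  let ?c = "\<lambda>m. const (piV N r P m)"
  have "(\<Sum>m\<in>S N r. ?c m * phi_terms r j (dec m)) = P + (\<Sum>i0\<in>{r - j..<r - 1}.
       psubst (phisubst r j i0 (Suc i0 - (r - j))) P - psubst (phisubst r j i0 (i0 - (r - j))) P)"
    unfolding psubst_V[OF assms] phi_terms_def distrib_left sum.distrib sum_distrib_left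
    unfolding V_expand[OF assms, symmetric] sum_subtractf[symmetric] right_diff_distrib[symmetric]
    by (subst sum.swap) (rule refl)
  then show ?thesis by (simp add: phi_def)
qed

lemma homog_phisubst: "Suc i0 < r \<Longrightarrow> p < r \<Longrightarrow> phisubst r j i0 l p \<in> homog r 1"
  using homog_var[of _ r] by (auto simp: phisubst_def omit_def intro!: homog_diff)

lemma homog_phi_terms:
  assumes "m \<in> S N r"
  shows "phi_terms r j (dec m) \<in> homog r (N - r)"
proof -
  have sum: "(\<Sum>p<r. 1 * (dec m ! p)) = N - r"
  proof -
    have "(\<Sum>p<r. 1 * (dec m ! p)) = (\<Sum>p<r. lookup (expo (dec m)) p)"
      using S_D(1)[OF assms] by (intro sum.cong) (auto simp: lookup_expo)
    then show ?thesis using sum_expo_dec[OF assms] by simp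
  qed
  have pr: "(\<Prod>p<r. phisubst r j i0 l p ^ (dec m ! p)) \<in> homog r (N - r)" if "Suc i0 < r" for i0 l
    unfolding sum[symmetric] using that by (intro homog_prod homog_power homog_phisubst) auto
  have "mono (dec m) \<in> homog r (N - r)"
    unfolding sum[symmetric] mono_eq_prod length_dec S_D(1)[OF assms]
    by (intro homog_prod homog_power homog_var) auto
  then show ?thesis unfolding phi_terms_def
    using pr by (intro homog_add homog_sum homog_diff) auto
qed

lemma rtep_homog_V:
  assumes "X \<in> homog r (N - r)" "r \<le> N"
  shows "rtep r X \<in> V N r"
proof -
  have "m \<in> (\<lambda>n. expo (dec n)) ` S N r" if m: "m \<in> keys (rtep r X)" for m
  proof -
    have ev: "even (lookup m i) \<and> 2 \<le> lookup m i" if "i < r" for i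
      using m that by (auto simp: in_keys_iff lookup_rtep split: if_splits)
    have "m \<in> keys X" using m by (auto simp: in_keys_iff lookup_rtep split: if_splits)
    then have k: "keys m \<subseteq> {..<r}" "(\<Sum>i<r. lookup m i) = N - r" using assms(1) by (auto simp: homog_def)
    define n where "n = map (\<lambda>i. lookup m i + 1) [0..<r]"
    have "sum_list n = (\<Sum>i<r. lookup m i + 1)"
      by (simp add: n_def sum_list_sum_nth atLeast0LessThan)
    also have "\<dots> = N" unfolding sum.distrib k(2) using assms(2) by simp
    finally have "n \<in> S N r" using ev by (fastforce simp: S_def n_def)
    moreover have "m = expo (dec n)"
    proof (rule poly_mapping_eqI)
      fix i show "lookup m i = lookup (expo (dec n)) i"
        using k(1) by (cases "i < r") (auto simp: lookup_expo n_def dec_def in_keys_iff)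
    qed
    ultimately show ?thesis by blast
  qed
  then show ?thesis by (auto simp: V_def)
qed

lemma S_ge: "n \<in> S N r \<Longrightarrow> r \<le> N"
  using sum_expo_dec by fastforce

lemma phi_V:
  assumes "P \<in> V N r"
  shows "phi N r j P \<in> V N r"
\<comment> \<open>Natural subtraction makes N - r the true degree only for r <= N, which an element
  of \<open>S N r\<close> guarantees. With no element, the sum defining the image is empty.\<close>
proof (cases "S N r = {}")
  case True
  then show ?thesis using assms by (simp add: phi_eq_rtep rtep_def V_def)
next
  case False
  then have "r \<le> N" using S_ge by blast
  then show ?thesis unfolding phi_eq_rtep[OF assms]
    by (intro rtep_homog_V homog_sum homog_const_mult homog_phi_terms)
qed

lemma piV_phi:
  assumes "P \<in> V N r" "1 \<le> j" "j \<le> r"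
  shows "piV N r (phi N r j P) = rowmul (S N r) (piV N r P) (Ej N r j)"
proof
  fix n
  show "piV N r (phi N r j P) n = rowmul (S N r) (piV N r P) (Ej N r j) n"
  proof (cases "n \<in> S N r")
    case True
    have "piV N r (phi N r j P) n =
        lookup (\<Sum>m\<in>S N r. const (piV N r P m) * phi_terms r j (dec m)) (expo (dec n))"
      using True lookup_expo_dec_even[OF True] by (simp add: piV_def phi_eq_rtep[OF assms(1)] lookup_rtep)
    also have "\<dots> = (\<Sum>m\<in>S N r. piV N r P m * Ej N r j m n)"
      unfolding lookup_sum lookup_const_mult using assms True by (intro sum.cong refl) (simp add: Ej_eq_lookup)
    finally show ?thesis using True by (simp add: rowmul_def)
  next
    case False then show ?thesis by (simp add: piV_def rowmul_def)
  qed
qed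

section \<open>The spaces \<open>W\<close> as tensor products\<close>

text \<open>The possible heads or tails of an index tuple of total \<open>N\<close>: any weight up
  to \<open>N\<close> occurs, the complementary block carrying the rest.\<close>

definition odd_tuples :: "nat \<Rightarrow> nat \<Rightarrow> nat list set" where
  "odd_tuples N k = (\<Union>b\<le>N. S b k)"

lemma odd_tuples_iff: "t \<in> odd_tuples N k \<longleftrightarrow> sum_list t \<le> N \<and> t \<in> S (sum_list t) k"
  by (auto simp: odd_tuples_def S_def)

lemma finite_odd_tuples: "finite (odd_tuples N k)"
  by (auto simp: odd_tuples_def finite_S)

lemma append_in_S_iff:
  assumes "length p = s"
  shows "p @ t \<in> S N (s + k) \<longleftrightarrow> t \<in> odd_tuples N k \<and> p \<in> S (N - sum_list t) s"
proof -
  have "sum_list p + sum_list t = N \<longleftrightarrow> sum_list t \<le> N \<and> sum_list p = N - sum_list t" by linarith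
  then show ?thesis unfolding odd_tuples_iff S_def using assms by (simp add: ball_Un) blast
qed

lemma append_in_S_iff':
  assumes "length p = s"
  shows "p @ t \<in> S N (s + k) \<longleftrightarrow> p \<in> odd_tuples N s \<and> t \<in> S (N - sum_list p) k"
proof -
  have "sum_list p + sum_list t = N \<longleftrightarrow> sum_list p \<le> N \<and> sum_list t = N - sum_list p" by linarith
  then show ?thesis unfolding odd_tuples_iff S_def using assms by (simp add: ball_Un) blast
qed

lemma sum_S_split:
  "(\<Sum>n\<in>S N (s + k). f n) = (\<Sum>t\<in>odd_tuples N k. \<Sum>p\<in>S (N - sum_list t) s. f (p @ t))"
proof -
  have "(\<Sum>t\<in>odd_tuples N k. \<Sum>p\<in>S (N - sum_list t) s. f (p @ t)) =
      (\<Sum>(t, p)\<in>(SIGMA t:odd_tuples N k. S (N - sum_list t) s). f (p @ t))"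
    by (rule sum.Sigma) (auto simp: finite_S finite_odd_tuples)
  also have "\<dots> = (\<Sum>n\<in>S N (s + k). f n)"
  proof (rule sum.reindex_bij_witness[where i = "\<lambda>n. (drop s n, take s n)" and j = "\<lambda>(t, p). p @ t"])
    fix n assume n: "n \<in> S N (s + k)"
    have "take s n @ drop s n \<in> S N (s + k)" "length (take s n) = s" using n S_D(1)[OF n] by auto
    then show "(drop s n, take s n) \<in> (SIGMA t:odd_tuples N k. S (N - sum_list t) s)"
      using append_in_S_iff by blast
  next
    fix tp assume "tp \<in> (SIGMA t:odd_tuples N k. S (N - sum_list t) s)"
    then obtain t p where tp: "tp = (t, p)" "t \<in> odd_tuples N k" "p \<in> S (N - sum_list t) s" by auto
    then have l: "length p = s" using S_D(1) by blast
    then show "(case tp of (t, p) \<Rightarrow> p @ t) \<in> S N (s + k)" using tp append_in_S_iff[OF l] by simp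
    show "(drop s (case tp of (t, p) \<Rightarrow> p @ t), take s (case tp of (t, p) \<Rightarrow> p @ t)) = tp" using tp l by simp
  qed auto
  finally show ?thesis by simp
qed

definition vec_upoly :: "nat \<Rightarrow> (nat list \<Rightarrow> rat) \<Rightarrow> rat poly" where
  "vec_upoly N u = (\<Sum>p\<in>S N 2. monom (u p) (p ! 0 - 1))"

text \<open>In these coordinates the index is the exponent of x_1 and N - 2 - a that of x_2. The
  inequalities keep all truncated subtractions exact.\<close>

lemma S2_iff: "p \<in> S N 2 \<longleftrightarrow> (\<exists>a. p = [a + 1, N - 1 - a] \<and> even a \<and> 2 \<le> a \<and> a + 2 \<le> N \<and> even (N - 2 - a) \<and> 2 \<le> N - 2 - a)"
proof
  assume p: "p \<in> S N 2"
  then obtain x y where xy: "p = [x, y]" by (auto simp: S_def length_Suc_conv numeral_2_eq_2)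
  then have c: "x + y = N" "odd x" "3 \<le> x" "odd y" "3 \<le> y" using p by (auto simp: S_def)
  show "\<exists>a. p = [a + 1, N - 1 - a] \<and> even a \<and> 2 \<le> a \<and> a + 2 \<le> N \<and> even (N - 2 - a) \<and> 2 \<le> N - 2 - a"
    using c xy by (intro exI[of _ "x - 1"]) auto
next
  assume "\<exists>a. p = [a + 1, N - 1 - a] \<and> even a \<and> 2 \<le> a \<and> a + 2 \<le> N \<and> even (N - 2 - a) \<and> 2 \<le> N - 2 - a"
  then obtain a where a: "p = [a + 1, N - 1 - a]" "even a" "2 \<le> a" "a + 2 \<le> N" "even (N - 2 - a)" "2 \<le> N - 2 - a"
    by blast
  have "N - 1 - a = Suc (N - 2 - a)" using a by simp
  then show "p \<in> S N 2" using a by (auto simp: S_def)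
qed

lemma coeff_vec_upoly:
  "coeff (vec_upoly N u) a = (if [a + 1, N - 1 - a] \<in> S N 2 then u [a + 1, N - 1 - a] else 0)"
proof -
  have "coeff (vec_upoly N u) a = (\<Sum>p\<in>S N 2. if p ! 0 - 1 = a then u p else 0)"
    by (simp add: vec_upoly_def coeff_sum)
  also have "\<dots> = (\<Sum>p\<in>S N 2. if p = [a + 1, N - 1 - a] then u p else 0)"
    by (intro sum.cong refl if_cong) (auto simp: S2_iff)
  finally show ?thesis using finite_S by simp
qed

lemma vec_upoly_props:
  "degree (vec_upoly N u) \<le> N - 2" "even_poly (vec_upoly N u)"
  "coeff (vec_upoly N u) 0 = 0" "coeff (vec_upoly N u) (N - 2) = 0"
proof -
  have z: "coeff (vec_upoly N u) a = 0" if "odd a \<or> a < 2 \<or> N < a + 4" for a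
  proof -
    have "[a + 1, N - 1 - a] \<notin> S N 2" using that by (auto simp: S_def)
    then show ?thesis by (simp only: coeff_vec_upoly if_False)
  qed
  show "degree (vec_upoly N u) \<le> N - 2" by (rule degree_le) (auto intro!: z)
  show "even_poly (vec_upoly N u)" unfolding even_poly_def using z by blast
  show "coeff (vec_upoly N u) 0 = 0" "coeff (vec_upoly N u) (N - 2) = 0" by (rule z; linarith)+
qed

definition W2 :: "nat \<Rightarrow> (nat list \<Rightarrow> rat) set" where
  "W2 N = {u \<in> supp_on (S N 2). vec_upoly N u \<in> period_polys (N - 2)}"

text \<open>Undoes the dehomogenisation: the binary form of degree \<open>w\<close> attached to
  \<open>q\<close>, evaluated at a pair of polynomials.\<close>

definition hom_eval :: "nat \<Rightarrow> mpoly \<Rightarrow> mpoly \<Rightarrow> rat poly \<Rightarrow> mpoly" where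
  "hom_eval w x y q = (\<Sum>a\<le>w. const (coeff q a) * x ^ a * y ^ (w - a))"

lemma hom_eval_flip: "hom_eval w x y (flip w q) = hom_eval w y x q"
  unfolding hom_eval_def
  by (rule sum.reindex_bij_witness[where i = "\<lambda>a. w - a" and j = "\<lambda>a. w - a"])
    (auto simp: coeff_flip mult_ac)

lemma hom_eval_tau_monom:
  assumes "a \<le> w"
  shows "hom_eval w x y (tau (monom c a)) = const c * (y - x) ^ a * y ^ (w - a)"
proof -
  have "tau (monom c a) = smult c ([:1, -1:] ^ a)"
    by (rule poly_eqI_except) (simp add: poly_monom)
  have co: "coeff (tau (monom c a)) j = c * (of_nat (a choose j) * (-1) ^ j)" for j
  proof (cases "j \<le> a")
    case False
    then have "degree ([:1, -1:] ^ a :: rat poly) < j" by (simp add: degree_power_eq)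
    then show ?thesis using False \<open>tau (monom c a) = _\<close> by (simp add: coeff_eq_0 binomial_eq_0)
  qed (simp add: coeff_linear_poly_power \<open>tau (monom c a) = _\<close>)
  have c1: "const (of_nat n) = of_nat n" "const ((-1) ^ n) = (-1) ^ n" for n
    by (induction n) (auto simp: const_add const_mult const_uminus)
  have "hom_eval w x y (tau (monom c a)) = (\<Sum>j\<le>a. const (c * (of_nat (a choose j) * (-1) ^ j)) * x ^ j * y ^ (w - j))"
    unfolding hom_eval_def co using assms by (intro sum.mono_neutral_right) (auto simp: binomial_eq_0)
  also have "\<dots> = (\<Sum>j\<le>a. const c * y ^ (w - a) * (of_nat (a choose j) * (- x) ^ j * y ^ (a - j)))"
  proof (intro sum.cong refl)
    fix j assume "j \<in> {..a}"
    then have e: "y ^ (w - j) = y ^ (w - a) * y ^ (a - j)" using assms by (simp add: power_add[symmetric])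
    have "(- x) ^ j = (-1) ^ j * x ^ j" by (rule power_minus)
    then show "const (c * (of_nat (a choose j) * (-1) ^ j)) * x ^ j * y ^ (w - j) =
        const c * y ^ (w - a) * (of_nat (a choose j) * (- x) ^ j * y ^ (a - j))"
      unfolding e const_mult c1 by (simp only: mult_ac)
  qed
  also have "\<dots> = const c * y ^ (w - a) * (- x + y) ^ a"
    unfolding sum_distrib_left[symmetric] binomial_ring ..
  finally show ?thesis by (simp add: mult_ac)
qed

lemma hom_eval_add: "hom_eval w x y (p + q) = hom_eval w x y p + hom_eval w x y q"
  by (simp add: hom_eval_def const_add distrib_right sum.distrib)

lemma hom_eval_uminus: "hom_eval w x y (- p) = - hom_eval w x y p"
  by (simp add: hom_eval_def const_uminus sum_negf)

lemma hom_eval_diff: "hom_eval w x y (p - q) = hom_eval w x y p - hom_eval w x y q"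
  using hom_eval_add[of w x y p "- q"] by (simp add: hom_eval_uminus)

lemma hom_eval_sum: "hom_eval w x y (sum f A) = (\<Sum>a\<in>A. hom_eval w x y (f a))"
  by (induction A rule: infinite_finite_induct) (auto simp: hom_eval_add, auto simp: hom_eval_def)

lemma hom_eval_tau:
  assumes "degree q \<le> w"
  shows "hom_eval w x y (tau q) = hom_eval w (y - x) y q"
proof -
  have tau_sum: "tau (sum f A) = (\<Sum>a\<in>A. tau (f a))" for f :: "nat \<Rightarrow> rat poly" and A
    by (induction A rule: infinite_finite_induct) (auto simp: tau_add tau_0)
  have "hom_eval w x y (tau q) = hom_eval w x y (tau (\<Sum>a\<le>w. monom (coeff q a) a))"
    using poly_as_sum_of_monoms'[OF assms] by simp
  also have "\<dots> = (\<Sum>a\<le>w. const (coeff q a) * (y - x) ^ a * y ^ (w - a))"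
    unfolding tau_sum hom_eval_sum by (intro sum.cong refl) (simp add: hom_eval_tau_monom)
  finally show ?thesis by (simp add: hom_eval_def)
qed

lemma hom_eval_even:
  assumes "even_poly q"
  shows "hom_eval w (- x) y q = hom_eval w x y q"
  unfolding hom_eval_def
proof (intro sum.cong refl)
  fix a
  show "const (coeff q a) * (- x) ^ a * y ^ (w - a) = const (coeff q a) * x ^ a * y ^ (w - a)"
    using assms by (cases "even a") (auto simp: even_poly_def)
qed

lemma hom_eval_flip_tau:
  assumes "degree q \<le> w" "even_poly q"
  shows "hom_eval w x y (flip w (tau q)) = hom_eval w (y - x) x q"
proof -
  have "hom_eval w x y (flip w (tau q)) = hom_eval w (x - y) x q"
    using assms by (simp add: hom_eval_flip hom_eval_tau)
  also have "\<dots> = hom_eval w (y - x) x q" using hom_eval_even[OF assms(2), of w "x - y" x] by simp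
  finally show ?thesis by simp
qed

text \<open>A slice fixes the tail \<open>t\<close> and varies the first two entries, where the
  relation defining W lives. The later \<open>strip\<close> fixes the head and varies the tail,
  where the matrices act.\<close>

abbreviation (input) slice :: "nat \<Rightarrow> nat list \<Rightarrow> (nat list \<Rightarrow> rat) \<Rightarrow> (nat list \<Rightarrow> rat)" where
  "slice N t v \<equiv> pull (\<lambda>p. p @ t) (S (N - sum_list t) 2) v"

lemma psubst_slices:
  assumes "P \<in> V N (2 + k)" "\<And>i. \<sigma> (i + 2) = var (i + 2)"
  shows "psubst \<sigma> P = (\<Sum>t\<in>odd_tuples N k.
      hom_eval (N - sum_list t - 2) (\<sigma> 0) (\<sigma> 1) (vec_upoly (N - sum_list t) (slice N t (piV N (2 + k) P)))
      * shift 2 (mono (dec t)))"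
proof -
  let ?v = "piV N (2 + k) P"
  have "psubst \<sigma> P = (\<Sum>t\<in>odd_tuples N k. \<Sum>p\<in>S (N - sum_list t) 2.
      const (?v (p @ t)) * (\<Prod>i<2 + k. \<sigma> i ^ (dec (p @ t) ! i)))"
    unfolding psubst_V[OF assms(1)] by (rule sum_S_split)
  also have "\<dots> = (\<Sum>t\<in>odd_tuples N k.
      hom_eval (N - sum_list t - 2) (\<sigma> 0) (\<sigma> 1) (vec_upoly (N - sum_list t) (slice N t ?v)) * shift 2 (mono (dec t)))"
  proof (intro sum.cong refl)
    fix t assume t: "t \<in> odd_tuples N k"
    define M where "M = N - sum_list t"
    have lt: "length t = k" using t by (auto simp: odd_tuples_iff S_def)
    have sh: "shift 2 (mono (dec t)) = (\<Prod>i<k. var (i + 2) ^ (dec t ! i))"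
      by (simp add: mono_eq_prod shift_simps lt)
    have pr: "(\<Prod>i<2 + k. \<sigma> i ^ (dec (p @ t) ! i)) = \<sigma> 0 ^ (p ! 0 - 1) * \<sigma> 1 ^ (M - 2 - (p ! 0 - 1)) * shift 2 (mono (dec t))"
      if p: "p \<in> S M 2" for p
    proof -
      obtain a where a: "p = [a + 1, M - 1 - a]" using p by (auto simp: S2_iff)
      have "(\<Prod>i<2 + k. \<sigma> i ^ (dec (p @ t) ! i)) = (\<Prod>i<Suc (Suc k). \<sigma> i ^ (dec (p @ t) ! i))" by simp
      also have "\<dots> = \<sigma> 0 ^ a * \<sigma> 1 ^ (M - 2 - a) * (\<Prod>i<k. \<sigma> (Suc (Suc i)) ^ (dec t ! i))"
        unfolding prod.lessThan_Suc_shift by (simp add: a dec_def mult_ac numeral_2_eq_2)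
      also have "(\<Prod>i<k. \<sigma> (Suc (Suc i)) ^ (dec t ! i)) = shift 2 (mono (dec t))"
        unfolding sh using assms(2) by simp
      finally show ?thesis by (simp add: a)
    qed
    have "hom_eval (M - 2) (\<sigma> 0) (\<sigma> 1) (vec_upoly M (slice N t ?v)) =
        (\<Sum>p\<in>S M 2. const (?v (p @ t)) * \<sigma> 0 ^ (p ! 0 - 1) * \<sigma> 1 ^ (M - 2 - (p ! 0 - 1)))"
      unfolding vec_upoly_def hom_eval_sum
    proof (intro sum.cong refl)
      fix p assume p: "p \<in> S M 2"
      then have le: "p ! 0 - 1 \<le> M - 2" by (auto simp: S2_iff)
      have "hom_eval (M - 2) (\<sigma> 0) (\<sigma> 1) (monom c b) = (\<Sum>a\<le>M - 2. if a = b then const c * \<sigma> 0 ^ b * \<sigma> 1 ^ (M - 2 - b) else 0)" for c b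
        unfolding hom_eval_def by (intro sum.cong) auto
      then show "hom_eval (M - 2) (\<sigma> 0) (\<sigma> 1) (monom (slice N t ?v p) (p ! 0 - 1)) =
          const (?v (p @ t)) * \<sigma> 0 ^ (p ! 0 - 1) * \<sigma> 1 ^ (M - 2 - (p ! 0 - 1))"
        using le p by (simp add: pull_def M_def)
    qed
    then show "(\<Sum>p\<in>S (N - sum_list t) 2. const (?v (p @ t)) * (\<Prod>i<2 + k. \<sigma> i ^ (dec (p @ t) ! i))) =
        hom_eval (N - sum_list t - 2) (\<sigma> 0) (\<sigma> 1) (vec_upoly (N - sum_list t) (slice N t ?v)) * shift 2 (mono (dec t))"
      unfolding M_def[symmetric]
      by (simp only: sum_distrib_right) (intro sum.cong refl, simp only: pr mult.assoc)
  qed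
  finally show ?thesis .
qed

lemma hom_eval_var: "hom_eval w (var 0) (var 1) q = (\<Sum>a\<le>w. const (coeff q a) * mono [a, w - a])"
  unfolding hom_eval_def mono_eq_prod by (intro sum.cong refl) (simp add: numeral_2_eq_2 mult_ac)

text \<open>Different tails contribute disjoint sets of monomials, so no cancellation between them
  is possible.\<close>

lemma sum_hom_eval_eq_0_iff:
  "(\<Sum>t\<in>odd_tuples N k. hom_eval (N - sum_list t - 2) (var 0) (var 1) (q t) * shift 2 (mono (dec t))) = 0
    \<longleftrightarrow> (\<forall>t\<in>odd_tuples N k. \<forall>a\<le>N - sum_list t - 2. coeff (q t) a = 0)" (is "?X = 0 \<longleftrightarrow> ?R")
proof
  assume X: "?X = 0"
  show ?R
  proof (intro ballI allI impI)
    fix s a assume s: "s \<in> odd_tuples N k" and a: "a \<le> N - sum_list s - 2"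
    let ?w = "\<lambda>t. N - sum_list t - 2"
    have "0 = lookup ?X (expo ([a, ?w s - a] @ dec s))" using X by simp
    also have "\<dots> = (\<Sum>t\<in>odd_tuples N k. \<Sum>b\<le>?w t. if t = s \<and> b = a then coeff (q t) b else 0)"
      unfolding lookup_sum
    proof (intro sum.cong refl)
      fix t assume t: "t \<in> odd_tuples N k"
      have dt: "dec t = dec s \<longleftrightarrow> t = s"
        using expo_dec_inj[of t "sum_list t" k s "sum_list s"] s t expo_inj[of "dec t" "dec s"]
        by (auto simp: odd_tuples_iff S_def)
      have "lookup (hom_eval (?w t) (var 0) (var 1) (q t) * shift 2 (mono (dec t))) (expo ([a, ?w s - a] @ dec s))
        = (\<Sum>b\<le>?w t. coeff (q t) b * lookup (mono ([b, ?w t - b] @ dec t)) (expo ([a, ?w s - a] @ dec s)))"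
        unfolding hom_eval_var sum_distrib_right lookup_sum mult.assoc lookup_const_mult
        by (subst mono_append) (simp add: numeral_2_eq_2)
      also have "\<dots> = (\<Sum>b\<le>?w t. if t = s \<and> b = a then coeff (q t) b else 0)"
      proof (intro sum.cong refl)
        fix b
        have "length t = length s" using s t by (auto simp: odd_tuples_iff S_def)
        then have "expo ([b, ?w t - b] @ dec t) = expo ([a, ?w s - a] @ dec s) \<longleftrightarrow> t = s \<and> b = a"
          using dt expo_inj[of "[b, ?w t - b] @ dec t" "[a, ?w s - a] @ dec s"] by auto
        then show "coeff (q t) b * lookup (mono ([b, ?w t - b] @ dec t)) (expo ([a, ?w s - a] @ dec s)) =
            (if t = s \<and> b = a then coeff (q t) b else 0)"
          by (simp add: mono_def lookup_single when_def)
      qed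
      finally show "lookup (hom_eval (?w t) (var 0) (var 1) (q t) * shift 2 (mono (dec t))) (expo ([a, ?w s - a] @ dec s))
        = (\<Sum>b\<le>?w t. if t = s \<and> b = a then coeff (q t) b else 0)" .
    qed
    also have "\<dots> = (\<Sum>t\<in>odd_tuples N k. if t = s then coeff (q t) a else 0)"
      using a by (intro sum.cong refl) auto
    also have "\<dots> = coeff (q s) a" using s finite_odd_tuples by simp
    finally show "coeff (q s) a = 0" by simp
  qed
next
  assume ?R
  then have "hom_eval (N - sum_list t - 2) (var 0) (var 1) (q t) = 0" if "t \<in> odd_tuples N k" for t
    using that by (simp add: hom_eval_def)
  then show "?X = 0" by simp
qed

text \<open>The defining relation changes only x_1 and x_2, so it can be tested on the coefficient
  of each monomial in the other variables. There it is the depth-two relation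
  \<open>norm_sum\<close> = 0.\<close>

lemma W_iff_slices:
  assumes P: "P \<in> V N (2 + k)"
  shows "P \<in> W N (2 + k) \<longleftrightarrow> (\<forall>t\<in>odd_tuples N k. slice N t (piV N (2 + k) P) \<in> W2 (N - sum_list t))"
proof -
  let ?w = "\<lambda>t. N - sum_list t - 2"
  let ?q = "\<lambda>t. vec_upoly (N - sum_list t) (slice N t (piV N (2 + k) P))"
  let ?A = "\<lambda>i. if i = 0 then var 1 - var 0 else if i = 1 then var 1 else var i"
  let ?B = "\<lambda>i. if i = 0 then var 1 - var 0 else if i = 1 then var 0 else var i"
  have a: "psubst ?A P = (\<Sum>t\<in>odd_tuples N k. hom_eval (?w t) (var 0) (var 1) (tau (?q t)) * shift 2 (mono (dec t)))"
    unfolding hom_eval_tau[OF vec_upoly_props(1)]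
    by (subst psubst_slices[OF P]) simp_all
  have b: "psubst ?B P = (\<Sum>t\<in>odd_tuples N k. hom_eval (?w t) (var 0) (var 1) (flip (?w t) (tau (?q t))) * shift 2 (mono (dec t)))"
    unfolding hom_eval_flip_tau[OF vec_upoly_props(1,2)]
    by (subst psubst_slices[OF P]) simp_all
  have c: "P = (\<Sum>t\<in>odd_tuples N k. hom_eval (?w t) (var 0) (var 1) (?q t) * shift 2 (mono (dec t)))"
    using psubst_slices[OF P, of var] by simp
  have "P \<in> W N (2 + k) \<longleftrightarrow> P - psubst ?A P + psubst ?B P = 0"
    using P by (auto simp: W_def algebra_simps)
  also have "P - psubst ?A P + psubst ?B P =
      (\<Sum>t\<in>odd_tuples N k. hom_eval (?w t) (var 0) (var 1) (norm_sum (?w t) (?q t)) * shift 2 (mono (dec t)))"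
    unfolding a b by (subst c) (simp add: norm_sum_def hom_eval_add hom_eval_diff distrib_right left_diff_distrib sum.distrib sum_subtractf)
  also have "\<dots> = 0 \<longleftrightarrow> (\<forall>t\<in>odd_tuples N k. \<forall>a\<le>?w t. coeff (norm_sum (?w t) (?q t)) a = 0)"
    by (rule sum_hom_eval_eq_0_iff)
  also have "\<dots> \<longleftrightarrow> (\<forall>t\<in>odd_tuples N k. slice N t (piV N (2 + k) P) \<in> W2 (N - sum_list t))"
  proof (intro ball_cong refl)
    fix t assume "t \<in> odd_tuples N k"
    have "degree (norm_sum (?w t) (?q t)) \<le> ?w t"
      unfolding norm_sum_def by (intro degree_add_le degree_diff_le) (simp_all only: degree_tau vec_upoly_props degree_flip)
    then have "(\<forall>a\<le>?w t. coeff (norm_sum (?w t) (?q t)) a = 0) \<longleftrightarrow> norm_sum (?w t) (?q t) = 0"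
      by (metis coeff_0 leading_coeff_0_iff)
    also have "\<dots> \<longleftrightarrow> ?q t = tau (?q t) - flip (?w t) (tau (?q t))"
      by (auto simp: norm_sum_def algebra_simps)
    also have "\<dots> \<longleftrightarrow> ?q t \<in> period_polys (?w t)"
      using vec_upoly_props[of "N - sum_list t" "slice N t (piV N (2 + k) P)"] by (auto simp: period_polys_def)
    also have "\<dots> \<longleftrightarrow> slice N t (piV N (2 + k) P) \<in> W2 (N - sum_list t)"
      by (auto simp: W2_def supp_on_def pull_def)
    finally show "(\<forall>a\<le>?w t. coeff (norm_sum (?w t) (?q t)) a = 0) \<longleftrightarrow> slice N t (piV N (2 + k) P) \<in> W2 (N - sum_list t)" .
  qed
  finally show ?thesis .
qed

section \<open>The maps phi on W\<close>

lemma W_antisym: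
  assumes "P \<in> W N (2 + k)" "a # b # t \<in> S N (2 + k)"
  shows "piV N (2 + k) P (a # b # t) = - piV N (2 + k) P (b # a # t)"
proof -
  let ?v = "piV N (2 + k) P"
  let ?M = "N - sum_list t"
  have t: "t \<in> odd_tuples N k" and ab: "[a, b] \<in> S ?M 2"
    using append_in_S_iff[of "[a, b]" 2 t N k] assms(2) by auto
  have ba: "[b, a] \<in> S ?M 2" using ab by (auto simp: S_def)
  have s: "a + b = ?M" "3 \<le> a" "3 \<le> b" using ab by (auto simp: S_def)
  have "P \<in> V N (2 + k)" using assms(1) by (simp add: W_def)
  then have "vec_upoly ?M (slice N t ?v) \<in> period_polys (?M - 2)"
    using W_iff_slices assms(1) t by (auto simp: W2_def)
  then have "flip (?M - 2) (vec_upoly ?M (slice N t ?v)) = - vec_upoly ?M (slice N t ?v)"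
    by (rule period_polys_anti)
  then have "coeff (flip (?M - 2) (vec_upoly ?M (slice N t ?v))) (a - 1) = - coeff (vec_upoly ?M (slice N t ?v)) (a - 1)"
    by simp
  moreover have "?M - 2 - (a - 1) = b - 1" "a - 1 \<le> ?M - 2" "[a - 1 + 1, ?M - 1 - (a - 1)] = [a, b]"
     "[b - 1 + 1, ?M - 1 - (b - 1)] = [b, a]" using s by auto
  ultimately have "slice N t ?v [b, a] = - slice N t ?v [a, b]"
    unfolding coeff_flip coeff_vec_upoly using ab ba by (simp only: if_True)
  then show ?thesis using ab ba by (simp add: pull_def)
qed

text \<open>Exchanging the first two entries permutes the index set and, by
  \<open>W_antisym\<close>, negates the coefficients.\<close>

lemma psubst_swap:
  assumes P: "P \<in> W N (2 + k)"
  shows "psubst (\<lambda>i. \<sigma> (if i = 0 then 1 else if i = 1 then 0 else i)) P = - psubst \<sigma> P"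
proof -
  let ?sw = "\<lambda>i :: nat. if i = 0 then 1 else if i = 1 then 0 else i"
  let ?sl = "\<lambda>n :: nat list. n ! 1 # n ! 0 # drop 2 n"
  let ?v = "piV N (2 + k) P"
  have PV: "P \<in> V N (2 + k)" using P by (simp add: W_def)
  have form: "\<exists>a b t. n = a # b # t" if "n \<in> S N (2 + k)" for n
    using S_D(1)[OF that] by (cases n rule: remdups_adj.cases) auto
  have mem: "b # a # t \<in> S N (2 + k)" if "a # b # t \<in> S N (2 + k)" for a b t
    using that by (auto simp: S_def)
  have pr: "(\<Prod>i<2 + k. \<rho> i ^ (dec (a # b # t) ! i)) = \<rho> 0 ^ (a - 1) * \<rho> 1 ^ (b - 1) * (\<Prod>i<k. \<rho> (Suc (Suc i)) ^ (dec t ! i))"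
    for a b t and \<rho> :: "nat \<Rightarrow> mpoly"
    unfolding add_2_eq_Suc prod.lessThan_Suc_shift by (simp add: dec_def mult_ac)
  have "psubst (\<lambda>i. \<sigma> (?sw i)) P = (\<Sum>n\<in>S N (2 + k). const (?v n) * (\<Prod>i<2 + k. \<sigma> (?sw i) ^ (dec n ! i)))"
    by (rule psubst_V[OF PV])
  also have "\<dots> = (\<Sum>n\<in>S N (2 + k). const (- ?v n) * (\<Prod>i<2 + k. \<sigma> i ^ (dec n ! i)))"
  proof (rule sum.reindex_bij_witness[where i = ?sl and j = ?sl])
    fix n assume n: "n \<in> S N (2 + k)"
    then obtain a b t where abt: "n = a # b # t" using form by blast
    show "?sl n \<in> S N (2 + k)" using n mem abt by simp
    show "?sl (?sl n) = n" using abt by simp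
    have "(\<Prod>i<2 + k. \<sigma> i ^ (dec (b # a # t) ! i)) = (\<Prod>i<2 + k. \<sigma> (?sw i) ^ (dec (a # b # t) ! i))"
      unfolding pr by (simp add: mult_ac)
    moreover have "- ?v (b # a # t) = ?v (a # b # t)" using W_antisym[OF P, of a b t] n abt by simp
    moreover have "?sl n = b # a # t" using abt by simp
    ultimately show "const (- ?v (?sl n)) * (\<Prod>i<2 + k. \<sigma> i ^ (dec (?sl n) ! i)) =
        const (?v n) * (\<Prod>i<2 + k. \<sigma> (?sw i) ^ (dec n ! i))" unfolding abt by presburger
  next
    fix n assume n: "n \<in> S N (2 + k)"
    then obtain a b t where abt: "n = a # b # t" using form by blast
    show "?sl n \<in> S N (2 + k)" using n mem abt by simp
    show "?sl (?sl n) = n" using abt by simp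
  qed
  also have "\<dots> = - psubst \<sigma> P" unfolding psubst_V[OF PV] const_uminus mult_minus_left sum_negf ..
  finally show ?thesis .
qed

lemma rtep_V: "P \<in> V N r \<Longrightarrow> rtep r P = P"
proof (rule poly_mapping_eqI)
  fix m assume P: "P \<in> V N r"
  show "lookup (rtep r P) m = lookup P m"
  proof (cases "m \<in> keys P")
    case True
    then obtain n where "n \<in> S N r" "m = expo (dec n)" using P by (auto simp: V_def)
    then show ?thesis using lookup_expo_dec_even by (auto simp: lookup_rtep)
  next
    case False then show ?thesis by (auto simp: lookup_rtep in_keys_iff)
  qed
qed

text \<open>The \<open>i = 1\<close> terms of \<open>\<phi>\<^sup>(\<^sup>r\<^sup>)\<close> cancel \<open>P\<close> by the relation defining \<open>W\<close>; antisymmetry turns the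
  remaining ones into those of \<open>\<phi>\<^sup>(\<^sup>r\<^sup>-\<^sup>1\<^sup>)\<close>.\<close>

lemma phi_W:
  assumes P: "P \<in> W N (2 + k)"
  shows "phi N (2 + k) (2 + k) P = P - phi N (2 + k) (1 + k) P"
proof -
  let ?r = "2 + k"
  have PV: "P \<in> V N ?r" using P by (simp add: W_def)
  let ?X = "\<lambda>i. psubst (phisubst ?r (1 + k) i (Suc i - 1)) P - psubst (phisubst ?r (1 + k) i (i - 1)) P"
  let ?Y = "\<lambda>i. psubst (phisubst ?r ?r i (Suc i)) P - psubst (phisubst ?r ?r i i) P"
  have A: "phisubst ?r ?r 0 0 = (\<lambda>i. if i = 0 then var 1 - var 0 else if i = 1 then var 1 else var i)"
    by (auto simp: phisubst_def omit_def fun_eq_iff)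
  have B: "phisubst ?r ?r 0 (Suc 0) = (\<lambda>i. if i = 0 then var 1 - var 0 else if i = 1 then var 0 else var i)"
    by (auto simp: phisubst_def omit_def fun_eq_iff)
  have "P = psubst (phisubst ?r ?r 0 0) P - psubst (phisubst ?r ?r 0 (Suc 0)) P"
    unfolding A B using P unfolding W_def by blast
  from arg_cong[OF this, of uminus, symmetric] have Y0: "?Y 0 = - P" unfolding minus_diff_eq .
  \<comment> \<open>In depth \<open>r\<close> the difference sits in slot 0 and x_1 follows; in
    depth r-1 it is the reverse. After the swap the omitted position, counted from x_2 instead of
    x_1, drops by one.\<close>
  have sw: "phisubst ?r ?r i (Suc l) = (\<lambda>p. phisubst ?r (1 + k) i l (if p = 0 then 1 else if p = 1 then 0 else p))" for i l
  proof
    fix p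
    show "phisubst ?r ?r i (Suc l) p = phisubst ?r (1 + k) i l (if p = 0 then 1 else if p = 1 then 0 else p)"
    proof (cases "p < 2")
      case True then show ?thesis by (auto simp: phisubst_def omit_def)
    next
      case False
      then obtain q where "p = Suc (Suc q)" by (metis add_2_eq_Suc le_Suc_ex not_less)
      then show ?thesis by (simp add: phisubst_def omit_def)
    qed
  qed
  have YX: "?Y i = - ?X i" if i: "1 \<le> i" for i
  proof -
    obtain l where l: "i = Suc l" using i by (cases i) auto
    have "psubst (phisubst ?r ?r i (Suc i)) P = - psubst (phisubst ?r (1 + k) i i) P"
      "psubst (phisubst ?r ?r i i) P = - psubst (phisubst ?r (1 + k) i l) P"
      using psubst_swap[OF P, of "phisubst ?r (1 + k) i i"] psubst_swap[OF P, of "phisubst ?r (1 + k) i l"]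
      by (simp_all only: sw l)
    then show ?thesis by (simp add: l)
  qed
  have "(\<Sum>i\<in>{0..<1 + k}. ?Y i) = ?Y 0 + (\<Sum>i\<in>{1..<1 + k}. ?Y i)"
    by (subst sum.atLeast_Suc_lessThan) auto
  also have "\<dots> = - P - (\<Sum>i\<in>{1..<1 + k}. ?X i)"
    unfolding Y0 using YX by (simp add: sum_negf[symmetric] sum_subtractf[symmetric])
  finally have "P + (\<Sum>i\<in>{0..<1 + k}. ?Y i) = P - (P + (\<Sum>i\<in>{1..<1 + k}. ?X i))" by simp
  then have "rtep ?r (P + (\<Sum>i\<in>{0..<1 + k}. ?Y i)) = P - rtep ?r (P + (\<Sum>i\<in>{1..<1 + k}. ?X i))"
    by (simp only: rtep_diff rtep_V[OF PV])
  then show ?thesis by (simp add: phi_def)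
qed

definition Wvec :: "nat \<Rightarrow> nat \<Rightarrow> (nat list \<Rightarrow> rat) set" where
  "Wvec N k = {v \<in> supp_on (S N (2 + k)). \<forall>t\<in>odd_tuples N k. slice N t v \<in> W2 (N - sum_list t)}"

lemma piV_image_W: "piV N (2 + k) ` W N (2 + k) = Wvec N k"
proof (intro equalityI subsetI)
  fix v assume "v \<in> piV N (2 + k) ` W N (2 + k)"
  then show "v \<in> Wvec N k" using W_iff_slices piV_supp by (auto simp: Wvec_def W_def)
next
  fix v assume v: "v \<in> Wvec N k"
  then have e: "piV N (2 + k) (vec_poly N (2 + k) v) = v" using piV_vec_poly by (auto simp: Wvec_def)
  then have "vec_poly N (2 + k) v \<in> W N (2 + k)" using W_iff_slices[OF vec_poly_V] v by (auto simp: Wvec_def)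
  then show "v \<in> piV N (2 + k) ` W N (2 + k)" using e by (metis image_eqI)
qed

lemma piV_0: "piV N r 0 = 0"
  by (auto simp: piV_def fun_eq_iff)

lemma Emat_eq_Ej: "Emat N r = Ej N r r"
  by (simp add: Emat_def Ej_def)

lemma rowmul_0: "rowmul I 0 A = 0"
  by (auto simp: rowmul_def fun_eq_iff)

text \<open>If E^(r-1) kills \<open>v\<close>, then \<open>phi_W\<close> gives v E = v. So v F = 0,
  and (H) applies.\<close>

lemma Wvec_inj:
  assumes "hypH" "1 \<le> k" "v \<in> Wvec N k" and z: "rowmul (S N (2 + k)) v (Ej N (2 + k) (1 + k)) = 0"
  shows "v = 0"
proof -
  let ?r = "2 + k"
  obtain P where P: "P \<in> W N ?r" "v = piV N ?r P" using assms(3) piV_image_W by blast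
  have PV: "P \<in> V N ?r" using P by (simp add: W_def)
  have V0: "0 \<in> V N ?r" by (simp add: V_def)
  have W0: "0 \<in> W N ?r" using V0 by (simp add: W_def)
  have "piV N ?r (phi N ?r (1 + k) P) = piV N ?r 0"
    using piV_phi[OF PV, of "1 + k"] z P(2) assms(2) by (simp add: piV_0)
  then have "phi N ?r (1 + k) P = 0" using piV_inj phi_V[OF PV] V0 by blast
  then have "phi N ?r ?r P = P" using phi_W[OF P(1)] by simp
  then have E: "rowmul (S N ?r) v (Emat N ?r) = v"
    using piV_phi[OF PV, of ?r] P(2) by (simp add: Emat_eq_Ej)
  have "rowmul (S N ?r) v (Fmat N ?r) = rowmul (S N ?r) v (Emat N ?r) - v"
  proof
    fix n
    have "(\<Sum>m\<in>S N ?r. v m * (if m = n then 1 else 0)) = (if n \<in> S N ?r then v n else 0)"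
      using finite_S by (simp add: if_distrib[of "(*) _"] cong: if_cong)
    moreover have "v n = 0" if "n \<notin> S N ?r" using that P(2) by (simp add: piV_def)
    ultimately show "rowmul (S N ?r) v (Fmat N ?r) n = (rowmul (S N ?r) v (Emat N ?r) - v) n"
      by (auto simp: rowmul_def Fmat_def right_diff_distrib sum_subtractf)
  qed
  then have "rowmul (S N ?r) (piV N ?r P) (Fmat N ?r) = rowmul (S N ?r) (piV N ?r 0) (Fmat N ?r)"
    using E P(2) by (simp add: piV_0 rowmul_0)
  moreover have "inj_on (\<lambda>P. rowmul (S N ?r) (piV N ?r P) (Fmat N ?r)) (W N ?r)"
    using assms(1) unfolding hypH_def by simp
  ultimately have "P = 0" using P(1) W0 by (auto dest: inj_onD)
  then show ?thesis using P(2) piV_0 by simp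
qed

text \<open>Multiplies by E^(2) ... E^(j-1). The bound is exclusive: \<open>j = r\<close> gives the
  product \<open>A\<close>, \<open>j = Suc r\<close> gives all of \<open>C\<close>, and
  \<open>j\<close> up to 2 gives the identity.\<close>

definition row_chain :: "nat \<Rightarrow> nat \<Rightarrow> nat \<Rightarrow> (nat list \<Rightarrow> rat) \<Rightarrow> (nat list \<Rightarrow> rat)" where
  "row_chain N r j v = fold (\<lambda>j v. rowmul (S N r) v (Ej N r j)) [2..<j] v"

lemma row_chain_le2: "j \<le> 2 \<Longrightarrow> row_chain N r j v = v"
  by (simp add: row_chain_def)

lemma row_chain_Suc: "2 \<le> j \<Longrightarrow> row_chain N r (Suc j) v = rowmul (S N r) (row_chain N r j v) (Ej N r j)"
  by (simp add: row_chain_def)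

lemma row_chain_induct [case_names base step]:
  assumes "\<And>j. j \<le> 2 \<Longrightarrow> Q j" "\<And>j. 2 \<le> j \<Longrightarrow> Q j \<Longrightarrow> Q (Suc j)"
  shows "Q j"
proof (induction j)
  case (Suc j)
  then show ?case using assms(1)[of "Suc j"] assms(2)[of j] by (cases "j < 2") auto
qed (use assms in auto)

lemma linear_row_chain: "Vector_Spaces.linear fscale fscale (row_chain N r j)"
proof (induction j rule: row_chain_induct)
  case (base j)
  then show ?case by (intro fv_linearI) (auto simp: row_chain_le2)
next
  case (step j)
  have "row_chain N r (Suc j) = (\<lambda>v. rowmul (S N r) v (Ej N r j)) \<circ> row_chain N r j"
    using step by (auto simp: row_chain_Suc)
  then show ?case using Vector_Spaces.linear_compose[OF step(2) linear_rowmul] by metis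
qed

lemma rowmul_supp: "rowmul I v A \<in> supp_on I"
  by (auto simp: rowmul_def supp_on_def)

lemma row_chain_supp: "v \<in> supp_on (S N r) \<Longrightarrow> row_chain N r j v \<in> supp_on (S N r)"
  by (induction j rule: row_chain_induct) (auto simp: row_chain_le2 row_chain_Suc rowmul_supp)

lemma phicomp_row_chain:
  assumes "P \<in> V N r"
  shows "phicomp N r P \<in> V N r \<and> piV N r (phicomp N r P) = row_chain N r r (piV N r P)"
proof -
  have "j \<le> r \<or> j \<le> 2 \<Longrightarrow> fold (\<lambda>j f. phi N r j \<circ> f) [2..<j] id P \<in> V N r \<and>
      piV N r (fold (\<lambda>j f. phi N r j \<circ> f) [2..<j] id P) = row_chain N r j (piV N r P)" for j
  proof (induction j rule: row_chain_induct)
    case (base j) then show ?case using assms by (simp add: row_chain_le2)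
  next
    case (step j) then show ?case using phi_V piV_phi[of _ N r j] by (auto simp: row_chain_Suc)
  qed
  then show ?thesis by (simp add: phicomp_def)
qed

lemma rowmul_matmul:
  assumes "finite I" shows "rowmul I v (matmul I A B) = rowmul I (rowmul I v A) B"
proof
  fix n
  have "(\<Sum>m\<in>I. v m * (\<Sum>k\<in>I. A m k * B k n)) = (\<Sum>k\<in>I. (\<Sum>m\<in>I. v m * A m k) * B k n)"
  proof -
    have "(\<Sum>m\<in>I. v m * (\<Sum>k\<in>I. A m k * B k n)) = (\<Sum>m\<in>I. \<Sum>k\<in>I. v m * A m k * B k n)"
      by (simp only: sum_distrib_left mult.assoc)
    also have "\<dots> = (\<Sum>k\<in>I. \<Sum>m\<in>I. v m * A m k * B k n)" by (rule sum.swap)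
    finally show ?thesis by (simp only: sum_distrib_right)
  qed
  then show "rowmul I v (matmul I A B) n = rowmul I (rowmul I v A) B n"
    by (simp add: rowmul_def matmul_def)
qed

lemma rowmul_foldr_matmul:
  assumes "finite I"
  shows "rowmul I v (foldr (\<lambda>j A. matmul I (B j) A) js E) = rowmul I (fold (\<lambda>j v. rowmul I v (B j)) js v) E"
  by (induction js arbitrary: v) (simp_all add: rowmul_matmul[OF assms])

text \<open>The left kernel of \<open>C\<close> for r >= 2. For r = 1 the product is empty and the
  space is zero, in agreement with T_1 = 0, so one formula serves all depths in the
  recursion.\<close>

definition Kvec :: "nat \<Rightarrow> nat \<Rightarrow> (nat list \<Rightarrow> rat) set" where
  "Kvec N r = {v \<in> supp_on (S N r). row_chain N r (Suc r) v = 0}"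

lemma subspace_Kvec: "fv.subspace (Kvec N r)"
  unfolding Kvec_def by (rule subspace_kernel_on[OF linear_row_chain subspace_supp_on])

lemma lkernel_Cmat:
  assumes "2 \<le> r" shows "lkernel (S N r) (Cmat N r) = Kvec N r"
  unfolding lkernel_eq Kvec_def Cmat_def rowmul_foldr_matmul[OF finite_S] row_chain_Suc[OF assms] Emat_eq_Ej
  by (simp add: row_chain_def)

lemma S_0: "1 \<le> r \<Longrightarrow> S 0 r = {}"
  using S_ge by fastforce

lemma dim_Kvec_trivial: "supp_on (S N r) \<inter> Kvec N r \<subseteq> {0} \<Longrightarrow> fv.dim (Kvec N r) = 0"
proof -
  assume "supp_on (S N r) \<inter> Kvec N r \<subseteq> {0}"
  then have "Kvec N r = {0}" using subspace_Kvec[of N r] fv.subspace_0 by (fastforce simp: Kvec_def)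
  then show ?thesis by (simp add: fv.dim_zero_space)
qed

lemma Tser_nth:
  assumes "1 \<le> r" shows "fps_nth (Tser r) N = of_nat (fv.dim (Kvec N r))"
proof (cases "r = 1")
  case True
  have "row_chain N 1 (Suc 1) v = v" for v by (rule row_chain_le2) simp
  then have "fv.dim (Kvec N 1) = 0" by (intro dim_Kvec_trivial) (auto simp: Kvec_def)
  then show ?thesis using True by (simp add: Tser_def)
next
  case False
  then have r: "2 \<le> r" using assms by simp
  show ?thesis
  proof (cases "N = 0")
    case True
    have "supp_on (S 0 r) \<subseteq> {0}" using S_0[OF assms] by (auto simp: supp_on_def fun_eq_0_iff)
    then have "fv.dim (Kvec 0 r) = 0" by (intro dim_Kvec_trivial) auto
    then show ?thesis using True r by (simp add: Tser_def)
  next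
    case False
    then show ?thesis using r
      by (simp add: Tser_def qdim_eq_dim dim_rkernel_eq_lkernel[OF finite_S] lkernel_Cmat)
  qed
qed

section \<open>Splitting off leading coordinates\<close>

lemma sum_S_split':
  "(\<Sum>n\<in>S N (s + k). f n) = (\<Sum>p\<in>odd_tuples N s. \<Sum>t\<in>S (N - sum_list p) k. f (p @ t))"
proof -
  have "(\<Sum>p\<in>odd_tuples N s. \<Sum>t\<in>S (N - sum_list p) k. f (p @ t)) =
      (\<Sum>(p, t)\<in>(SIGMA p:odd_tuples N s. S (N - sum_list p) k). f (p @ t))"
    by (rule sum.Sigma) (auto simp: finite_S finite_odd_tuples)
  also have "\<dots> = (\<Sum>n\<in>S N (s + k). f n)"
  proof (rule sum.reindex_bij_witness[where i = "\<lambda>n. (take s n, drop s n)" and j = "\<lambda>(p, t). p @ t"])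
    fix n assume n: "n \<in> S N (s + k)"
    have "take s n @ drop s n \<in> S N (s + k)" "length (take s n) = s" using n S_D(1)[OF n] by auto
    then show "(take s n, drop s n) \<in> (SIGMA p:odd_tuples N s. S (N - sum_list p) k)"
      using append_in_S_iff' by blast
  next
    fix tp assume "tp \<in> (SIGMA p:odd_tuples N s. S (N - sum_list p) k)"
    then obtain t p where tp: "tp = (p, t)" "p \<in> odd_tuples N s" "t \<in> S (N - sum_list p) k" by auto
    then have l: "length p = s" by (auto simp: odd_tuples_iff S_def)
    then show "(case tp of (p, t) \<Rightarrow> p @ t) \<in> S N (s + k)" using tp append_in_S_iff'[OF l] by simp
    show "(take s (case tp of (p, t) \<Rightarrow> p @ t), drop s (case tp of (p, t) \<Rightarrow> p @ t)) = tp" using tp l by simp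
  qed auto
  finally show ?thesis by simp
qed

abbreviation (input) strip :: "nat \<Rightarrow> nat \<Rightarrow> nat list \<Rightarrow> (nat list \<Rightarrow> rat) \<Rightarrow> (nat list \<Rightarrow> rat)" where
  "strip N k p v \<equiv> pull (\<lambda>t. p @ t) (S (N - sum_list p) k) v"

lemma length_odd_tuples: "p \<in> odd_tuples N s \<Longrightarrow> length p = s"
  by (auto simp: odd_tuples_iff S_def)

text \<open>For j <= k the delta in E^(j) forces the first \<open>s\<close> coordinates to agree, so
  the matrix is block diagonal, with the depth-k matrix as each block.\<close>

lemma strip_rowmul_Ej:
  assumes p: "p \<in> odd_tuples N s" and j: "j \<le> k"
  shows "strip N k p (rowmul (S N (s + k)) v (Ej N (s + k) j)) =
    rowmul (S (N - sum_list p) k) (strip N k p v) (Ej (N - sum_list p) k j)"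
proof
  fix n
  let ?M = "N - sum_list p"
  show "strip N k p (rowmul (S N (s + k)) v (Ej N (s + k) j)) n = rowmul (S ?M k) (strip N k p v) (Ej ?M k j) n"
  proof (cases "n \<in> S ?M k")
    case True
    have mem: "p @ n \<in> S N (s + k)" using append_in_S_iff'[OF length_odd_tuples[OF p]] p True by blast
    have lp: "length p = s" using length_odd_tuples[OF p] .
    have d: "s + k - j = s + (k - j)" using j by simp
    have e: "Ej N (s + k) j (q @ m) (p @ n) = (if q = p then Ej ?M k j m n else 0)"
      if "q \<in> odd_tuples N s" for q m
      using length_odd_tuples[OF that] lp by (auto simp: Ej_def d)
    have "rowmul (S N (s + k)) v (Ej N (s + k) j) (p @ n) =
       (\<Sum>q\<in>odd_tuples N s. \<Sum>m\<in>S (N - sum_list q) k. v (q @ m) * Ej N (s + k) j (q @ m) (p @ n))"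
      using mem by (simp add: rowmul_def sum_S_split')
    also have "\<dots> = (\<Sum>q\<in>odd_tuples N s. if q = p then (\<Sum>m\<in>S ?M k. v (p @ m) * Ej ?M k j m n) else 0)"
      by (intro sum.cong refl) (auto simp: e)
    also have "\<dots> = (\<Sum>m\<in>S ?M k. v (p @ m) * Ej ?M k j m n)" using p finite_odd_tuples by simp
    finally show ?thesis using True by (simp add: pull_def rowmul_def)
  next
    case False then show ?thesis by (simp add: pull_def rowmul_def)
  qed
qed

lemma strip_row_chain:
  assumes "p \<in> odd_tuples N s" "j \<le> Suc k"
  shows "strip N k p (row_chain N (s + k) j v) = row_chain (N - sum_list p) k j (strip N k p v)"
  using assms(2)
proof (induction j rule: row_chain_induct)
  case (base j) then show ?case by (simp add: row_chain_le2)
next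
  case (step j) then show ?case using strip_rowmul_Ej[OF assms(1), of j k] by (simp add: row_chain_Suc)
qed

lemma eq_0_iff_strips:
  assumes "u \<in> supp_on (S N (s + k))"
  shows "u = 0 \<longleftrightarrow> (\<forall>p\<in>odd_tuples N s. strip N k p u = 0)"
proof
  assume z: "\<forall>p\<in>odd_tuples N s. strip N k p u = 0"
  show "u = 0" unfolding fun_eq_0_iff
  proof
    fix n show "u n = 0"
    proof (cases "n \<in> S N (s + k)")
      case True
      then have "take s n @ drop s n \<in> S N (s + k)" "length (take s n) = s" using S_D(1)[OF True] by auto
      then have "take s n \<in> odd_tuples N s" "drop s n \<in> S (N - sum_list (take s n)) k"
        using append_in_S_iff' by blast+
      moreover from this have "strip N k (take s n) u (drop s n) = 0" using z by simp
      ultimately show ?thesis by (simp add: pull_def)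
    next
      case False then show ?thesis using assms by (simp add: supp_on_def)
    qed
  qed
qed simp

lemma S_union_strips: "(\<Union>p\<in>odd_tuples N s. (\<lambda>t. p @ t) ` S (N - sum_list p) k) = S N (s + k)"
proof (intro equalityI subsetI)
  fix n assume "n \<in> (\<Union>p\<in>odd_tuples N s. (\<lambda>t. p @ t) ` S (N - sum_list p) k)"
  then show "n \<in> S N (s + k)" using append_in_S_iff' length_odd_tuples by blast
next
  fix n assume n: "n \<in> S N (s + k)"
  then have "take s n @ drop s n \<in> S N (s + k)" "length (take s n) = s" using S_D(1)[OF n] by auto
  then have "take s n \<in> odd_tuples N s" "drop s n \<in> S (N - sum_list (take s n)) k"
    using append_in_S_iff' by blast+
  then show "n \<in> (\<Union>p\<in>odd_tuples N s. (\<lambda>t. p @ t) ` S (N - sum_list p) k)"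
    by (intro UN_I[of "take s n"] image_eqI[of _ _ "drop s n"]) simp_all
qed

lemma pull_supp: "pull h B v \<in> supp_on B"
  by (auto simp: pull_def supp_on_def)

lemma dim_strip_blocks:
  assumes "J \<subseteq> odd_tuples N s" and "\<And>M. fv.subspace (K M)" "\<And>M. K M \<subseteq> supp_on (S M k)"
  shows "fv.dim {v \<in> supp_on (\<Union>p\<in>J. (\<lambda>t. p @ t) ` S (N - sum_list p) k). \<forall>p\<in>J. strip N k p v \<in> K (N - sum_list p)}
    = (\<Sum>p\<in>J. fv.dim (K (N - sum_list p)))"
proof (rule dim_blocks)
  show "finite J" using assms(1) finite_odd_tuples finite_subset by blast
  fix i j x y assume ij: "i \<in> J" "j \<in> J" "i @ x = j @ y"
  then have "length i = length j" using assms(1) length_odd_tuples[of _ N s] by (metis subsetD)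
  then show "i = j" using ij(3) by simp
qed (simp_all add: assms finite_S inj_on_def)

text \<open>With one coordinate split off, the product up to E^(k) in depth 1+k is, on each strip,
  the full product for depth \<open>k\<close>. Hence the kernel is a direct sum of copies of
  \<open>Kvec\<close>.\<close>

lemma dim_ker_row_chain:
  "fv.dim {v \<in> supp_on (S N (1 + k)). row_chain N (1 + k) (1 + k) v = 0} = (\<Sum>p\<in>odd_tuples N 1. fv.dim (Kvec (N - sum_list p) k))"
proof -
  have "{v \<in> supp_on (S N (1 + k)). row_chain N (1 + k) (1 + k) v = 0} =
      {v \<in> supp_on (\<Union>p\<in>odd_tuples N 1. (\<lambda>t. p @ t) ` S (N - sum_list p) k).
        \<forall>p\<in>odd_tuples N 1. strip N k p v \<in> Kvec (N - sum_list p) k}"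
    unfolding S_union_strips
  proof (rule Collect_cong, rule conj_cong[OF refl])
    fix v assume v: "v \<in> supp_on (S N (1 + k))"
    have "row_chain N (1 + k) (1 + k) v = 0 \<longleftrightarrow> (\<forall>p\<in>odd_tuples N 1. strip N k p (row_chain N (1 + k) (1 + k) v) = 0)"
      by (rule eq_0_iff_strips[OF row_chain_supp[OF v]])
    also have "\<dots> \<longleftrightarrow> (\<forall>p\<in>odd_tuples N 1. strip N k p v \<in> Kvec (N - sum_list p) k)"
      using strip_row_chain[of _ N 1 "Suc k" k v] by (auto simp: Kvec_def pull_supp)
    finally show "row_chain N (1 + k) (1 + k) v = 0 \<longleftrightarrow> (\<forall>p\<in>odd_tuples N 1. strip N k p v \<in> Kvec (N - sum_list p) k)" .
  qed
  also have "fv.dim \<dots> = (\<Sum>p\<in>odd_tuples N 1. fv.dim (Kvec (N - sum_list p) k))"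
    by (rule dim_strip_blocks[OF order_refl]) (simp_all add: subspace_Kvec, simp add: Kvec_def)
  finally show ?thesis .
qed

section \<open>Dimensions and generating series\<close>

lemma W2_supp: "W2 N \<subseteq> supp_on (S N 2)"
  by (auto simp: W2_def)

lemma linear_vec_upoly: "Vector_Spaces.linear fscale smult (vec_upoly N)"
  by (intro Vector_Spaces.linear_iff[THEN iffD2] conjI allI pv.vector_space_axioms fv.vector_space_axioms)
    (auto intro!: poly_eqI simp: coeff_vec_upoly)

lemma subspace_period_polys: "pv.subspace (period_polys w)"
proof -
  have "period_polys w = even_anti w \<inter> {p. norm_sum w p = 0}" by (auto simp: period_polys_eq_kernel)
  then show ?thesis
    using pv_pair.linear_subspace_kernel[OF linear_norm_sum] subspace_even_anti pv.subspace_inter by metis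
qed

lemma subspace_W2: "fv.subspace (W2 N)"
proof -
  have "W2 N = supp_on (S N 2) \<inter> {u. vec_upoly N u \<in> period_polys (N - 2)}" by (auto simp: W2_def)
  then show ?thesis
    using fv_pv.linear_subspace_linear_preimage[OF linear_vec_upoly subspace_period_polys]
      subspace_supp_on fv.subspace_inter by metis
qed

lemma S2_empty: "odd N \<or> N = 0 \<Longrightarrow> S N 2 = {}"
proof -
  assume N: "odd N \<or> N = 0"
  have False if p: "p \<in> S N 2" for p
  proof -
    obtain a where "even a" "a + 2 \<le> N" "even (N - 2 - a)" using p unfolding S2_iff by blast
    then show False using N by auto
  qed
  then show ?thesis by blast
qed

lemma dim_W2_even: "fv.dim (W2 (2 * h + 2)) = (h - 1) div 2 - h div 3"
proof -
  let ?N = "2 * h + 2"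
  obtain B where B: "finite B" "supp_on (S ?N 2) \<subseteq> fv.span B" using supp_on_finite_span[OF finite_S, of ?N 2] by auto
  have sp: "W2 ?N \<subseteq> fv.span B" using W2_supp B(2) by blast
  have "pv.dim (vec_upoly ?N ` W2 ?N) = fv.dim (W2 ?N)"
  proof (rule fv_pv.dim_image_inj_on[OF linear_vec_upoly subspace_W2 B(1) sp])
    fix u assume u: "u \<in> W2 ?N" "vec_upoly ?N u = 0"
    show "u = 0" unfolding fun_eq_0_iff
    proof
      fix p show "u p = 0"
      proof (cases "p \<in> S ?N 2")
        case True
        then obtain a where a: "p = [a + 1, ?N - 1 - a]" by (auto simp: S2_iff)
        have "coeff (vec_upoly ?N u) a = 0" using u(2) by simp
        then show ?thesis using True unfolding coeff_vec_upoly a by (simp only: if_True)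
      next
        case False then show ?thesis using u(1) by (auto simp: W2_def supp_on_def)
      qed
    qed
  qed
  moreover have "vec_upoly ?N ` W2 ?N = period_polys (2 * h)"
  proof (intro equalityI subsetI)
    fix q assume "q \<in> vec_upoly ?N ` W2 ?N" then show "q \<in> period_polys (2 * h)" by (auto simp: W2_def)
  next
    fix q assume q: "q \<in> period_polys (2 * h)"
    define u where "u p = (if p \<in> S ?N 2 then coeff q (p ! 0 - 1) else 0)" for p
    have "vec_upoly ?N u = q"
    proof (rule poly_eqI)
      fix a
      have "coeff q a = 0" if "[a + 1, ?N - 1 - a] \<notin> S ?N 2"
      proof (rule ccontr)
        assume c: "coeff q a \<noteq> 0"
        have "even a" using q c by (auto simp: period_polys_def even_poly_def)
        moreover have "coeff q 0 = 0" "coeff q (2 * h) = 0" using q by (simp_all add: period_polys_def)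
        then have "a \<noteq> 0" "a \<noteq> 2 * h" using c by metis+
        moreover have "a \<le> 2 * h" using q c le_degree[of q a] by (simp add: period_polys_def)
        ultimately have "2 \<le> a" "a + 2 \<le> 2 * h" "even a" by presburger+
        then have "[a + 1, ?N - 1 - a] \<in> S ?N 2" by (auto simp: S2_iff)
        then show False using that by blast
      qed
      then show "coeff (vec_upoly ?N u) a = coeff q a" by (auto simp: coeff_vec_upoly u_def)
    qed
    moreover have "u \<in> supp_on (S ?N 2)" by (simp add: u_def supp_on_def)
    ultimately show "q \<in> vec_upoly ?N ` W2 ?N" using q by (intro image_eqI[of _ _ u]) (auto simp: W2_def)
  qed
  ultimately show ?thesis using dim_period_polys by simp
qed

lemma dim_W2_empty: "odd N \<or> N = 0 \<Longrightarrow> fv.dim (W2 N) = 0"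
proof -
  assume "odd N \<or> N = 0"
  then have "W2 N \<subseteq> {0}" using S2_empty[of N] by (auto simp: W2_def supp_on_def fun_eq_0_iff)
  then have "W2 N = {0}" using fv.subspace_0[OF subspace_W2] by blast
  then show ?thesis by (simp add: fv.dim_zero_space)
qed

lemma subspace_strips:
  assumes "\<And>M. fv.subspace (K M)"
  shows "fv.subspace {v \<in> Wvec N k. \<forall>p\<in>odd_tuples N 2. strip N k p v \<in> K (N - sum_list p)}"
proof -
  have "{v \<in> Wvec N k. \<forall>p\<in>odd_tuples N 2. strip N k p v \<in> K (N - sum_list p)} =
     {v \<in> supp_on (S N (2 + k)). \<forall>t\<in>odd_tuples N k. slice N t v \<in> W2 (N - sum_list t)} \<inter>
     {v \<in> supp_on (S N (2 + k)). \<forall>p\<in>odd_tuples N 2. strip N k p v \<in> K (N - sum_list p)}"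
    by (auto simp: Wvec_def)
  moreover have "fv.subspace \<dots>"
    by (intro fv.subspace_inter subspace_blocks subspace_W2 assms)
  ultimately show ?thesis by simp
qed

text \<open>Choosing pivots for each \<open>W2 a\<close> identifies the tensor product with a direct sum of copies of
  the \<open>K M\<close>.\<close>

lemma dim_tensor:
  assumes K: "\<And>M. fv.subspace (K M)" "\<And>M. K M \<subseteq> supp_on (S M k)"
  shows "fv.dim {v \<in> Wvec N k. \<forall>p\<in>odd_tuples N 2. strip N k p v \<in> K (N - sum_list p)} =
    (\<Sum>a\<le>N. fv.dim (W2 a) * fv.dim (K (N - a)))"
proof -
  let ?L = "{v \<in> Wvec N k. \<forall>p\<in>odd_tuples N 2. strip N k p v \<in> K (N - sum_list p)}"
  have "\<forall>a. \<exists>X M. X \<subseteq> S a 2 \<and> dual_basis (W2 a) X M"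
    using dual_basis_exists[OF finite_S subspace_W2 W2_supp] by blast
  then obtain X D where X: "\<And>a. X a \<subseteq> S a 2" and D: "\<And>a. dual_basis (W2 a) (X a) (D a)" by metis
  \<comment> \<open>\<open>J\<close> below collects the pivots of all \<open>W2 a\<close>; a vector
    of the tensor product will be recovered from its strips at these heads.\<close>
  have finX: "finite (X a)" for a using X finite_S finite_subset by blast
  have sumX: "sum_list p = a" if "p \<in> X a" for p a using that X S_D(2) by blast
  define J where "J = (\<Union>a\<le>N. X a)"
  have J: "J \<subseteq> odd_tuples N 2" using X by (auto simp: J_def odd_tuples_def)
  have J_iff: "p \<in> J \<longleftrightarrow> p \<in> X (sum_list p) \<and> sum_list p \<le> N" for p
    using sumX by (auto simp: J_def)
  define I where "I = (\<Union>p\<in>J. (\<lambda>t. p @ t) ` S (N - sum_list p) k)"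
  have I: "I \<subseteq> S N (2 + k)" unfolding I_def S_union_strips[symmetric] using J by blast
  have I_iff: "p @ t \<in> I \<longleftrightarrow> p \<in> J \<and> t \<in> S (N - sum_list p) k" if "length p = 2" for p t
  proof
    assume "p @ t \<in> I"
    then obtain q s where q: "q \<in> J" "s \<in> S (N - sum_list q) k" "p @ t = q @ s" by (auto simp: I_def)
    then have "length q = 2" using J length_odd_tuples by blast
    then have "p = q" "t = s" using q(3) that by auto
    then show "p \<in> J \<and> t \<in> S (N - sum_list p) k" using q by simp
  qed (auto simp: I_def)
  let ?L' = "{v \<in> supp_on I. \<forall>p\<in>J. strip N k p v \<in> K (N - sum_list p)}"
  \<comment> \<open>\<open>\<rho>\<close> keeps only the entries with a pivot as head. It is
    injective because each slice lies in some \<open>W2 a\<close> and is determined by its pivot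
    values.\<close>
  define \<rho> where "\<rho> v = (\<lambda>n. if n \<in> I then v n else 0)" for v :: "nat list \<Rightarrow> rat"
  have lin: "Vector_Spaces.linear fscale fscale \<rho>"
    by (rule fv_linearI) (auto simp: \<rho>_def)
  have Lsupp: "?L \<subseteq> supp_on (S N (2 + k))" by (auto simp: Wvec_def)
  have strip_\<rho>: "strip N k p (\<rho> v) = strip N k p v" if "p \<in> J" for p v
    using that I_iff J length_odd_tuples by (fastforce simp: pull_def \<rho>_def fun_eq_iff)
  have "fv.dim (\<rho> ` ?L) = fv.dim ?L"
  proof (rule fv_dim_image_inj[OF lin subspace_strips[OF K(1)] finite_S Lsupp])
    fix v assume v: "v \<in> ?L" "\<rho> v = 0"
    have sl: "slice N t v = 0" if t: "t \<in> odd_tuples N k" for t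
    proof (rule dual_basisD(2)[OF D])
      show "slice N t v \<in> W2 (N - sum_list t)" using v(1) t by (simp add: Wvec_def)
      fix p assume p: "p \<in> X (N - sum_list t)"
      then have pS: "p \<in> S (N - sum_list t) 2" using X by blast
      have "p @ t \<in> I"
      proof (subst I_iff)
        show "length p = 2" using pS S_D(1) by blast
        have "sum_list p = N - sum_list t" using sumX p by blast
        moreover have "sum_list t \<le> N" "t \<in> S (sum_list t) k" using t by (auto simp: odd_tuples_iff)
        ultimately show "p \<in> J \<and> t \<in> S (N - sum_list p) k" using p by (simp add: J_iff)
      qed
      then have "v (p @ t) = 0" using fun_cong[OF v(2), of "p @ t"] by (simp add: \<rho>_def)
      then show "slice N t v p = 0" by (simp add: pull_def)
    qed
    show "v = 0" unfolding fun_eq_0_iff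
    proof
      fix n show "v n = 0"
      proof (cases "n \<in> S N (2 + k)")
        case True
        then have n: "take 2 n @ drop 2 n \<in> S N (2 + k)" "length (take 2 n) = 2" using S_D(1)[OF True] by auto
        then have d: "drop 2 n \<in> odd_tuples N k" "take 2 n \<in> S (N - sum_list (drop 2 n)) 2"
          using append_in_S_iff by blast+
        then show ?thesis using fun_cong[OF sl[OF d(1)], of "take 2 n"] by (simp add: pull_def)
      next
        case False then show ?thesis using v(1) Lsupp by (auto simp: supp_on_def)
      qed
    qed
  qed
  moreover have "\<rho> ` ?L = ?L'"
  proof (intro equalityI subsetI)
    fix u assume "u \<in> \<rho> ` ?L"
    then obtain v where v: "v \<in> ?L" "u = \<rho> v" by blast
    have "u \<in> supp_on I" by (simp add: v \<rho>_def supp_on_def)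
    then show "u \<in> ?L'" using v J strip_\<rho> by auto
  next
    fix u assume u: "u \<in> ?L'"
    \<comment> \<open>The inverse of \<open>\<rho>\<close>: the entry at head \<open>p\<close>
      combines the pivot entries with coefficients \<open>D a q p\<close>. Its slices are then
      combinations of the vectors \<open>D a q\<close> in \<open>W2 a\<close>, its strips
      combinations of the given strips in the \<open>K\<close> of the same weight.\<close>
    define v where "v n = (if n \<in> S N (2 + k) then
        \<Sum>q\<in>X (sum_list (take 2 n)). u (q @ drop 2 n) * D (sum_list (take 2 n)) q (take 2 n) else 0)" for n
    have v_app: "v (p @ t) = (\<Sum>q\<in>X (sum_list p). u (q @ t) * D (sum_list p) q p)"
      if "p @ t \<in> S N (2 + k)" "length p = 2" for p t
      using that by (simp add: v_def)
    have "v \<in> Wvec N k" unfolding Wvec_def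
    proof (intro CollectI conjI ballI)
      show "v \<in> supp_on (S N (2 + k))" by (simp add: v_def supp_on_def)
      fix t assume t: "t \<in> odd_tuples N k"
      let ?a = "N - sum_list t"
      have "slice N t v = (\<Sum>q\<in>X ?a. fscale (u (q @ t)) (D ?a q))"
      proof
        fix p
        show "slice N t v p = (\<Sum>q\<in>X ?a. fscale (u (q @ t)) (D ?a q)) p"
        proof (cases "p \<in> S ?a 2")
          case True
          then have "length p = 2" "sum_list p = ?a" using S_D by blast+
          moreover from this have "p @ t \<in> S N (2 + k)" using append_in_S_iff t True by blast
          ultimately show ?thesis using True by (simp add: pull_def v_app sum_fun_apply)
        next
          case False
          then have "D ?a q p = 0" if "q \<in> X ?a" for q
            using dual_basisD(1)[OF D that] W2_supp by (auto simp: supp_on_def)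
          then show ?thesis using False by (simp add: pull_def sum_fun_apply)
        qed
      qed
      also have "\<dots> \<in> W2 ?a"
        by (intro fv.subspace_sum fv.subspace_scale subspace_W2 dual_basisD(1)[OF D])
      finally show "slice N t v \<in> W2 ?a" .
    qed
    moreover have "strip N k p v \<in> K (N - sum_list p)" if p: "p \<in> odd_tuples N 2" for p
    proof -
      let ?a = "sum_list p"
      have le: "?a \<le> N" using p by (simp add: odd_tuples_iff)
      have lp: "length p = 2" using p length_odd_tuples by blast
      have "strip N k p v = (\<Sum>q\<in>X ?a. fscale (D ?a q p) (strip N k q u))"
      proof
        fix t
        show "strip N k p v t = (\<Sum>q\<in>X ?a. fscale (D ?a q p) (strip N k q u)) t"
        proof (cases "t \<in> S (N - ?a) k")
          case True
          then have "p @ t \<in> S N (2 + k)" using append_in_S_iff'[OF lp] p by blast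
          then show ?thesis using True lp sumX
            by (simp add: pull_def v_app sum_fun_apply mult.commute)
        next
          case False then show ?thesis using sumX by (simp add: pull_def sum_fun_apply)
        qed
      qed
      also have "\<dots> \<in> K (N - ?a)"
      proof (intro fv.subspace_sum fv.subspace_scale K(1))
        fix q assume q: "q \<in> X ?a"
        then have "q \<in> J" using sumX[OF q] le by (simp add: J_iff)
        then show "strip N k q u \<in> K (N - ?a)" using u sumX[OF q] by auto
      qed
      finally show ?thesis .
    qed
    moreover have "\<rho> v = u"
    proof
      fix n
      show "\<rho> v n = u n"
      proof (cases "n \<in> I")
        case True
        then obtain p t where pt: "p \<in> J" "t \<in> S (N - sum_list p) k" "n = p @ t" by (auto simp: I_def)
        have lp: "length p = 2" using J pt(1) length_odd_tuples by blast
        have pX: "p \<in> X (sum_list p)" using pt(1) J_iff by blast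
        have "v n = (\<Sum>q\<in>X (sum_list p). u (q @ t) * D (sum_list p) q p)"
          unfolding pt(3) using True I pt(3) lp by (intro v_app) auto
        also have "\<dots> = u n" using dual_basis_sum[OF D finX pX] pt(3) by simp
        finally show ?thesis using True by (simp add: \<rho>_def)
      next
        case False then show ?thesis using u by (simp add: \<rho>_def supp_on_def)
      qed
    qed
    ultimately show "u \<in> \<rho> ` ?L" by blast
  qed
  moreover have "fv.dim ?L' = (\<Sum>p\<in>J. fv.dim (K (N - sum_list p)))"
    unfolding I_def by (rule dim_strip_blocks[OF J K])
  moreover have "\<dots> = (\<Sum>a\<le>N. \<Sum>p\<in>X a. fv.dim (K (N - sum_list p)))"
    unfolding J_def
  proof (rule sum.UNION_disjoint)
    show "\<forall>i\<in>{..N}. \<forall>j\<in>{..N}. i \<noteq> j \<longrightarrow> X i \<inter> X j = {}" using sumX by blast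
  qed (simp_all add: finX)
  moreover have "\<dots> = (\<Sum>a\<le>N. card (X a) * fv.dim (K (N - a)))"
    using sumX by (intro sum.cong refl) simp
  moreover have "card (X a) = fv.dim (W2 a)" for a
    using dim_dual_basis[OF D finX subspace_W2] by simp
  ultimately show ?thesis by simp
qed

lemma dim_Wvec: "fv.dim (Wvec N k) = (\<Sum>a\<le>N. fv.dim (W2 a) * card (S (N - a) k))"
proof -
  have "Wvec N k = {v \<in> Wvec N k. \<forall>p\<in>odd_tuples N 2. strip N k p v \<in> supp_on (S (N - sum_list p) k)}"
    by (auto simp: pull_supp)
  also have "fv.dim \<dots> = (\<Sum>a\<le>N. fv.dim (W2 a) * fv.dim (supp_on (S (N - a) k)))"
    by (rule dim_tensor) (auto simp: subspace_supp_on)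
  finally show ?thesis by (simp add: dim_supp_on finite_S)
qed

lemma subspace_Wvec: "fv.subspace (Wvec N k)"
  unfolding Wvec_def by (intro subspace_blocks subspace_W2)

lemma linear_expand:
  fixes f :: "('a \<Rightarrow> rat) \<Rightarrow> 'b \<Rightarrow> rat"
  assumes "Vector_Spaces.linear fscale fscale f" "finite A" "u \<in> supp_on A"
  shows "f u y = (\<Sum>x\<in>A. u x * f (\<lambda>z. if x = z then 1 else 0) y)"
proof -
  have "u = (\<Sum>x\<in>A. fscale (u x) (\<lambda>z. if x = z then 1 else 0))"
    using dual_basis_expand[OF dual_basis_supp_on assms(2) subspace_supp_on assms(3)] .
  then have "f u = (\<Sum>x\<in>A. fscale (u x) (f (\<lambda>z. if x = z then 1 else 0)))"
    using fv_pair.linear_sum[OF assms(1), of "\<lambda>x. fscale (u x) (\<lambda>z. if x = z then 1 else 0)" A]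
      fv_pair.linear_scale[OF assms(1)] by simp
  then show ?thesis by (simp add: sum_fun_apply)
qed

text \<open>The factors up to E^(k) recombine tails of equal weight with coefficients that do not
  depend on the head. Each slice of the result is thus a linear combination of slices lying in one
  space \<open>W2\<close>.\<close>

lemma row_chain_Wvec:
  assumes v: "v \<in> Wvec N k" and j: "j \<le> Suc k"
  shows "row_chain N (2 + k) j v \<in> Wvec N k"
  unfolding Wvec_def
proof (intro CollectI conjI ballI)
  show "row_chain N (2 + k) j v \<in> supp_on (S N (2 + k))" using v by (intro row_chain_supp) (simp add: Wvec_def)
  fix t assume t: "t \<in> odd_tuples N k"
  let ?M = "sum_list t"
  \<comment> \<open>The matrix entry of the depth-k product at row \<open>m\<close> and column
    \<open>t\<close>.\<close>
  define c where "c m = row_chain ?M k j (\<lambda>z. if m = z then 1 else 0) t" for m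
  have M: "?M \<le> N" "t \<in> S ?M k" using t by (auto simp: odd_tuples_iff)
  have "slice N t (row_chain N (2 + k) j v) = (\<Sum>m\<in>S ?M k. fscale (c m) (slice N m v))"
  proof
    fix p
    show "slice N t (row_chain N (2 + k) j v) p = (\<Sum>m\<in>S ?M k. fscale (c m) (slice N m v)) p"
    proof (cases "p \<in> S (N - ?M) 2")
      case True
      then have sp: "sum_list p = N - ?M" using S_D by blast
      then have p: "p \<in> odd_tuples N 2" using True by (simp add: odd_tuples_iff)
      have Np: "N - sum_list p = ?M" using sp M by simp
      have "row_chain N (2 + k) j v (p @ t) = strip N k p (row_chain N (2 + k) j v) t"
        using M Np by (simp add: pull_def)
      also have "\<dots> = row_chain ?M k j (strip N k p v) t" using strip_row_chain[OF p j] Np by simp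
      also have "\<dots> = (\<Sum>m\<in>S ?M k. strip N k p v m * c m)"
        unfolding c_def using Np pull_supp[of _ "S ?M k" v] by (intro linear_expand linear_row_chain finite_S) simp
      also have "\<dots> = (\<Sum>m\<in>S ?M k. c m * slice N m v p)"
      proof (intro sum.cong refl)
        fix m assume m: "m \<in> S ?M k"
        then have "sum_list m = ?M" using S_D by blast
        then show "strip N k p v m * c m = c m * slice N m v p" using m True Np by (simp add: pull_def)
      qed
      finally show ?thesis using True by (simp add: pull_def sum_fun_apply)
    next
      case False
      have "slice N m v p = 0" if "m \<in> S ?M k" for m using that False S_D(2)[OF that] by (simp add: pull_def)
      then show ?thesis using False by (simp add: pull_def sum_fun_apply)
    qed
  qed
  also have "\<dots> \<in> W2 (N - ?M)"
  proof (intro fv.subspace_sum fv.subspace_scale subspace_W2)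
    fix m assume m: "m \<in> S ?M k"
    then have "sum_list m = ?M" using S_D by blast
    moreover from this have "m \<in> odd_tuples N k" using m M by (simp add: odd_tuples_iff)
    ultimately show "slice N m v \<in> W2 (N - ?M)" using v by (auto simp: Wvec_def)
  qed
  finally show "slice N t (row_chain N (2 + k) j v) \<in> W2 (N - ?M)" .
qed

lemma dim_Wvec_ker:
  assumes "hypH" "1 \<le> k"
  shows "fv.dim {v \<in> Wvec N k. row_chain N (2 + k) (2 + k) v = 0} = (\<Sum>a\<le>N. fv.dim (W2 a) * fv.dim (Kvec (N - a) k))"
proof -
  have "{v \<in> Wvec N k. row_chain N (2 + k) (2 + k) v = 0} =
     {v \<in> Wvec N k. \<forall>p\<in>odd_tuples N 2. strip N k p v \<in> Kvec (N - sum_list p) k}"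
  proof (rule Collect_cong, rule conj_cong[OF refl])
    fix v assume v: "v \<in> Wvec N k"
    have "row_chain N (2 + k) (2 + k) v = rowmul (S N (2 + k)) (row_chain N (2 + k) (1 + k) v) (Ej N (2 + k) (1 + k))"
      using row_chain_Suc[of "1 + k"] assms(2) by simp
    then have "row_chain N (2 + k) (2 + k) v = 0 \<longleftrightarrow> row_chain N (2 + k) (1 + k) v = 0"
      using Wvec_inj[OF assms row_chain_Wvec[OF v, of "1 + k"]] rowmul_0 by auto
    also have "\<dots> \<longleftrightarrow> (\<forall>p\<in>odd_tuples N 2. strip N k p (row_chain N (2 + k) (1 + k) v) = 0)"
      using v by (intro eq_0_iff_strips row_chain_supp) (simp add: Wvec_def)
    also have "\<dots> \<longleftrightarrow> (\<forall>p\<in>odd_tuples N 2. strip N k p v \<in> Kvec (N - sum_list p) k)"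
      using strip_row_chain[of _ N 2 "Suc k" k v] by (auto simp: Kvec_def pull_supp)
    finally show "row_chain N (2 + k) (2 + k) v = 0 \<longleftrightarrow> (\<forall>p\<in>odd_tuples N 2. strip N k p v \<in> Kvec (N - sum_list p) k)" .
  qed
  also have "fv.dim \<dots> = (\<Sum>a\<le>N. fv.dim (W2 a) * fv.dim (Kvec (N - a) k))"
    by (rule dim_tensor) (simp_all add: subspace_Kvec, simp add: Kvec_def)
  finally show ?thesis .
qed

text \<open>(G) in coordinates: \<open>A\<close> maps the left kernel of A E onto the part of its
  image killed by E, which is the right-hand side of (G).\<close>

lemma row_chain_image_Kvec:
  assumes "hypG" "1 \<le> k"
  shows "row_chain N (2 + k) (2 + k) ` Kvec N (2 + k) = row_chain N (2 + k) (2 + k) ` Wvec N k"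
proof -
  let ?r = "2 + k"
  let ?E = "\<lambda>v. rowmul (S N ?r) v (Ej N ?r ?r)"
  have im: "piV N ?r ` (phicomp N ?r ` Y) = row_chain N ?r ?r ` (piV N ?r ` Y)" if "Y \<subseteq> V N ?r" for Y
    using phicomp_row_chain that by (force simp: image_image intro!: image_cong)
  have "piV N ?r ` ({Q \<in> V N ?r. phi N ?r ?r Q = 0} \<inter> phicomp N ?r ` V N ?r) =
      {u \<in> row_chain N ?r ?r ` supp_on (S N ?r). ?E u = 0}"
  proof (intro equalityI subsetI)
    fix u assume "u \<in> piV N ?r ` ({Q \<in> V N ?r. phi N ?r ?r Q = 0} \<inter> phicomp N ?r ` V N ?r)"
    then obtain Q where Q: "u = piV N ?r Q" "Q \<in> V N ?r" "phi N ?r ?r Q = 0" "Q \<in> phicomp N ?r ` V N ?r" by blast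
    have "u \<in> piV N ?r ` (phicomp N ?r ` V N ?r)" using Q by blast
    then have "u \<in> row_chain N ?r ?r ` supp_on (S N ?r)" using im[OF order_refl] piV_image_V by simp
    moreover have "?E u = 0" using piV_phi[OF Q(2), of ?r] Q by (simp add: piV_0)
    ultimately show "u \<in> {u \<in> row_chain N ?r ?r ` supp_on (S N ?r). ?E u = 0}" by blast
  next
    fix u assume u: "u \<in> {u \<in> row_chain N ?r ?r ` supp_on (S N ?r). ?E u = 0}"
    then have "u \<in> piV N ?r ` (phicomp N ?r ` V N ?r)" using im[OF order_refl] piV_image_V by simp
    then obtain Q where Q: "u = piV N ?r Q" "Q \<in> phicomp N ?r ` V N ?r" by blast
    then have QV: "Q \<in> V N ?r" using phicomp_row_chain by blast
    have "piV N ?r (phi N ?r ?r Q) = piV N ?r 0" using piV_phi[OF QV, of ?r] Q u by (simp add: piV_0)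
    moreover have "0 \<in> V N ?r" by (simp add: V_def)
    ultimately have "phi N ?r ?r Q = 0" using piV_inj[OF phi_V[OF QV]] by blast
    then show "u \<in> piV N ?r ` ({Q \<in> V N ?r. phi N ?r ?r Q = 0} \<inter> phicomp N ?r ` V N ?r)" using Q QV by blast
  qed
  moreover have "phicomp N ?r ` W N ?r = {Q \<in> V N ?r. phi N ?r ?r Q = 0} \<inter> phicomp N ?r ` V N ?r"
  proof -
    have "3 \<le> ?r" using assms(2) by simp
    then show ?thesis using assms(1) unfolding hypG_def by blast
  qed
  moreover have "piV N ?r ` (phicomp N ?r ` W N ?r) = row_chain N ?r ?r ` Wvec N k"
    using im[of "W N ?r"] piV_image_W by (auto simp: W_def)
  moreover have "row_chain N ?r ?r ` Kvec N ?r = {u \<in> row_chain N ?r ?r ` supp_on (S N ?r). ?E u = 0}"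
    unfolding Kvec_def using row_chain_Suc[of ?r N ?r] by auto
  ultimately show ?thesis by simp
qed

lemma dim_Kvec_recursion:
  assumes "hypH" "hypG" "1 \<le> k"
  shows "fv.dim (Kvec N (2 + k)) + (\<Sum>a\<le>N. fv.dim (W2 a) * fv.dim (Kvec (N - a) k)) =
    (\<Sum>p\<in>odd_tuples N 1. fv.dim (Kvec (N - sum_list p) (1 + k))) + (\<Sum>a\<le>N. fv.dim (W2 a) * card (S (N - a) k))"
proof -
  let ?r = "2 + k"
  have "fv.dim (Kvec N ?r) = fv.dim {v \<in> Kvec N ?r. row_chain N ?r ?r v = 0} + fv.dim (row_chain N ?r ?r ` Kvec N ?r)"
    by (rule fv_rank_nullity[OF linear_row_chain subspace_Kvec finite_S]) (auto simp: Kvec_def)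
  \<comment> \<open>Whatever \<open>A\<close> kills, \<open>C\<close> kills as well, so the kernel
    of \<open>A\<close> on \<open>Kvec\<close> is its full left kernel.\<close>
  moreover have "{v \<in> Kvec N ?r. row_chain N ?r ?r v = 0} = {v \<in> supp_on (S N (1 + (1 + k))). row_chain N (1 + (1 + k)) (1 + (1 + k)) v = 0}"
    unfolding Kvec_def using row_chain_Suc[of ?r N ?r] rowmul_0 by auto
  moreover have "fv.dim (Wvec N k) = fv.dim {v \<in> Wvec N k. row_chain N ?r ?r v = 0} + fv.dim (row_chain N ?r ?r ` Wvec N k)"
    by (rule fv_rank_nullity[OF linear_row_chain subspace_Wvec finite_S]) (auto simp: Wvec_def)
  ultimately show ?thesis
    using dim_Wvec_ker[OF assms(1,3)] row_chain_image_Kvec[OF assms(2,3)] dim_Wvec dim_ker_row_chain[of N "1 + k"] by simp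
qed

section \<open>Coefficients of the generating series\<close>

lemma fps_divide_eqI:
  fixes a b c :: "rat fps"
  assumes "fps_nth b 0 \<noteq> 0" "c * b = a"
  shows "a / b = c"
proof -
  have "b \<noteq> 0" using assms(1) by auto
  then show ?thesis using assms(2) by (metis nonzero_mult_div_cancel_right)
qed

lemma Oser_nth: "fps_nth Oser n = (if odd n \<and> 3 \<le> n then 1 else 0)"
proof -
  let ?c = "Abs_fps (\<lambda>n. if odd n \<and> 3 \<le> n then 1 else 0) :: rat fps"
  have "?c * (1 - fps_X ^ 2) = fps_X ^ 3"
  proof (rule fps_ext)
    fix n
    have "fps_nth (?c * (1 - fps_X ^ 2)) n = fps_nth ?c n - (if n < 2 then 0 else fps_nth ?c (n - 2))"
      by (simp add: right_diff_distrib fps_X_power_mult_right_nth)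
    also have "\<dots> = fps_nth (fps_X ^ 3) n"
    proof -
      have "n < 3 \<or> n = 3 \<or> n = 4 \<or> (\<exists>m. n = m + 5)" by presburger
      then consider "n < 3" | "n = 3" | "n = 4" | m where "n = m + 5" by blast
      then show ?thesis by cases (auto simp: fps_X_power_nth)
    qed
    finally show "fps_nth (?c * (1 - fps_X ^ 2)) n = fps_nth (fps_X ^ 3) n" .
  qed
  then have "Oser = ?c" unfolding Oser_def by (intro fps_divide_eqI) auto
  then have "fps_nth Oser n = fps_nth ?c n" by (rule arg_cong)
  then show ?thesis unfolding fps_nth_Abs_fps .
qed

text \<open>Multiplying by the denominator 1 - x^4 - x^6 + x^10 turns the claim into a recurrence
  for the dimensions with the single source term at n = 12.\<close>

lemma Sser_nth: "fps_nth Sser N = of_nat (fv.dim (W2 N))"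
proof -
  define s :: "nat \<Rightarrow> nat" where "s N = fv.dim (W2 N)" for N
  have s_odd: "s N = 0" if "odd N" for N using that dim_W2_empty by (simp add: s_def)
  have s_even: "s (2 * k) = (if k = 0 then 0 else (k - 2) div 2 - (k - 1) div 3)" for k
  proof (cases k)
    case 0 then show ?thesis using dim_W2_empty[of 0] by (simp add: s_def)
  next
    case (Suc h) then show ?thesis using dim_W2_even[of h] by (simp add: s_def)
  qed
  have s_even2: "s (2 * (j + 2)) = j div 2 - (j + 1) div 3" for j
    using s_even[of "j + 2"] by simp
  let ?c = "Abs_fps (\<lambda>n. of_nat (s n)) :: rat fps"
  have "?c * ((1 - fps_X ^ 4) * (1 - fps_X ^ 6)) = fps_X ^ 12"
  proof (rule fps_ext)
    fix n
    have e: "?c * ((1 - fps_X ^ 4) * (1 - fps_X ^ 6)) = ?c - ?c * fps_X ^ 4 - ?c * fps_X ^ 6 + ?c * fps_X ^ 10"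
      by (simp add: algebra_simps power_add[symmetric])
    have "fps_nth (?c * ((1 - fps_X ^ 4) * (1 - fps_X ^ 6))) n = of_nat (s n) - (if n < 4 then 0 else of_nat (s (n - 4)))
      - (if n < 6 then 0 else of_nat (s (n - 6))) + (if n < 10 then 0 else of_nat (s (n - 10)))"
      unfolding e by (simp add: fps_X_power_mult_right_nth)
    also have "\<dots> = of_nat (s n + (if n < 10 then 0 else s (n - 10)))
        - of_nat ((if n < 4 then 0 else s (n - 4)) + (if n < 6 then 0 else s (n - 6)))"
      by simp
    also have "s n + (if n < 10 then 0 else s (n - 10)) =
        ((if n < 4 then 0 else s (n - 4)) + (if n < 6 then 0 else s (n - 6))) + (if n = 12 then 1 else 0)"
    proof (cases "odd n")
      case True then show ?thesis by (auto simp: s_odd)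
    next
      case False
      then obtain k where k: "n = 2 * k" by (meson evenE)
      have d: "2 * k - 4 = 2 * (k - 2)" "2 * k - 6 = 2 * (k - 3)" "2 * k - 10 = 2 * (k - 5)" by auto
      \<comment> \<open>From k = 7 on all four arguments are at least 4, so \<open>s_even2\<close>
        covers them. The inequalities \<open>le\<close> then exclude truncation, and the quotients
        shift by whole periods. Smaller \<open>k\<close> are evaluated directly.\<close>
      have "k \<le> 6 \<or> (\<exists>m. k = m + 7)" by presburger
      then consider "k \<le> 6" | m where "k = m + 7" by blast
      then show ?thesis
      proof cases
        case 1
        then have "k \<in> {0, 1, 2, 3, 4, 5, 6}" by auto
        then show ?thesis unfolding k d s_even by auto
      next
        case 2
        define A where "A = (m + 3) div 2"
        define B where "B = m div 2"
        define C where "C = (m + 2 + 1) div 3"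
        define D where "D = (m + 1) div 3"
        have shift: "(m + 5) div 2 = A + 1" "(m + 2) div 2 = B + 1" "(m + 5 + 1) div 3 = C + 1" "(m + 3 + 1) div 3 = D + 1"
          unfolding A_def B_def C_def D_def by presburger+
        have le: "D \<le> B" "C \<le> B + 1" "D + 1 \<le> A" "C \<le> A"
          unfolding A_def B_def C_def D_def by presburger+
        have n: "n = 2 * (m + 5 + 2)" "n - 4 = 2 * (m + 3 + 2)" "n - 6 = 2 * (m + 2 + 2)" "n - 10 = 2 * (m + 2)"
          using k 2 by simp_all
        note s_even2[of "m + 5", folded n(1), unfolded shift]
          s_even2[of "m + 3", folded n(2) A_def, unfolded shift]
          s_even2[of "m + 2", folded n(3) C_def, unfolded shift]
          s_even2[of m, folded n(4) B_def D_def]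
        moreover have "\<not> n < 10" "n \<noteq> 12" using k 2 by simp_all
        ultimately show ?thesis using le by simp
      qed
    qed
    finally show "fps_nth (?c * ((1 - fps_X ^ 4) * (1 - fps_X ^ 6))) n = fps_nth (fps_X ^ 12) n"
      by (simp add: fps_X_power_nth)
  qed
  then have "Sser = ?c" unfolding Sser_def by (intro fps_divide_eqI) auto
  then have "fps_nth Sser N = fps_nth ?c N" by (rule arg_cong)
  then show ?thesis unfolding fps_nth_Abs_fps s_def .
qed

text \<open>The heads of length one are the odd numbers from 3 on, the exponents occurring in O(x);
  summing over heads is therefore convolution with that series.\<close>

lemma sum_odd_tuples_1:
  "(\<Sum>p\<in>odd_tuples N 1. f (sum_list p)) = (\<Sum>i\<le>N. fps_nth Oser i * f i)" for f :: "nat \<Rightarrow> rat"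
proof -
  have "odd_tuples N 1 = (\<lambda>i. [i]) ` {i \<in> {..N}. odd i \<and> 3 \<le> i}"
    by (auto simp: odd_tuples_iff S_def length_Suc_conv)
  then have "(\<Sum>p\<in>odd_tuples N 1. f (sum_list p)) = (\<Sum>i\<in>{i \<in> {..N}. odd i \<and> 3 \<le> i}. f i)"
    by (simp add: sum.reindex inj_on_def)
  also have "\<dots> = (\<Sum>i\<le>N. if odd i \<and> 3 \<le> i then f i else 0)" by (rule sum.inter_filter) simp
  also have "\<dots> = (\<Sum>i\<le>N. fps_nth Oser i * f i)" by (intro sum.cong) (auto simp: Oser_nth)
  finally show ?thesis .
qed

lemma card_S: "of_nat (card (S N k)) = fps_nth (Oser ^ k) N"
proof (induction k arbitrary: N)
  case 0
  have "S N 0 = (if N = 0 then {[]} else {})" by (auto simp: S_def)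
  then show ?case by simp
next
  case (Suc k)
  have "card (S N (Suc k)) = (\<Sum>p\<in>odd_tuples N 1. card (S (N - sum_list p) k))"
    using sum_S_split'[of "\<lambda>_. 1 :: nat" N 1 k] by simp
  then have "of_nat (card (S N (Suc k))) = (\<Sum>p\<in>odd_tuples N 1. fps_nth (Oser ^ k) (N - sum_list p))"
    using Suc by simp
  also have "\<dots> = (\<Sum>i\<le>N. fps_nth Oser i * fps_nth (Oser ^ k) (N - i))" by (rule sum_odd_tuples_1)
  finally show ?case by (simp add: fps_mult_nth atLeast0AtMost)
qed

theorem theorem5p2:
  fixes r :: nat
  assumes "hypH" and "hypG" and "3 \<le> r"
  shows "Tser r = Oser * Tser (r - 1) - Sser * Tser (r - 2) + Oser ^ (r - 2) * Sser"
proof (rule fps_ext)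
  fix N
  define k where "k = r - 2"
  have k: "1 \<le> k" "r = 2 + k" "r - 1 = 1 + k" using assms(3) by (auto simp: k_def)
  have "fps_nth (Tser r) N + fps_nth (Sser * Tser k) N = fps_nth (Oser * Tser (1 + k)) N + fps_nth (Sser * Oser ^ k) N"
  proof -
    have "fps_nth (Oser * Tser (1 + k)) N = (\<Sum>p\<in>odd_tuples N 1. of_nat (fv.dim (Kvec (N - sum_list p) (1 + k))))"
      unfolding fps_mult_nth atLeast0AtMost
      using sum_odd_tuples_1[of "\<lambda>i. of_nat (fv.dim (Kvec (N - i) (1 + k)))" N] by (simp add: Tser_nth)
    moreover have "fps_nth (Sser * Tser k) N = (\<Sum>a\<le>N. of_nat (fv.dim (W2 a) * fv.dim (Kvec (N - a) k)))"
      unfolding fps_mult_nth atLeast0AtMost using k(1) by (simp add: Tser_nth Sser_nth)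
    moreover have "fps_nth (Sser * Oser ^ k) N = (\<Sum>a\<le>N. of_nat (fv.dim (W2 a) * card (S (N - a) k)))"
      unfolding fps_mult_nth atLeast0AtMost by (simp add: card_S Sser_nth)
    moreover have "fps_nth (Tser r) N = of_nat (fv.dim (Kvec N (2 + k)))" using k by (simp add: Tser_nth)
    ultimately show ?thesis
      using arg_cong[OF dim_Kvec_recursion[OF assms(1,2) k(1), of N], of "of_nat :: nat \<Rightarrow> rat"] by simp
  qed
  then show "fps_nth (Tser r) N = fps_nth (Oser * Tser (r - 1) - Sser * Tser (r - 2) + Oser ^ (r - 2) * Sser) N"
    unfolding k(3) k_def[symmetric] by (simp add: mult.commute)
qed

end
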